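(* Let $K$ be a field and let $A$ be a $G$-algebra over $K$ in the variables $x_1,\ldots,x_n,\partial$ (in this order, i.e. $\partial$ plays the role of $x_{n+1}$). Assume that the $K$-algebra generated by $x_1,\ldots,x_n$ subject only to those defining relations of $A$ that involve pairs of variables from $\{x_1,\ldots,x_n\}$ is itself a $G$-algebra; denote this $G$-algebra by $B$ (a subalgebra of $A$), and put $B^*=B\setminus\{0\}$. Suppose there exists an admissible monomial ordering $\prec$ on $A$ satisfying $x_k\prec\partial$ for all $1\le k\le n$. Then: (1) $B^*$ is a multiplicatively closed Ore set in $A$. (2) The Ore localization $(B^* )^{-1}A$ of $A$ with respect to $B^*$ can be presented as an Ore extension of $\mathrm{Quot}(B)$ by the variable $\partial$, i.e. $(B^* )^{-1}A\cong \mathrm{Quot}(B)[\partial;\sigma,\delta]$ for some ring endomorphism $\sigma$ of $\mathrm{Quot}(B)$ and some $\sigma$-derivation $\delta$ of $\mathrm{Quot}(B)$.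
   Context: **$G$-algebra.** Let $A$ be the quotient of the free associative algebra $K\langle x_1,\ldots,x_m\rangle$ by the two-sided ideal $I$ generated by the elements $x_jx_i-c_{ij}x_ix_j-d_{ij}$ for all $1\le i<j\le m$, where $c_{ij}\in K\setminus\{0\}$ and the $d_{ij}$ are polynomials given in terms of standard monomials $x_1^{a_1}\cdots x_m^{a_m}$. $A$ is called a $G$-algebra (in the variables $x_1,\dots,x_m$) if: (a) for all $1\le i<j<k\le m$ the expression $c_{ik}c_{jk}d_{ij}x_k-x_kd_{ij}+c_{jk}x_jd_{ik}-c_{ij}d_{ik}x_j+d_{jk}x_i-c_{ij}c_{ik}x_id_{jk}$ reduces to zero modulo $I$; and (b) there exists a monomial ordering $\prec$ on $K[x_1,\ldots,x_m]$ such that $\mathrm{lm}(d_{ij})\prec x_ix_j$ for all $i<j$ with $d_{ij}\neq 0$, where $\mathrm{lm}$ denotes the leading monomial. An ordering satisfying (b) is called admissible. All monomial orderings are assumed to be well-orderings. A $G$-algebra is a Noetherian integral domain, and $\mathrm{Quot}(A)$ denotes its total two-sided ring of fractions (a skew field). The standard monomials form a $K$-basis of a $G$-algebra. **Ore set and localization.** A multiplicatively closed set $S$ in a Noetherian integral domain $A$ with $0\notin S$ is an Ore set in $A$ if for all $s_1\in S$, $a_1\in A$ there exist $s_2\in S$, $a_2\in A$ with $a_1s_2=s_1a_2$. The Ore localization $S^{-1}A$ is a ring $A_S$ together with an injective homomorphism $\phi:A\to A_S$ such that (i) $\phi(s)$ is a unit in $A_S$ for all $s\in S$, and (ii) every $f\in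 A_S$ has the form $f=\phi(s)^{-1}\phi(a)$ with $a\in A$, $s\in S$. **Ore extension.** For a $K$-algebra $C$, a ring endomorphism $\sigma:C\to C$ and a $\sigma$-derivation $\delta:C\to C$ (a $K$-linear map with $\delta(ab)=\sigma(a)\delta(b)+\delta(a)b$), the Ore extension $C[\partial;\sigma,\delta]$ is the ring of all polynomials in $\partial$ with coefficients (written on the left) in $C$, with usual addition and product defined by $\partial a=\sigma(a)\partial+\delta(a)$ for $a\in C$. *)

theory Defs
  imports "HOL-Algebra.QuotRing" "HOL-Algebra.UnivPoly" "HOL-Library.Poly_Mapping"
begin

section \<open>Free associative algebras\<close>

text \<open>The free monoid on a type of letters. It is written additively (\<open>0\<close> is the empty word,
  \<open>+\<close> is concatenation), because this is what the convolution product on \<^typ>\<open>'a \<Rightarrow>\<^sub>0 'b\<close>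
  expects: \<open>'x free_monoid \<Rightarrow>\<^sub>0 'k\<close> is then the free associative algebra.\<close>

datatype 'x free_monoid = Word (letters: "'x list")

instantiation free_monoid :: (type) monoid_add
begin

definition zero_free_monoid :: "'a free_monoid" where
  "0 = Word []"

definition plus_free_monoid :: "'a free_monoid \<Rightarrow> 'a free_monoid \<Rightarrow> 'a free_monoid" where
  "u + v = Word (letters u @ letters v)"

instance
  by standard (simp_all add: zero_free_monoid_def plus_free_monoid_def)

end

type_synonym 'k ncpoly = "nat free_monoid \<Rightarrow>\<^sub>0 'k"

text \<open>\<open>K\<langle>x\<^sub>1,\<dots>,x\<^sub>m\<rangle>\<close>, for the field \<open>K\<close> given by the type \<^typ>\<open>'k\<close>.\<close>

definition free_algebra :: "nat \<Rightarrow> 'k::field ncpoly ring" where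
  "free_algebra m =
     \<lparr>carrier = {f. \<forall>w\<in>Poly_Mapping.keys f. set (letters w) \<subseteq> {1..m}},
      mult = (*), one = 1, zero = 0, add = (+)\<rparr>"

definition var :: "nat \<Rightarrow> 'k::field ncpoly" where
  "var i = Poly_Mapping.single (Word [i]) 1"

definition scal :: "'k \<Rightarrow> 'k::field ncpoly" where
  "scal k = Poly_Mapping.single 0 k"

section \<open>Commutative monomials and monomial orderings\<close>

text \<open>An element \<open>a\<close> of \<^typ>\<open>nat \<Rightarrow>\<^sub>0 nat\<close> is the exponent vector of \<open>\<Prod>i. x\<^sub>i ^ a\<^sub>i\<close>.\<close>

type_synonym monomial = "nat \<Rightarrow>\<^sub>0 nat"

type_synonym 'k cpoly = "monomial \<Rightarrow>\<^sub>0 'k"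

definition monomials :: "nat \<Rightarrow> monomial set" where
  "monomials m = {a. Poly_Mapping.keys a \<subseteq> {1..m}}"

definition var_exp :: "nat \<Rightarrow> monomial" where
  "var_exp i = Poly_Mapping.single i 1"

text \<open>An ordering is represented by its reflexive relation \<open>\<preceq>\<close>; \<open>\<prec>\<close> is \<^term>\<open>r - Id\<close>.\<close>

definition monomial_ordering :: "nat \<Rightarrow> monomial rel \<Rightarrow> bool" where
  "monomial_ordering m r \<longleftrightarrow>
     well_order_on (monomials m) r \<and>
     (\<forall>a b c. (a, b) \<in> r \<and> c \<in> monomials m \<longrightarrow> (a + c, b + c) \<in> r)"

definition lead_monomial :: "monomial rel \<Rightarrow> 'k::field cpoly \<Rightarrow> monomial" where
  "lead_monomial r p =
     (THE a. a \<in> Poly_Mapping.keys p \<and> (\<forall>b\<in>Poly_Mapping.keys p. (b, a) \<in> r))"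

text \<open>The polynomial \<open>p\<close>, read as a combination of the standard monomials
  \<open>x\<^sub>1 ^ a\<^sub>1 \<cdots> x\<^sub>m ^ a\<^sub>m\<close> in the free algebra.\<close>

definition std_word :: "monomial \<Rightarrow> nat free_monoid" where
  "std_word a =
     Word (concat (map (\<lambda>i. replicate (Poly_Mapping.lookup a i) i)
                       (sorted_list_of_set (Poly_Mapping.keys a))))"

definition std_poly :: "'k::field cpoly \<Rightarrow> 'k ncpoly" where
  "std_poly p =
     (\<Sum>a\<in>Poly_Mapping.keys p. Poly_Mapping.single (std_word a) (Poly_Mapping.lookup p a))"

section \<open>G-algebras\<close>

definition comm_rel ::
  "(nat \<Rightarrow> nat \<Rightarrow> 'k) \<Rightarrow> (nat \<Rightarrow> nat \<Rightarrow> 'k cpoly) \<Rightarrow> nat \<Rightarrow> nat \<Rightarrow> 'k::field ncpoly" where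
  "comm_rel c d i j = var j * var i - scal (c i j) * var i * var j - std_poly (d i j)"

definition galg_ideal ::
  "nat \<Rightarrow> (nat \<Rightarrow> nat \<Rightarrow> 'k) \<Rightarrow> (nat \<Rightarrow> nat \<Rightarrow> 'k cpoly) \<Rightarrow> 'k::field ncpoly set" where
  "galg_ideal m c d =
     genideal (free_algebra m) {comm_rel c d i j | i j. 1 \<le> i \<and> i < j \<and> j \<le> m}"

definition galg ::
  "nat \<Rightarrow> (nat \<Rightarrow> nat \<Rightarrow> 'k) \<Rightarrow> (nat \<Rightarrow> nat \<Rightarrow> 'k cpoly) \<Rightarrow> 'k::field ncpoly set ring" where
  "galg m c d = free_algebra m Quot galg_ideal m c d"

definition galg_class ::
  "nat \<Rightarrow> (nat \<Rightarrow> nat \<Rightarrow> 'k) \<Rightarrow> (nat \<Rightarrow> nat \<Rightarrow> 'k cpoly) \<Rightarrow> 'k::field ncpoly \<Rightarrow> 'k ncpoly set" where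
  "galg_class m c d f = galg_ideal m c d +>\<^bsub>free_algebra m\<^esub> f"

text \<open>One step of rewriting with the rules \<open>x\<^sub>j x\<^sub>i \<rightarrow> c\<^sub>i\<^sub>j x\<^sub>i x\<^sub>j + d\<^sub>i\<^sub>j\<close> (\<open>i < j\<close>): in a single term
  \<open>\<alpha> u x\<^sub>j x\<^sub>i v\<close> of \<open>f\<close> with \<open>\<alpha> \<noteq> 0\<close>, the factor \<open>x\<^sub>j x\<^sub>i\<close> is replaced.\<close>

definition galg_step ::
  "nat \<Rightarrow> (nat \<Rightarrow> nat \<Rightarrow> 'k) \<Rightarrow> (nat \<Rightarrow> nat \<Rightarrow> 'k cpoly) \<Rightarrow> 'k::field ncpoly \<Rightarrow> 'k ncpoly \<Rightarrow> bool" where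
  "galg_step m c d f g \<longleftrightarrow>
     (\<exists>i j u v. 1 \<le> i \<and> i < j \<and> j \<le> m \<and> u + Word [j, i] + v \<in> Poly_Mapping.keys f \<and>
        g = f - Poly_Mapping.single u (Poly_Mapping.lookup f (u + Word [j, i] + v))
                  * comm_rel c d i j * Poly_Mapping.single v 1)"

definition reduces_to_zero ::
  "nat \<Rightarrow> (nat \<Rightarrow> nat \<Rightarrow> 'k) \<Rightarrow> (nat \<Rightarrow> nat \<Rightarrow> 'k cpoly) \<Rightarrow> 'k::field ncpoly \<Rightarrow> bool" where
  "reduces_to_zero m c d f \<longleftrightarrow> (galg_step m c d)\<^sup>*\<^sup>* f 0"

text \<open>The expression below is the difference of the two ways of rewriting the overlap
  \<open>x\<^sub>k x\<^sub>j x\<^sub>i\<close>. It therefore always lies in the ideal of relations, so \<open>reduces to zero\<close> has to be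
  understood in terms of rewriting and not as membership in the ideal.\<close>

definition nondeg_expr ::
  "(nat \<Rightarrow> nat \<Rightarrow> 'k) \<Rightarrow> (nat \<Rightarrow> nat \<Rightarrow> 'k cpoly) \<Rightarrow> nat \<Rightarrow> nat \<Rightarrow> nat \<Rightarrow> 'k::field ncpoly" where
  "nondeg_expr c d i j k =
       scal (c i k * c j k) * std_poly (d i j) * var k - var k * std_poly (d i j)
     + scal (c j k) * var j * std_poly (d i k) - scal (c i j) * std_poly (d i k) * var j
     + std_poly (d j k) * var i - scal (c i j * c i k) * var i * std_poly (d j k)"

definition admissible_ordering ::
  "nat \<Rightarrow> (nat \<Rightarrow> nat \<Rightarrow> 'k::field cpoly) \<Rightarrow> monomial rel \<Rightarrow> bool" where
  "admissible_ordering m d r \<longleftrightarrow>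
     monomial_ordering m r \<and>
     (\<forall>i j. 1 \<le> i \<and> i < j \<and> j \<le> m \<and> d i j \<noteq> 0 \<longrightarrow>
        (lead_monomial r (d i j), var_exp i + var_exp j) \<in> r - Id)"

text \<open>The data \<open>c\<close>, \<open>d\<close> define a G-algebra in \<open>x\<^sub>1, \<dots>, x\<^sub>m\<close>. Only the entries with
  \<open>1 \<le> i < j \<le> m\<close> matter.\<close>

definition is_galg ::
  "nat \<Rightarrow> (nat \<Rightarrow> nat \<Rightarrow> 'k) \<Rightarrow> (nat \<Rightarrow> nat \<Rightarrow> 'k::field cpoly) \<Rightarrow> bool" where
  "is_galg m c d \<longleftrightarrow>
     (\<forall>i j. 1 \<le> i \<and> i < j \<and> j \<le> m \<longrightarrow> c i j \<noteq> 0 \<and> Poly_Mapping.keys (d i j) \<subseteq> monomials m) \<and>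
     (\<forall>i j k. 1 \<le> i \<and> i < j \<and> j < k \<and> k \<le> m \<longrightarrow> reduces_to_zero m c d (nondeg_expr c d i j k)) \<and>
     (\<exists>r. admissible_ordering m d r)"

text \<open>The map \<open>galg m' c d \<rightarrow> galg m c d\<close> for \<open>m' \<le> m\<close> that is induced by
  \<open>K\<langle>x\<^sub>1,\<dots>,x\<^sub>m\<^sub>'\<rangle> \<subseteq> K\<langle>x\<^sub>1,\<dots>,x\<^sub>m\<rangle>\<close>. With \<open>I' \<subseteq> I\<close> the ideals of relations, it sends
  the coset \<open>I' + f\<close> to \<open>I + (I' + f) = I + f\<close>.\<close>

definition galg_incl ::
  "nat \<Rightarrow> (nat \<Rightarrow> nat \<Rightarrow> 'k) \<Rightarrow> (nat \<Rightarrow> nat \<Rightarrow> 'k cpoly) \<Rightarrow> 'k::field ncpoly set \<Rightarrow> 'k ncpoly set" where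
  "galg_incl m c d X = galg_ideal m c d <+>\<^bsub>free_algebra m\<^esub> X"

section \<open>Ore sets and localizations\<close>

definition ore_set :: "('a, 'm) ring_scheme \<Rightarrow> 'a set \<Rightarrow> bool" where
  "ore_set R S \<longleftrightarrow>
     submonoid S R \<and> \<zero>\<^bsub>R\<^esub> \<notin> S \<and>
     (\<forall>s1\<in>S. \<forall>a1\<in>carrier R. \<exists>s2\<in>S. \<exists>a2\<in>carrier R. a1 \<otimes>\<^bsub>R\<^esub> s2 = s1 \<otimes>\<^bsub>R\<^esub> a2)"

definition ore_localization ::
  "('a, 'm) ring_scheme \<Rightarrow> 'a set \<Rightarrow> ('b, 'n) ring_scheme \<Rightarrow> ('a \<Rightarrow> 'b) \<Rightarrow> bool" where
  "ore_localization R S L \<phi> \<longleftrightarrow>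
     ring L \<and> \<phi> \<in> ring_hom R L \<and> inj_on \<phi> (carrier R) \<and>
     (\<forall>s\<in>S. \<phi> s \<in> Units L) \<and>
     (\<forall>f\<in>carrier L. \<exists>s\<in>S. \<exists>a\<in>carrier R. f = inv\<^bsub>L\<^esub> (\<phi> s) \<otimes>\<^bsub>L\<^esub> \<phi> a)"

text \<open>\<open>(Q, \<psi>)\<close> is the total two-sided ring of fractions: every element is both a left and a right
  fraction with nonzero denominator.\<close>

definition quot_ring ::
  "('a, 'm) ring_scheme \<Rightarrow> ('b, 'n) ring_scheme \<Rightarrow> ('a \<Rightarrow> 'b) \<Rightarrow> bool" where
  "quot_ring R Q \<psi> \<longleftrightarrow>
     ore_localization R (carrier R - {\<zero>\<^bsub>R\<^esub>}) Q \<psi> \<and>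
     (\<forall>f\<in>carrier Q. \<exists>s\<in>carrier R - {\<zero>\<^bsub>R\<^esub>}. \<exists>a\<in>carrier R. f = \<psi> a \<otimes>\<^bsub>Q\<^esub> inv\<^bsub>Q\<^esub> (\<psi> s))"

section \<open>Ore extensions\<close>

text \<open>\<open>\<kappa>\<close> gives the \<open>K\<close>-algebra structure of \<open>C\<close>.\<close>

definition skew_derivation ::
  "('k \<Rightarrow> 'c) \<Rightarrow> ('c, 'm) ring_scheme \<Rightarrow> ('c \<Rightarrow> 'c) \<Rightarrow> ('c \<Rightarrow> 'c) \<Rightarrow> bool" where
  "skew_derivation \<kappa> C \<sigma> \<delta> \<longleftrightarrow>
     \<delta> \<in> carrier C \<rightarrow> carrier C \<and>
     (\<forall>a\<in>carrier C. \<forall>b\<in>carrier C. \<delta> (a \<oplus>\<^bsub>C\<^esub> b) = \<delta> a \<oplus>\<^bsub>C\<^esub> \<delta> b) \<and>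
     (\<forall>k. \<forall>a\<in>carrier C. \<delta> (\<kappa> k \<otimes>\<^bsub>C\<^esub> a) = \<kappa> k \<otimes>\<^bsub>C\<^esub> \<delta> a) \<and>
     (\<forall>a\<in>carrier C. \<forall>b\<in>carrier C.
        \<delta> (a \<otimes>\<^bsub>C\<^esub> b) = (\<sigma> a \<otimes>\<^bsub>C\<^esub> \<delta> b) \<oplus>\<^bsub>C\<^esub> (\<delta> a \<otimes>\<^bsub>C\<^esub> b))"

text \<open>Left multiplication by \<open>\<partial>\<close> on coefficient sequences:
  \<open>\<partial> \<cdot> (\<Sum>k. b\<^sub>k \<partial>^k) = \<Sum>k. \<sigma>(b\<^sub>k) \<partial>^(k+1) + \<delta>(b\<^sub>k) \<partial>^k\<close>.\<close>

definition ore_shift ::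
  "('c, 'm) ring_scheme \<Rightarrow> ('c \<Rightarrow> 'c) \<Rightarrow> ('c \<Rightarrow> 'c) \<Rightarrow> (nat \<Rightarrow> 'c) \<Rightarrow> nat \<Rightarrow> 'c" where
  "ore_shift C \<sigma> \<delta> q k =
     (case k of 0 \<Rightarrow> \<zero>\<^bsub>C\<^esub> | Suc l \<Rightarrow> \<sigma> (q l)) \<oplus>\<^bsub>C\<^esub> \<delta> (q k)"

text \<open>\<open>C[\<partial>;\<sigma>,\<delta>]\<close> has the underlying additive group of \<^term>\<open>UP C\<close>, and
  \<open>(\<Sum>i. a\<^sub>i \<partial>^i) \<cdot> q = \<Sum>i. a\<^sub>i (\<partial>^i \<cdot> q)\<close>.\<close>

definition ore_ext ::
  "('c, 'm) ring_scheme \<Rightarrow> ('c \<Rightarrow> 'c) \<Rightarrow> ('c \<Rightarrow> 'c) \<Rightarrow> (nat \<Rightarrow> 'c) ring" where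
  "ore_ext C \<sigma> \<delta> =
     \<lparr>carrier = carrier (UP C),
      mult = (\<lambda>p q k. \<Oplus>\<^bsub>C\<^esub>i\<in>{i. p i \<noteq> \<zero>\<^bsub>C\<^esub>}. p i \<otimes>\<^bsub>C\<^esub> ((ore_shift C \<sigma> \<delta> ^^ i) q) k),
      one = \<one>\<^bsub>UP C\<^esub>, zero = \<zero>\<^bsub>UP C\<^esub>, add = add (UP C)\<rparr>"

definition ore_const :: "('c, 'm) ring_scheme \<Rightarrow> 'c \<Rightarrow> nat \<Rightarrow> 'c" where
  "ore_const C a = monom (UP C) a 0"

definition ore_var :: "('c, 'm) ring_scheme \<Rightarrow> nat \<Rightarrow> 'c" where
  "ore_var C = monom (UP C) \<one>\<^bsub>C\<^esub> 1"

end

theory Submission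
  imports Defs "HOL-Library.Multiset"
begin

text \<open>Rewriting with \<open>x\<^sub>j x\<^sub>i \<rightarrow> c\<^sub>i\<^sub>j x\<^sub>i x\<^sub>j + d\<^sub>i\<^sub>j\<close> is confluent (Bergman's diamond lemma), so the standard
  monomials form a basis and leading monomials are multiplicative. Dickson's lemma then yields the
  right Ore condition for \<open>B\<close>. Since all variables are smaller than \<open>\<partial>\<close>, every monomial of \<open>d\<^sub>k\<^sub>\<partial>\<close> has
  degree at most one in \<open>\<partial>\<close>; hence \<open>\<partial> b = \<sigma> b \<partial> + \<delta> b\<close> on \<open>B\<close>, and \<open>\<sigma>\<close> preserves leading monomials, which
  makes it bijective by well-founded induction. So \<open>A\<close> inherits the right Ore condition, and \<open>\<sigma>\<close> and
  \<open>\<delta>\<close> extend to \<open>Quot(B)\<close>. Expanding in powers of \<open>\<partial>\<close> embeds \<open>A\<close> into \<open>Quot(B)[\<partial>;\<sigma>,\<delta>]\<close>, and this is the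
  localization because finitely many coefficients have a common left denominator.\<close>

section \<open>Words and polynomials\<close>

text \<open>Ideal membership alone is too weak for the confluence argument: what counts is that a
  rewriting sequence uses only relations below a known bound. Ideal elements are therefore carried
  together with a bound on the leading words of the relations used (\<open>J\<close>), and
  confluence is an equality modulo smaller combinations. Noetherianity is never established in
  general. The classical argument that a Noetherian domain is Ore is run on the single chain
  generated by two elements, and Dickson's lemma stops that chain. Ore sets are defined by right
  multiples, localizations by left fractions. The right condition is proved; the left one for B is
  read off from the given model of \<open>Quot(B)\<close>. Both halves of the bijectivity of
  \<sigma> matter: surjectivity moves a denominator past \<partial>, injectivity lets \<sigma> act
  on fractions. A and B carry unrelated orderings. They are linked only by normal forms, which do
  not depend on an ordering; leading monomials for \<sigma> are taken in the ordering of A.\<close>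

abbreviation "keys \<equiv> Poly_Mapping.keys"
abbreviation "lookup \<equiv> Poly_Mapping.lookup"
abbreviation "single \<equiv> Poly_Mapping.single"

definition words :: "nat \<Rightarrow> nat free_monoid set" where
  "words m = {w. set (letters w) \<subseteq> {1..m}}"

definition exp_of :: "nat free_monoid \<Rightarrow> monomial" where
  "exp_of w = (\<Sum>x\<leftarrow>letters w. var_exp x)"

definition sorted_words :: "nat \<Rightarrow> nat free_monoid set" where
  "sorted_words m = {w \<in> words m. sorted (letters w)}"

abbreviation wmon :: "nat free_monoid \<Rightarrow> 'k::field ncpoly" where
  "wmon w \<equiv> single w 1"


lemma letters_zero [simp]: "letters 0 = []"
  by (simp add: zero_free_monoid_def)

lemma letters_plus [simp]: "letters (u + v) = letters u @ letters v"
  by (simp add: plus_free_monoid_def)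

lemma words_zero [simp]: "0 \<in> words m"
  by (simp add: words_def)

lemma words_plus [simp]: "u + v \<in> words m \<longleftrightarrow> u \<in> words m \<and> v \<in> words m"
  by (auto simp: words_def)

lemma words_Word [simp]: "Word xs \<in> words m \<longleftrightarrow> set xs \<subseteq> {1..m}"
  by (simp add: words_def)

lemma sorted_words_subset: "sorted_words m \<subseteq> words m"
  by (auto simp: sorted_words_def)

lemma free_monoid_cancel_right [simp]: "v + u = v' + u \<longleftrightarrow> v = (v' :: 'x free_monoid)"
  by (cases v; cases v') (simp add: plus_free_monoid_def)

lemma exp_of_plus [simp]: "exp_of (u + v) = exp_of u + exp_of v"
  by (simp add: exp_of_def)

lemma exp_of_pair [simp]: "exp_of (Word [i, j]) = var_exp i + var_exp j"
  by (simp add: exp_of_def)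

lemma exp_of_single [simp]: "exp_of (Word [i]) = var_exp i"
  by (simp add: exp_of_def)

lemma lookup_exp_of: "lookup (exp_of w) x = count_list (letters w) x"
proof -
  have "lookup (\<Sum>x\<leftarrow>xs. var_exp x) y = count_list xs y" for xs y
    by (induction xs) (auto simp: lookup_add var_exp_def lookup_single when_def)
  then show ?thesis by (simp add: exp_of_def)
qed

lemma exp_of_eq_iff: "exp_of u = exp_of v \<longleftrightarrow> mset (letters u) = mset (letters v)"
  by (simp add: poly_mapping_eq_iff fun_eq_iff lookup_exp_of multiset_eq_iff count_mset)

lemma keys_exp_of: "keys (exp_of w) = set (letters w)"
  by (auto simp: in_keys_iff lookup_exp_of count_list_0_iff)

lemma exp_of_monomials: "exp_of w \<in> monomials m \<longleftrightarrow> w \<in> words m"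
  by (simp add: monomials_def keys_exp_of words_def)

lemma monomials_add: "a + b \<in> monomials m \<longleftrightarrow> a \<in> monomials m \<and> b \<in> monomials m"
proof -
  have "keys (a + b) = keys a \<union> keys b"
    by (auto simp: in_keys_iff lookup_add)
  then show ?thesis by (auto simp: monomials_def)
qed

lemma monomials_zero [simp]: "0 \<in> monomials m"
  by (simp add: monomials_def)

lemma var_exp_monomials [simp]: "var_exp i \<in> monomials m \<longleftrightarrow> i \<in> {1..m}"
  by (simp add: monomials_def var_exp_def)

lemma count_list_concat_replicate:
  "count_list (concat (map (\<lambda>i. replicate (f i) i) xs)) x = f x * count_list xs x"
proof -
  have "count_list (replicate k y) x = (if x = y then k else 0)" for k y
    by (induction k) auto
  then show ?thesis by (induction xs) auto
qed

lemma exp_of_std_word [simp]: "exp_of (std_word a) = a"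
proof (rule poly_mapping_eqI)
  fix x
  have "count_list (sorted_list_of_set (keys a)) x = (if x \<in> keys a then 1 else 0)"
    using distinct_count_atmost_1[of "sorted_list_of_set (keys a)"]
    by (auto simp: count_mset count_list_0_iff)
  then show "lookup (exp_of (std_word a)) x = lookup a x"
    by (simp add: lookup_exp_of std_word_def count_list_concat_replicate in_keys_iff)
qed

lemma sorted_std_word: "sorted (letters (std_word a))"
proof -
  have "sorted xs \<Longrightarrow> sorted (concat (map (\<lambda>i. replicate (f i) i) xs))" for f :: "nat \<Rightarrow> nat" and xs
    by (induction xs) (auto simp: sorted_append)
  then show ?thesis by (simp add: std_word_def)
qed

lemma std_word_words [simp]: "std_word a \<in> words m \<longleftrightarrow> a \<in> monomials m"
  by (metis exp_of_monomials exp_of_std_word)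

lemma std_word_sorted_words [simp]: "std_word a \<in> sorted_words m \<longleftrightarrow> a \<in> monomials m"
  by (simp add: sorted_words_def sorted_std_word)

text \<open>A sorted word is determined by the multiset of its letters, so sorted words and exponent
  vectors correspond one to one.\<close>

lemma std_word_exp_of: "sorted (letters w) \<Longrightarrow> std_word (exp_of w) = w"
proof -
  assume s: "sorted (letters w)"
  have "exp_of (std_word (exp_of w)) = exp_of w" by simp
  then have "letters (std_word (exp_of w)) = letters w"
    unfolding exp_of_eq_iff using s sorted_std_word
    by (metis properties_for_sort sorted_sort_id)
  then show ?thesis by (metis free_monoid.collapse)
qed

text \<open>The adjacent descent \<open>j, i\<close> is the left side of a rewriting rule, so a word
  over the given variables to which no rule applies is sorted.\<close>

lemma not_sorted_split:
  assumes "\<not> sorted xs"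
  obtains ys j i zs where "xs = ys @ [j, i] @ zs" "i < (j::nat)"
  using assms
proof (induction xs arbitrary: thesis)
  case (Cons x xs)
  show ?case
  proof (cases "sorted xs")
    case False
    then obtain ys j i zs where "xs = ys @ [j, i] @ zs" "i < j" using Cons.IH by blast
    then show ?thesis using Cons.prems(1)[of "x # ys" j i zs] by simp
  next
    case True
    then obtain y zs where "xs = y # zs" "y < x"
      using Cons.prems(2) by (cases xs) (auto simp: not_le dest: order_le_less_trans)
    then show ?thesis using Cons.prems(1)[of "[]" x y zs] by simp
  qed
qed simp

lemma poly_sum_single: "(\<Sum>w\<in>keys f. single w (lookup f w)) = f"
  by (rule poly_mapping_eqI)
    (auto simp: lookup_sum lookup_single when_def in_keys_iff)

text \<open>Additive statements need checking on single terms only; \<open>W\<close> remembers which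
  words can occur.\<close>

lemma poly_induct [consumes 1, case_names zero single add]:
  fixes f :: "'a \<Rightarrow>\<^sub>0 'b::comm_monoid_add"
  assumes "keys f \<subseteq> W"
    and zero: "P 0"
    and single: "\<And>w k. w \<in> W \<Longrightarrow> P (single w k)"
    and add: "\<And>f g. P f \<Longrightarrow> P g \<Longrightarrow> P (f + g)"
  shows "P f"
proof -
  have "P (\<Sum>w\<in>S. single w (lookup f w))" if "finite S" "S \<subseteq> W" for S
    using that by (induction S) (auto simp: zero single add)
  from this[of "keys f"] show ?thesis using assms(1) by (simp add: poly_sum_single)
qed

lemma keys_times: "w \<in> keys (f * g) \<Longrightarrow> \<exists>u\<in>keys f. \<exists>v\<in>keys g. w = u + v"
  using keys_mult by fastforce

lemma scal_comm: "f * scal k = scal k * (f :: 'k::field ncpoly)"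
proof -
  have "keys f \<subseteq> UNIV" by simp
  then show ?thesis
    by (induction f rule: poly_induct) (auto simp: scal_def mult_single algebra_simps)
qed

lemma scal_mult: "scal (a * b) = scal a * (scal b :: 'k::field ncpoly)"
  by (simp add: scal_def mult_single)

lemma scal_0 [simp]: "scal 0 = (0 :: 'k::field ncpoly)"
  by (simp add: scal_def)

lemma scal_1 [simp]: "scal 1 = (1 :: 'k::field ncpoly)"
  by (simp add: scal_def)

lemma scal_minus: "scal (- a) = - (scal a :: 'k::field ncpoly)"
  by (simp add: scal_def single_uminus)

lemma scal_wmon: "scal k * wmon w = (single w k :: 'k::field ncpoly)"
  by (simp add: scal_def mult_single)

lemma lookup_scal: "lookup (scal k * f) w = k * lookup (f :: 'k::field ncpoly) w"
proof -
  have "keys f \<subseteq> UNIV" by simp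
  then show ?thesis
    by (induction f rule: poly_induct)
      (auto simp: scal_def mult_single algebra_simps lookup_single lookup_add when_def)
qed

lemma keys_scal: "keys (scal k * f) \<subseteq> keys (f :: 'k::field ncpoly)"
  by (auto simp: in_keys_iff lookup_scal)

lemma keys_std_poly: "keys (std_poly (p :: 'k::field cpoly)) \<subseteq> std_word ` keys p"
proof -
  have "keys (\<Sum>a\<in>S. single (std_word a) (f a)) \<subseteq> std_word ` S" for S and f :: "_ \<Rightarrow> 'k"
    using keys_sum[of "\<lambda>a. single (std_word a) (f a)" S] by (auto split: if_splits)
  then show ?thesis by (simp add: std_poly_def)
qed

definition fa :: "nat \<Rightarrow> 'k::field ncpoly set" where
  "fa m = {f. keys f \<subseteq> words m}"

lemma carrier_free_algebra: "carrier (free_algebra m) = fa m"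
  by (auto simp: free_algebra_def fa_def words_def)

lemma fa_zero [simp]: "0 \<in> fa m" by (simp add: fa_def)
lemma fa_one [simp]: "1 \<in> fa m" by (simp add: fa_def)
lemma fa_single [simp]: "single w k \<in> fa m \<longleftrightarrow> k = 0 \<or> w \<in> words m"
  by (simp add: fa_def)
lemma fa_add [simp]: "f \<in> fa m \<Longrightarrow> g \<in> fa m \<Longrightarrow> f + g \<in> fa m"
  using keys_add[of f g] by (auto simp: fa_def)
lemma fa_diff [simp]: "f \<in> fa m \<Longrightarrow> g \<in> fa m \<Longrightarrow> f - g \<in> fa m"
  using keys_diff[of f g] by (auto simp: fa_def)
lemma fa_uminus [simp]: "- f \<in> fa m \<longleftrightarrow> f \<in> fa m"
  by (auto simp: fa_def)
lemma fa_mult [simp]: "f \<in> fa m \<Longrightarrow> g \<in> fa m \<Longrightarrow> f * g \<in> fa m"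
  by (fastforce simp: fa_def dest: keys_times)
lemma fa_scal [simp]: "scal k \<in> fa m"
  by (simp add: scal_def)
lemma fa_var [simp]: "var i \<in> fa m \<longleftrightarrow> i \<in> {1..m}"
  by (simp add: var_def)
lemma fa_power [simp]: "f \<in> fa m \<Longrightarrow> f ^ i \<in> fa m"
  by (induction i) auto
lemma fa_std_poly: "keys p \<subseteq> monomials m \<Longrightarrow> std_poly p \<in> fa m"
  using keys_std_poly[of p] by (fastforce simp: fa_def)

lemma ring_free_algebra: "ring (free_algebra m :: 'k::field ncpoly ring)"
proof -
  have "\<exists>y\<in>fa m. y + x = 0" if "x \<in> fa m" for x :: "'k ncpoly"
    using that by (intro bexI[of _ "- x"]) auto
  then show ?thesis
    by (intro ringI abelian_groupI monoidI)
      (auto simp: free_algebra_def fa_def[symmetric] words_def[symmetric] algebra_simps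
        carrier_free_algebra[unfolded free_algebra_def, simplified])
qed

section \<open>The Poincare-Birkhoff-Witt basis\<close>

lemma comm_rel_alt:
  "comm_rel c d i j = wmon (Word [j, i]) - single (Word [i, j]) (c i j) - std_poly (d i j)"
  by (simp add: comm_rel_def var_def scal_def mult_single plus_free_monoid_def zero_free_monoid_def)

text \<open>The right-hand side of the rewriting rule for
  \<open>x\<^sub>j x\<^sub>i\<close>.\<close>

definition rel_tail :: "(nat \<Rightarrow> nat \<Rightarrow> 'k) \<Rightarrow> (nat \<Rightarrow> nat \<Rightarrow> 'k cpoly) \<Rightarrow> nat \<Rightarrow> nat \<Rightarrow> 'k::field ncpoly" where
  "rel_tail c d i j = single (Word [i, j]) (c i j) + std_poly (d i j)"

lemma comm_rel_tail: "comm_rel c d i j = wmon (Word [j, i]) - rel_tail c d i j"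
  by (simp add: comm_rel_alt rel_tail_def)

section \<open>The admissible ordering and its lift to words\<close>

locale galg_pbw =
  fixes m :: nat and c :: "nat \<Rightarrow> nat \<Rightarrow> 'k::field" and d :: "nat \<Rightarrow> nat \<Rightarrow> 'k cpoly"
    and r :: "monomial rel"
  assumes is_galg: "is_galg m c d"
    and admissible: "admissible_ordering m d r"
begin

abbreviation rel :: "nat \<Rightarrow> nat \<Rightarrow> 'k ncpoly" where
  "rel i j \<equiv> comm_rel c d i j"

definition lt :: "monomial \<Rightarrow> monomial \<Rightarrow> bool" where
  "lt a b \<longleftrightarrow> (a, b) \<in> r - Id"

lemma well_order: "well_order_on (monomials m) r"
  using admissible by (simp add: admissible_ordering_def monomial_ordering_def)

lemma order_facts:
  shows r_subset: "r \<subseteq> monomials m \<times> monomials m" and r_refl: "refl_on (monomials m) r"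
    and r_trans: "trans r" and r_antisym: "antisym r" and r_total: "total_on (monomials m) r"
  using well_order
  by (simp_all only: well_order_on_def linear_order_on_def partial_order_on_def preorder_on_def)

lemma lt_monomials: "lt a b \<Longrightarrow> a \<in> monomials m \<and> b \<in> monomials m"
  using r_subset by (auto simp: lt_def)

lemma lt_trans: "lt a b \<Longrightarrow> lt b e \<Longrightarrow> lt a e"
  unfolding lt_def by (rule transD[OF trans_diff_Id[OF r_trans r_antisym]])

lemma lt_irrefl [simp]: "\<not> lt a a"
  by (simp add: lt_def)

lemma lt_total: "a \<in> monomials m \<Longrightarrow> b \<in> monomials m \<Longrightarrow> lt a b \<or> a = b \<or> lt b a"
  using r_total by (simp add: lt_def total_on_def) blast

lemma le_iff: "a \<in> monomials m \<Longrightarrow> b \<in> monomials m \<Longrightarrow> (a, b) \<in> r \<longleftrightarrow> lt a b \<or> a = b"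
  using r_refl by (auto simp: lt_def refl_on_def)

lemma wfp_lt: "wfp lt"
proof -
  have "{(a, b). lt a b} = r - Id" by (auto simp: lt_def)
  then show ?thesis using well_order by (simp add: well_order_on_def wfp_def)
qed

lemma lt_add: "lt a b \<Longrightarrow> e \<in> monomials m \<Longrightarrow> lt (a + e) (b + e)"
proof -
  have *: "(a, b) \<in> r \<and> e \<in> monomials m \<longrightarrow> (a + e, b + e) \<in> r"
    using admissible unfolding admissible_ordering_def monomial_ordering_def by blast
  show "lt a b \<Longrightarrow> e \<in> monomials m \<Longrightarrow> lt (a + e) (b + e)"
    using * by (simp add: lt_def)
qed

lemma lt_add': "lt a b \<Longrightarrow> e \<in> monomials m \<Longrightarrow> lt (e + a) (e + b)"
  using lt_add by (simp add: add.commute)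

lemma lt_ctx: "lt a b \<Longrightarrow> e \<in> monomials m \<Longrightarrow> e' \<in> monomials m \<Longrightarrow> lt (e + a + e') (e + b + e')"
  using lt_add lt_add' by blast

text \<open>If \<open>a\<close> were below 0, adding \<open>a\<close> repeatedly would give an
  infinite descent 0, a, 2a, ..., against well-foundedness.\<close>

lemma zero_le: assumes "a \<in> monomials m" shows "a = 0 \<or> lt 0 a"
proof (rule ccontr)
  assume "\<not> ?thesis"
  then have a: "lt a 0" using lt_total[of a 0] assms by auto
  define s where "s k = (((+) a) ^^ k) 0" for k :: nat
  have s: "s k \<in> monomials m" for k
    by (induction k) (auto simp: s_def monomials_add assms)
  have "lt (s (Suc k)) (s k)" for k
    using lt_add[OF a s[of k]] by (simp add: s_def)
  then show False
    using wfp_lt unfolding wfp_def wf_iff_no_infinite_down_chain by auto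
qed

lemma finite_max: "finite S \<Longrightarrow> S \<noteq> {} \<Longrightarrow> S \<subseteq> monomials m \<Longrightarrow> \<exists>a\<in>S. \<forall>b\<in>S. b = a \<or> lt b a"
proof (induction S rule: finite_ne_induct)
  case (insert x F)
  then obtain a where a: "a \<in> F" "\<forall>b\<in>F. b = a \<or> lt b a" by auto
  show ?case
  proof (cases "lt a x")
    case True
    then have "\<forall>b\<in>insert x F. b = x \<or> lt b x" using a lt_trans[OF _ True] by auto
    then show ?thesis by blast
  next
    case False
    then have "x = a \<or> lt x a" using lt_total[of x a] insert.prems a by auto
    then show ?thesis using a by auto
  qed
qed auto

lemma galg_c: "1 \<le> i \<Longrightarrow> i < j \<Longrightarrow> j \<le> m \<Longrightarrow> c i j \<noteq> 0"
  using is_galg by (simp add: is_galg_def)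

lemma galg_d: "1 \<le> i \<Longrightarrow> i < j \<Longrightarrow> j \<le> m \<Longrightarrow> keys (d i j) \<subseteq> monomials m"
  using is_galg by (simp add: is_galg_def)

text \<open>Admissibility bounds only the leading monomial, which is a definite description. The
  finite nonempty set of keys has a maximum, the description picks it out, and the other keys lie
  below it.\<close>

lemma keys_d:
  assumes "1 \<le> i" "i < j" "j \<le> m" "a \<in> keys (d i j)"
  shows "lt a (var_exp i + var_exp j)"
proof -
  let ?S = "keys (d i j)"
  have S: "?S \<subseteq> monomials m" using galg_d assms by simp
  have "\<exists>b\<in>?S. \<forall>a\<in>?S. a = b \<or> lt a b"
    by (rule finite_max) (use S assms(4) in auto)
  then obtain b where b: "b \<in> ?S" "\<forall>a\<in>?S. a = b \<or> lt a b" by blast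
  have "lead_monomial r (d i j) = b"
    unfolding lead_monomial_def
  proof (rule the_equality)
    show "b \<in> ?S \<and> (\<forall>a\<in>?S. (a, b) \<in> r)" using b S le_iff by blast
    fix x assume "x \<in> ?S \<and> (\<forall>a\<in>?S. (a, x) \<in> r)"
    then show "x = b" using b S le_iff by (metis lt_irrefl lt_trans subsetD)
  qed
  moreover have "d i j \<noteq> 0" using assms(4) by auto
  ultimately have "lt b (var_exp i + var_exp j)"
    using admissible assms by (auto simp: admissible_ordering_def lt_def)
  then show ?thesis using b assms(4) lt_trans by metis
qed

text \<open>The words \<open>x\<^sub>j x\<^sub>i\<close> and \<open>x\<^sub>i x\<^sub>j\<close> have
  the same exponent vector, so the monomial ordering cannot see that a swap makes progress. The
  lexicographic tie-break makes every rule strictly decreasing.\<close>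

definition wlt :: "nat free_monoid \<Rightarrow> nat free_monoid \<Rightarrow> bool" where
  "wlt w' w \<longleftrightarrow> w' \<in> words m \<and> w \<in> words m \<and>
     (lt (exp_of w') (exp_of w) \<or>
      exp_of w' = exp_of w \<and> (letters w', letters w) \<in> lenlex less_than)"

lemma wfp_wlt: "wfp wlt"
proof -
  have "wf ({(a, b). lt a b} <*lex*> lenlex less_than)"
    using wfp_lt by (auto simp: wfp_def)
  then have "wf (inv_image ({(a, b). lt a b} <*lex*> lenlex less_than) (\<lambda>w. (exp_of w, letters w)))"
    by (rule wf_inv_image)
  then show ?thesis unfolding wfp_def
    by (rule wf_subset) (auto simp: wlt_def inv_image_def)
qed

lemma wlt_trans:
  assumes "wlt u v" "wlt v w"
  shows "wlt u w"
  using assms lt_trans[of "exp_of u" "exp_of v" "exp_of w"]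
    lenlex_trans[OF _ _ trans_less_than, of "letters u" "letters v" "letters w"]
  by (auto simp: wlt_def)

lemma wlt_irrefl [simp]: "\<not> wlt w w"
  by (auto simp: wlt_def intro!: lenlex_irreflexive)

lemma wlt_total:
  assumes "u \<in> words m" "v \<in> words m"
  shows "wlt u v \<or> u = v \<or> wlt v u"
proof (cases "u = v")
  case False
  then have "letters u \<noteq> letters v" by (auto dest: free_monoid.expand)
  then have "(letters u, letters v) \<in> lenlex less_than \<or> (letters v, letters u) \<in> lenlex less_than"
    using total_lenlex[OF total_less_than] by (auto simp: total_on_def)
  then show ?thesis
    using lt_total[of "exp_of u" "exp_of v"] assms by (auto simp: wlt_def exp_of_monomials)
qed simp

text \<open>Equal exponents force equal lengths, so the tie-break is plain lexicographic comparison
  of words of one length, which is stable under common prefixes and suffixes.\<close>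

lemma wlt_ctx:
  assumes "wlt w' w" "u \<in> words m" "v \<in> words m"
  shows "wlt (u + w' + v) (u + w + v)"
proof (cases "lt (exp_of w') (exp_of w)")
  case True
  then show ?thesis using assms lt_ctx by (auto simp: wlt_def exp_of_monomials)
next
  case False
  then have e: "exp_of w' = exp_of w" "(letters w', letters w) \<in> lenlex less_than"
    using assms by (auto simp: wlt_def)
  then have len: "length (letters w') = length (letters w)"
    by (metis exp_of_eq_iff mset_eq_length)
  then have "(letters w', letters w) \<in> lex less_than"
    using e by (auto simp: lenlex_conv)
  then have "(letters (u + w' + v), letters (u + w + v)) \<in> lex less_than"
    by (simp add: lex_append_leftI lex_append_rightI)
  then show ?thesis using assms e len by (auto simp: wlt_def lenlex_conv)
qed

lemma wlt_permute:
  assumes "x < y" "mset (x # xs) = mset (y # ys)" "set (y # ys) \<subseteq> {1..m}"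
  shows "wlt (Word (x # xs)) (Word (y # ys))"
proof -
  have "set (x # xs) = set (y # ys)" using assms(2) by (metis set_mset_mset)
  moreover have "length xs = length ys" using assms(2) mset_eq_length by fastforce
  ultimately show ?thesis using assms
    by (auto simp: wlt_def lenlex_conv exp_of_eq_iff)
qed

lemma std_word_lt:
  assumes "1 \<le> i" "i < j" "j \<le> m" "w \<in> keys (std_poly (d i j))"
  shows "w \<in> words m \<and> lt (exp_of w) (var_exp i + var_exp j)"
proof -
  obtain a where "w = std_word a" "a \<in> keys (d i j)" using keys_std_poly assms(4) by fast
  then show ?thesis using keys_d[OF assms(1-3)] lt_monomials by auto
qed

text \<open>The swapped word is smaller by the tie-break, the words of \<open>d i j\<close> are
  smaller already in the exponent.\<close>

lemma keys_rel_tail: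
  assumes "1 \<le> i" "i < j" "j \<le> m" "w \<in> keys (rel_tail c d i j)"
  shows "wlt w (Word [j, i])"
proof -
  have "w = Word [i, j] \<or> w \<in> keys (std_poly (d i j))"
    using assms(4) unfolding rel_tail_def
    by (auto simp: in_keys_iff lookup_add lookup_single when_def)
  moreover have "wlt (Word [i, j]) (Word [j, i])"
    using assms by (intro wlt_permute) auto
  moreover have "wlt w (Word [j, i])" if "w \<in> keys (std_poly (d i j))"
    using std_word_lt[OF assms(1-3) that] assms(1-3) by (auto simp: wlt_def add.commute)
  ultimately show ?thesis by blast
qed

lemma keys_tail_ctx:
  assumes "1 \<le> i" "i < j" "j \<le> m" "u \<in> words m" "v \<in> words m"
    "w \<in> keys (single u k * rel_tail c d i j * wmon v)"
  shows "wlt w (u + Word [j, i] + v)"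
proof -
  obtain w1 v' where "w = w1 + v'" "w1 \<in> keys (single u k * rel_tail c d i j)"
      "v' \<in> keys (wmon v :: 'k ncpoly)"
    using keys_times[OF assms(6)] by blast
  moreover from this obtain u' w' where "w1 = u' + w'" "u' \<in> keys (single u k)"
      "w' \<in> keys (rel_tail c d i j)"
    using keys_times by blast
  ultimately have "w = u + w' + v" "w' \<in> keys (rel_tail c d i j)"
    by (auto split: if_splits)
  then show ?thesis using keys_rel_tail[OF assms(1-3)] wlt_ctx assms(4,5) by blast
qed

lemma rel_ctx:
  "single u k * rel i j * wmon v
     = single (u + Word [j, i] + v) k - single u k * rel_tail c d i j * wmon v"
  by (simp add: comm_rel_tail left_diff_distrib right_diff_distrib mult_single)

lemma keys_rel_ctx:
  assumes "1 \<le> i" "i < j" "j \<le> m" "u \<in> words m" "v \<in> words m"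
    "w \<in> keys (single u k * rel i j * wmon v)"
  shows "w = u + Word [j, i] + v \<or> wlt w (u + Word [j, i] + v)"
proof -
  have "w \<in> keys (single (u + Word [j, i] + v) k) \<or>
    w \<in> keys (single u k * rel_tail c d i j * wmon v)"
    using assms(6)[unfolded rel_ctx, THEN subsetD[OF keys_diff]] by (simp only: Un_iff)
  then show ?thesis using keys_tail_ctx[OF assms(1-5)] by (auto split: if_splits)
qed

lemma lookup_rel_ctx:
  assumes "1 \<le> i" "i < j" "j \<le> m" "u \<in> words m" "v \<in> words m"
  shows "lookup (single u k * rel i j * wmon v) (u + Word [j, i] + v) = k"
proof -
  have "u + Word [j, i] + v \<notin> keys (single u k * rel_tail c d i j * wmon v)"
    using keys_tail_ctx[OF assms] by fastforce
  then show ?thesis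
    unfolding rel_ctx by (simp add: lookup_minus in_keys_iff)
qed

lemma rel_fa: "1 \<le> i \<Longrightarrow> i < j \<Longrightarrow> j \<le> m \<Longrightarrow> rel i j \<in> fa m"
  using galg_d by (simp add: comm_rel_def fa_std_poly)

text \<open>Combinations of two-sided multiples \<open>u (x\<^sub>j x\<^sub>i - \<dots>) v\<close> of the relations whose leading word
  \<open>u x\<^sub>j x\<^sub>i v\<close> lies in \<open>S\<close>.\<close>

inductive_set J :: "nat free_monoid set \<Rightarrow> 'k ncpoly set" for S where
  zero: "0 \<in> J S"
| step: "f \<in> J S \<Longrightarrow> 1 \<le> i \<Longrightarrow> i < j \<Longrightarrow> j \<le> m \<Longrightarrow> u \<in> words m \<Longrightarrow> v \<in> words m \<Longrightarrow>
    u + Word [j, i] + v \<in> S \<Longrightarrow> f + single u k * rel i j * wmon v \<in> J S"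

lemma J_gen:
  "1 \<le> i \<Longrightarrow> i < j \<Longrightarrow> j \<le> m \<Longrightarrow> u \<in> words m \<Longrightarrow> v \<in> words m \<Longrightarrow>
    u + Word [j, i] + v \<in> S \<Longrightarrow> single u k * rel i j * wmon v \<in> J S"
  using J.step[OF J.zero] by fastforce

lemma J_add: "g \<in> J S \<Longrightarrow> f \<in> J S \<Longrightarrow> f + g \<in> J S"
  by (induction g rule: J.induct) (simp_all add: J.step flip: add.assoc)

lemma J_ctx:
  assumes "f \<in> J S" "\<And>w. w \<in> S \<Longrightarrow> u + w + v \<in> S'" "u \<in> words m" "v \<in> words m"
  shows "single u a * f * wmon v \<in> J S'"
  using assms(1)
proof (induction f rule: J.induct)
  case zero
  then show ?case by (simp add: J.zero)
next
  case (step f i j u' v' k)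
  have *: "single u a * (single u' k * rel i j * wmon v') * wmon v
    = single (u + u') (a * k) * rel i j * wmon (v' + v)"
    by (simp add: mult_single flip: mult.assoc) (simp add: mult_single mult.assoc)
  have "\<dots> \<in> J S'"
    using step assms(2)[OF step.hyps(7)] assms(3,4) by (intro J_gen) (auto simp: add.assoc)
  then show ?case
    using J_add step.IH by (simp add: distrib_left distrib_right *)
qed

lemma J_mono: "f \<in> J S \<Longrightarrow> S \<subseteq> S' \<Longrightarrow> f \<in> J S'"
  by (induction f rule: J.induct) (auto intro: J.intros)

lemma J_scal: "f \<in> J S \<Longrightarrow> scal a * f \<in> J S"
  using J_ctx[of f S 0 0 S a] by (simp add: scal_def)

lemma J_uminus: "f \<in> J S \<Longrightarrow> - f \<in> J S"
  using J_scal[of f S "-1"] by (simp add: scal_minus)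

lemma J_diff: "f \<in> J S \<Longrightarrow> g \<in> J S \<Longrightarrow> f - g \<in> J S"
  using J_add[OF J_uminus[of g S], of f] by simp

text \<open>After \<open>g\<close> is expanded into single terms, each word of \<open>g\<close>
  lengthens the leading words on the right, and its coefficient, being central, moves to the
  front.\<close>

lemma J_mult_right:
  assumes "f \<in> J S" "\<And>w w'. w \<in> S \<Longrightarrow> w' \<in> keys g \<Longrightarrow> w + w' \<in> S'" "g \<in> fa m"
  shows "f * g \<in> J S'"
proof -
  have "keys g \<subseteq> keys g" by simp
  then show ?thesis
  proof (induction g rule: poly_induct)
    case (single w k)
    then have "f * wmon w \<in> J S'"
      using J_ctx[OF assms(1), of 0 w S' 1] assms(2,3) by (auto simp: fa_def)
    then have "scal k * (f * wmon w) \<in> J S'" by (rule J_scal)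
    moreover have "scal k * (f * wmon w) = f * (scal k * wmon w)"
      using scal_comm[of f k] by (metis mult.assoc)
    ultimately show ?case by (simp add: scal_wmon)
  qed (auto simp: J.zero distrib_left J_add)
qed

lemma J_mult_left:
  assumes "f \<in> J S" "\<And>w w'. w \<in> S \<Longrightarrow> w' \<in> keys g \<Longrightarrow> w' + w \<in> S'" "g \<in> fa m"
  shows "g * f \<in> J S'"
proof -
  have "keys g \<subseteq> keys g" by simp
  then show ?thesis
  proof (induction g rule: poly_induct)
    case (single w k)
    then show ?case
      using J_ctx[OF assms(1), of w 0 S' k] assms(2,3) by (auto simp: fa_def)
  qed (auto simp: J.zero distrib_right J_add)
qed

lemma J_fa: "f \<in> J S \<Longrightarrow> f \<in> fa m"
  by (induction f rule: J.induct) (auto simp: rel_fa)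

end

section \<open>Overlaps of two relations\<close>

text \<open>The left side is the difference of the two ways of reducing the overlap
  \<open>xk xj xi\<close>. On the right, each relation is multiplied so that its leading word is
  another, smaller permutation of the three letters, and what remains is the nondegeneracy
  expression. In an abstract ring the scalars are just central elements, and the identity is settled
  by expanding both sides.\<close>

lemma overlap_identity:
  fixes xi xj xk dij dik djk a b e :: "'a::ring_1"
  assumes central: "\<And>x. x * a = a * x" "\<And>x. x * b = b * x" "\<And>x. x * e = e * x"
    and rij: "rij = xj * xi - a * xi * xj - dij"
    and rik: "rik = xk * xi - b * xi * xk - dik"
    and rjk: "rjk = xk * xj - e * xj * xk - djk"
  shows "rjk * xi - xk * rij
    = a * (rik * xj) - e * (xj * rik) - (e * b) * (rij * xk) + (a * b) * (xi * rjk)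
      - (b * e * dij * xk - xk * dij + e * xj * dik - a * dik * xj + djk * xi - a * b * xi * djk)"
proof -
  have c: "xk * a = a * xk" "xj * a = a * xj" "xi * a = a * xi" "xk * b = b * xk" "xj * b = b * xj"
    "xi * b = b * xi" "xk * e = e * xk" "xj * e = e * xj" "xi * e = e * xi"
    "b * a = a * b" "e * a = a * e" "e * b = b * e"
    by (rule central)+
  have c': "xk * (a * y) = a * (xk * y)" "xj * (a * y) = a * (xj * y)" "xi * (a * y) = a * (xi * y)"
    "xk * (b * y) = b * (xk * y)" "xj * (b * y) = b * (xj * y)" "xi * (b * y) = b * (xi * y)"
    "xk * (e * y) = e * (xk * y)" "xj * (e * y) = e * (xj * y)" "xi * (e * y) = e * (xi * y)"
    "b * (a * y) = a * (b * y)" "e * (a * y) = a * (e * y)" "e * (b * y) = b * (e * y)" for y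
    by (simp_all only: mult.assoc[symmetric] c)
  show ?thesis
    unfolding rij rik rjk
    by (simp add: distrib_left distrib_right left_diff_distrib right_diff_distrib mult.assoc c c')
qed

context galg_pbw
begin

text \<open>Each leading word equals relation plus tail. After this substitution the product of the
  two relations cancels; what is left is relation times tail minus tail times relation, and a tail
  contains only smaller words.\<close>

lemma J_disjoint:
  assumes ij: "1 \<le> i" "i < j" "j \<le> m" and ij': "1 \<le> i'" "i' < j'" "j' \<le> m"
    and w: "u \<in> words m" "t \<in> words m" "v \<in> words m"
  shows "wmon u * rel i j * wmon (t + Word [j', i'] + v)
    - wmon (u + Word [j, i] + t) * rel i' j' * wmon v
    \<in> J {w. wlt w (u + Word [j, i] + t + Word [j', i'] + v)}" (is "_ \<in> J ?S")
proof -
  let ?g = "wmon t * rel_tail c d i' j' * wmon v"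
  let ?h = "wmon u * rel_tail c d i j * wmon t"
  \<comment> \<open>The empty word \<open>wmon 0\<close> only brings the relation into the shape
    that \<open>J_gen\<close> expects.\<close>
  have "wmon u * rel i j * wmon 0 * ?g \<in> J ?S"
  proof (rule J_mult_right[OF J_gen[where S = "{u + Word [j, i]}"]])
    fix w w' assume "w \<in> {u + Word [j, i]}" "w' \<in> keys ?g"
    then show "w + w' \<in> ?S"
      using wlt_ctx[OF keys_tail_ctx[OF ij' w(2,3)], of w' 1 "u + Word [j, i]" 0] w ij
      by (simp add: add.assoc)
  next
    show "?g \<in> fa m" using w keys_rel_tail[OF ij']
      by (intro fa_mult) (auto simp: fa_def wlt_def)
  qed (use ij w in auto)
  moreover have "?h * (wmon 0 * rel i' j' * wmon v) \<in> J ?S"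
  proof (rule J_mult_left[OF J_gen[where S = "{Word [j', i'] + v}"]])
    fix w w' assume "w \<in> {Word [j', i'] + v}" "w' \<in> keys ?h"
    then show "w' + w \<in> ?S"
      using wlt_ctx[OF keys_tail_ctx[OF ij w(1,2)], of w' 1 0 "Word [j', i'] + v"] w ij'
      by (simp add: add.assoc)
  next
    show "?h \<in> fa m" using w keys_rel_tail[OF ij]
      by (intro fa_mult) (auto simp: fa_def wlt_def)
  qed (use ij' w in auto)
  moreover have "wmon u * rel i j * wmon (t + Word [j', i'] + v)
      - wmon (u + Word [j, i] + t) * rel i' j' * wmon v
    = wmon u * rel i j * wmon 0 * ?g - ?h * (wmon 0 * rel i' j' * wmon v)"
  proof -
    have 1: "wmon (t + Word [j', i'] + v) = wmon t * (rel i' j' + rel_tail c d i' j') * wmon v"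
      and 2: "wmon (u + Word [j, i] + t) = wmon u * (rel i j + rel_tail c d i j) * wmon t"
      by (simp_all add: comm_rel_tail mult_single)
    show ?thesis unfolding 1 2
      by (simp add: distrib_left distrib_right mult.assoc)
  qed
  ultimately show ?thesis using J_diff by presburger
qed

text \<open>Each rewriting step subtracts a multiple of a relation whose leading word is a word of
  the current polynomial. Steps never raise exponents, so the bound \<open>b\<close> survives, and
  summing the subtracted multiples recovers \<open>f\<close>.\<close>

lemma J_reduces:
  assumes "(galg_step m c d)\<^sup>*\<^sup>* f 0"
    and "\<And>w. w \<in> keys f \<Longrightarrow> w \<in> words m \<and> lt (exp_of w) b"
  shows "f \<in> J {w. w \<in> words m \<and> lt (exp_of w) b}"
  using assms
proof (induction rule: converse_rtranclp_induct)
  case base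
  then show ?case by (simp add: J.zero)
next
  case (step f g)
  let ?S = "{w. w \<in> words m \<and> lt (exp_of w) b}"
  obtain i j u v k where ij: "1 \<le> i" "i < j" "j \<le> m" "u + Word [j, i] + v \<in> keys f"
    and g: "g = f - single u k * rel i j * wmon v"
    using step.hyps(1) unfolding galg_step_def by blast
  have w: "u + Word [j, i] + v \<in> words m" "lt (exp_of (u + Word [j, i] + v)) b"
    using step.prems[OF ij(4)] by auto
  then have uv: "u \<in> words m" "v \<in> words m" by simp_all
  have "w \<in> words m \<and> lt (exp_of w) b" if "w \<in> keys g" for w
  proof -
    have "w \<in> keys f \<or> w \<in> keys (single u k * rel i j * wmon v)"
      using that[unfolded g, THEN subsetD[OF keys_diff]] by (simp only: Un_iff)
    then show ?thesis
    proof
      assume "w \<in> keys (single u k * rel i j * wmon v)"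
      then have "w = u + Word [j, i] + v \<or> wlt w (u + Word [j, i] + v)"
        using keys_rel_ctx[OF ij(1-3) uv] by blast
      then show ?thesis using w lt_trans[of "exp_of w" "exp_of (u + Word [j, i] + v)" b]
        by (auto simp: wlt_def)
    qed (use step.prems in auto)
  qed
  then have "g \<in> J ?S" using step.IH by blast
  moreover have "single u k * rel i j * wmon v \<in> J ?S"
    using ij uv w by (intro J_gen) auto
  ultimately have "g + single u k * rel i j * wmon v \<in> J ?S" by (rule J_add[rotated])
  then show ?case by (simp add: g)
qed

text \<open>Every summand is a variable times some \<open>d p q\<close>, where the three indices are
  \<open>i, j, k\<close> in some order. Admissibility puts its words strictly below the overlap
  already in the exponent, and the nondegeneracy hypothesis supplies the rewriting sequence.\<close>

lemma J_nondeg: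
  assumes ijk: "1 \<le> i" "i < j" "j < k" "k \<le> m"
  shows "nondeg_expr c d i j k \<in> J {w. wlt w (Word [k, j, i])}"
proof -
  let ?b = "var_exp k + var_exp j + var_exp i"
  define L where "L = {f :: 'k ncpoly. \<forall>w\<in>keys f. w \<in> words m \<and> lt (exp_of w) ?b}"
  have add_L: "f + g \<in> L" if "f \<in> L" "g \<in> L" for f g
    using that keys_add[of f g] by (auto simp: L_def)
  have diff_L: "f - g \<in> L" if "f \<in> L" "g \<in> L" for f g
    using that keys_diff[of f g] by (auto simp: L_def)
  have scal_L: "scal a * f \<in> L" if "f \<in> L" for f a
    using that keys_scal[of a f] by (auto simp: L_def)
  have ijk': "1 \<le> j" "j \<le> m" "i < k" "i \<le> m" "1 \<le> k" using ijk by auto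
  have right: "std_poly (d p q) * var s \<in> L" and left: "var s * std_poly (d p q) \<in> L"
    if pq: "1 \<le> p" "p < q" "q \<le> m" "s \<in> {1..m}" "var_exp p + var_exp q + var_exp s = ?b" for p q s
  proof -
    have *: "lt (exp_of w + var_exp s) ?b" "lt (var_exp s + exp_of w) ?b" "w \<in> words m"
      if "w \<in> keys (std_poly (d p q))" for w
    proof -
      show "lt (exp_of w + var_exp s) ?b"
        using std_word_lt[OF pq(1-3) that] pq(4) lt_add[of "exp_of w" "var_exp p + var_exp q" "var_exp s"]
        unfolding pq(5) by simp
      then show "lt (var_exp s + exp_of w) ?b" by (simp only: add.commute)
      show "w \<in> words m" using std_word_lt[OF pq(1-3) that] by simp
    qed
    show "std_poly (d p q) * var s \<in> L"
      unfolding L_def var_def using * pq(4) by (auto dest: keys_times)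
    show "var s * std_poly (d p q) \<in> L"
      unfolding L_def var_def using * pq(4) by (auto dest: keys_times)
  qed
  have "nondeg_expr c d i j k \<in> L"
    unfolding nondeg_expr_def mult.assoc
    by (intro add_L diff_L scal_L right left) (use ijk ijk' in \<open>auto simp: algebra_simps\<close>)
  then have "nondeg_expr c d i j k \<in> J {w. w \<in> words m \<and> lt (exp_of w) ?b}"
    using is_galg ijk by (intro J_reduces) (auto simp: is_galg_def reduces_to_zero_def L_def)
  then show ?thesis
    by (rule J_mono) (use ijk in \<open>auto simp: wlt_def exp_of_def add.assoc\<close>)
qed

text \<open>In \<open>overlap_identity\<close> the four multiples of relations have leading words
  that are lexicographically smaller permutations of \<open>k, j, i\<close>; the remaining summand
  is handled by \<open>J_nondeg\<close>.\<close>

lemma J_overlap: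
  assumes ijk: "1 \<le> i" "i < j" "j < k" "k \<le> m" and uv: "u \<in> words m" "v \<in> words m"
  shows "wmon u * rel j k * wmon (Word [i] + v) - wmon (u + Word [k]) * rel i j * wmon v
    \<in> J {w. wlt w (u + Word [k, j, i] + v)}"
proof -
  let ?S = "{w. wlt w (Word [k, j, i])}"
  have ijk': "1 \<le> j" "j \<le> m" "i < k" "i \<le> m" "1 \<le> k" using ijk by auto
  have p: "wlt (Word [k, i, j]) (Word [k, j, i])" "wlt (Word [j, k, i]) (Word [k, j, i])"
    "wlt (Word [j, i, k]) (Word [k, j, i])" "wlt (Word [i, k, j]) (Word [k, j, i])"
    using ijk ijk' by (auto simp: wlt_def lenlex_conv exp_of_def algebra_simps)
  have 1: "rel i k * var j \<in> J ?S"
    using J_gen[of i k 0 "Word [j]" ?S 1] ijk ijk' p by (simp add: var_def plus_free_monoid_def)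
  have 2: "var j * rel i k \<in> J ?S"
    using J_gen[of i k "Word [j]" 0 ?S 1] ijk ijk' p by (simp add: var_def plus_free_monoid_def)
  have 3: "rel i j * var k \<in> J ?S"
    using J_gen[of i j 0 "Word [k]" ?S 1] ijk ijk' p by (simp add: var_def plus_free_monoid_def)
  have 4: "var i * rel j k \<in> J ?S"
    using J_gen[of j k "Word [i]" 0 ?S 1] ijk ijk' p by (simp add: var_def plus_free_monoid_def)
  have "rel j k * var i - var k * rel i j
    = scal (c i j) * (rel i k * var j) - scal (c j k) * (var j * rel i k)
      - (scal (c j k) * scal (c i k)) * (rel i j * var k)
      + (scal (c i j) * scal (c i k)) * (var i * rel j k)
      - nondeg_expr c d i j k"
    unfolding nondeg_expr_def scal_mult
    by (rule overlap_identity) (simp_all add: comm_rel_def scal_comm)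
  also have "\<dots> \<in> J ?S"
    using 1 2 3 4 J_nondeg[OF ijk] unfolding scal_mult[symmetric]
    by (intro J_diff J_add J_scal)
  finally have "wmon u * (rel j k * var i - var k * rel i j) * wmon v
      \<in> J {w. wlt w (u + Word [k, j, i] + v)}"
    by (rule J_ctx) (use uv wlt_ctx in auto)
  moreover have "wmon (Word [i] + v) = (var i * wmon v :: 'k ncpoly)"
    "wmon (u + Word [k]) = (wmon u * var k :: 'k ncpoly)"
    by (simp_all add: var_def mult_single)
  ultimately show ?thesis
    by (simp add: left_diff_distrib right_diff_distrib mult.assoc)
qed

text \<open>Two rules applicable to one word either coincide, share one letter, or act on disjoint
  positions; \<open>J_overlap\<close> and \<open>J_disjoint\<close> settle the last two
  cases.\<close>

lemma J_confluent_aux: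
  assumes ij: "1 \<le> i" "i < j" "j \<le> m" and ij': "1 \<le> i'" "i' < j'" "j' \<le> m"
    and uv: "u \<in> words m" "v \<in> words m" and uv': "u' \<in> words m" "v' \<in> words m"
    and eq: "u + Word [j, i] + v = u' + Word [j', i'] + v'"
    and len: "length (letters u) \<le> length (letters u')"
  shows "wmon u * rel i j * wmon v - wmon u' * rel i' j' * wmon v' \<in> J {w. wlt w (u + Word [j, i] + v)}"
proof -
  have eq': "letters u @ [j, i] @ letters v = letters u' @ [j', i'] @ letters v'"
    using arg_cong[OF eq, of letters] by simp
  have "\<exists>s. letters u @ s = letters u' \<and> [j, i] @ letters v = s @ [j', i'] @ letters v'"
    using len eq'[unfolded append_eq_append_conv2[of "letters u"]] by auto
  then obtain s where s: "letters u' = letters u @ s" "[j, i] @ letters v = s @ [j', i'] @ letters v'"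
    by metis
  \<comment> \<open>\<open>s\<close> lists the letters between the starting points of the two
    occurrences, so its length distinguishes the three cases.\<close>
  consider "s = []" | x where "s = [x]" | x y t where "s = x # y # t"
    by (metis neq_Nil_conv)
  then show ?thesis
  proof cases
    case 1
    then have "u' = u" "j = j'" "i = i'" "v = v'"
      using s by (auto intro: free_monoid.expand)
    then show ?thesis by (simp add: J.zero)
  next
    case 2
    then have *: "x = j" "i = j'" "letters v = i' # letters v'" using s(2) by auto
    then have "u' = u + Word [j]" "v = Word [i'] + v'"
      using s(1) 2 by (auto intro: free_monoid.expand)
    moreover have "u + Word [j, i] + (Word [i'] + v') = u + Word [j, j', i'] + v'"
      using *(2) by (auto intro: free_monoid.expand)
    ultimately show ?thesis
      using J_overlap[of i' i j u v'] ij ij' uv uv' * by simp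
  next
    case 3
    then have *: "x = j" "y = i" "letters v = t @ [j', i'] @ letters v'" using s(2) by auto
    then have "u' = u + Word [j, i] + Word t" "v = Word t + Word [j', i'] + v'"
      using s(1) 3 by (auto intro: free_monoid.expand)
    then show ?thesis
      using J_disjoint[OF ij ij' uv(1) _ uv'(2), of "Word t"] uv uv' by (simp add: add.assoc)
  qed
qed

lemma J_confluent:
  assumes ij: "1 \<le> i" "i < j" "j \<le> m" and ij': "1 \<le> i'" "i' < j'" "j' \<le> m"
    and uv: "u \<in> words m" "v \<in> words m" and uv': "u' \<in> words m" "v' \<in> words m"
    and eq: "u + Word [j, i] + v = u' + Word [j', i'] + v'"
  shows "wmon u * rel i j * wmon v - wmon u' * rel i' j' * wmon v' \<in> J {w. wlt w (u + Word [j, i] + v)}"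
proof (cases "length (letters u) \<le> length (letters u')")
  case True
  then show ?thesis by (intro J_confluent_aux ij ij' uv uv' eq)
next
  case False
  then have "wmon u' * rel i' j' * wmon v' - wmon u * rel i j * wmon v
      \<in> J {w. wlt w (u' + Word [j', i'] + v')}"
    by (intro J_confluent_aux ij ij' uv uv' eq[symmetric]) simp
  from J_uminus[OF this] show ?thesis by (simp add: eq)
qed

text \<open>By \<open>J_confluent\<close>, all multiples of relations with leading word
  \<open>w0\<close> agree modulo smaller ones. They can be merged into one, whose coefficient is
  then visible at \<open>w0\<close>.\<close>

lemma J_split_top:
  assumes "f \<in> J {w. w = w0 \<or> wlt w w0}"
  shows "f \<in> J {w. wlt w w0} \<or>
    (\<exists>i j u v k. 1 \<le> i \<and> i < j \<and> j \<le> m \<and> u \<in> words m \<and> v \<in> words m \<and> u + Word [j, i] + v = w0 \<and>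
      f - single u k * rel i j * wmon v \<in> J {w. wlt w w0})"
  using assms
proof (induction f rule: J.induct)
  case zero
  then show ?case by (simp add: J.zero)
next
  case (step f i j u v k)
  let ?g = "\<lambda>k. single u k * rel i j * wmon v"
  note ij = step.hyps(2-4) and uv = step.hyps(5,6)
  from step.hyps(7) consider "wlt (u + Word [j, i] + v) w0" | "u + Word [j, i] + v = w0" by blast
  then show ?case
  proof cases
    case 1
    then have g: "?g k \<in> J {w. wlt w w0}" by (intro J_gen ij uv) simp
    from step.IH show ?thesis
    proof (elim disjE exE conjE)
      assume "f \<in> J {w. wlt w w0}"
      then show ?thesis using J_add[OF g] by blast
    next
      fix i' j' u' v' k'
      assume *: "1 \<le> i'" "i' < j'" "j' \<le> m" "u' \<in> words m" "v' \<in> words m" "u' + Word [j', i'] + v' = w0"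
        "f - single u' k' * rel i' j' * wmon v' \<in> J {w. wlt w w0}"
      have "f + ?g k - single u' k' * rel i' j' * wmon v' \<in> J {w. wlt w w0}"
        using J_add[OF g *(7)] by (simp add: algebra_simps)
      then show ?thesis using * by blast
    qed
  next
    case 2
    from step.IH show ?thesis
    proof (elim disjE exE conjE)
      assume "f \<in> J {w. wlt w w0}"
      then have "f + ?g k - ?g k \<in> J {w. wlt w w0}" by simp
      then show ?thesis using ij uv 2 by blast
    next
      fix i' j' u' v' k'
      assume *: "1 \<le> i'" "i' < j'" "j' \<le> m" "u' \<in> words m" "v' \<in> words m" "u' + Word [j', i'] + v' = w0"
        "f - single u' k' * rel i' j' * wmon v' \<in> J {w. wlt w w0}"
      \<comment> \<open>The multiple stored at the primed position is traded for one at the new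
        position, after which the coefficients \<open>k\<close> and \<open>k'\<close> add
        up.\<close>
      have "scal k' * (wmon u' * rel i' j' * wmon v' - wmon u * rel i j * wmon v) \<in> J {w. wlt w w0}"
        using J_confluent[OF *(1-3) ij *(4,5) uv] 2 *(6) J_scal by simp
      also have "scal k' * (wmon u' * rel i' j' * wmon v' - wmon u * rel i j * wmon v)
         = single u' k' * rel i' j' * wmon v' - ?g k'"
        by (simp add: right_diff_distrib scal_wmon flip: mult.assoc)
      finally have "f - single u' k' * rel i' j' * wmon v'
          + (single u' k' * rel i' j' * wmon v' - ?g k') \<in> J {w. wlt w w0}"
        using *(7) J_add by blast
      then have "f + ?g k - ?g (k + k') \<in> J {w. wlt w w0}"
        by (simp add: single_add distrib_right algebra_simps)
      then show ?thesis using ij uv 2 by blast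
    qed
  qed
qed

lemma J_keys: "f \<in> J {w. wlt w w0} \<Longrightarrow> w \<in> keys f \<Longrightarrow> wlt w w0"
proof (induction f rule: J.induct)
  case (step f i j u v k)
  have "w \<in> keys f \<or> w \<in> keys (single u k * rel i j * wmon v)"
    using subsetD[OF keys_add step.prems] by (simp only: Un_iff)
  then show ?case
    using step.IH step.hyps(7) keys_rel_ctx[OF step.hyps(2-6), of w k]
      wlt_trans[of w "u + Word [j, i] + v" w0] by auto
qed simp

text \<open>Since \<open>wlt\<close> is total on words, the finitely many leading words used in a
  combination have a largest one.\<close>

lemma J_bounded:
  assumes "f \<in> J S" "S \<subseteq> words m"
  shows "f = 0 \<or> (\<exists>w0\<in>S. f \<in> J {w. w = w0 \<or> wlt w w0})"
  using assms(1)
proof (induction f rule: J.induct)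
  case (step f i j u v k)
  let ?g = "single u k * rel i j * wmon v" and ?w = "u + Word [j, i] + v"
  have g: "?g \<in> J {w. w = ?w \<or> wlt w ?w}" using step.hyps by (intro J_gen) auto
  from step.IH show ?case
  proof (elim disjE bexE)
    assume "f = 0"
    then show ?thesis using g step.hyps(7) by auto
  next
    fix w0 assume w0: "w0 \<in> S" "f \<in> J {w. w = w0 \<or> wlt w w0}"
    have "wlt ?w w0 \<or> w0 = ?w \<or> wlt w0 ?w"
      using wlt_total w0(1) step.hyps(7) assms(2) by blast
    then consider "?w = w0 \<or> wlt ?w w0" | "wlt w0 ?w" by blast
    then show ?thesis
    proof cases
      case 1
      then have "?g \<in> J {w. w = w0 \<or> wlt w w0}" using step.hyps by (intro J_gen) auto
      then show ?thesis using J_add w0 by blast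
    next
      case 2
      then have "f \<in> J {w. w = ?w \<or> wlt w ?w}"
        by (intro J_mono[OF w0(2)]) (use wlt_trans in blast)
      then show ?thesis using J_add g step.hyps(7) by blast
    qed
  qed
qed simp

text \<open>Descent on the largest leading word: a leading word contains a descent and cannot occur
  in a sorted polynomial, so the merged top multiple has coefficient zero and the bound can be
  lowered.\<close>

lemma J_sorted_below:
  assumes "f \<in> J {w. w = w0 \<or> wlt w w0}" "\<And>w. w \<in> keys f \<Longrightarrow> sorted (letters w)"
  shows "f = 0"
  using assms(1)
proof (induction w0 rule: wfp_induct_rule[OF wfp_wlt])
  case (1 w0)
  have "f \<in> J {w. wlt w w0}"
  proof -
    from J_split_top[OF 1(2)] show ?thesis
    proof (elim disjE exE conjE)
      fix i j u v k
      let ?g = "single u k * rel i j * wmon v"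
      assume *: "1 \<le> i" "i < j" "j \<le> m" "u \<in> words m" "v \<in> words m" "u + Word [j, i] + v = w0"
        "f - ?g \<in> J {w. wlt w w0}"
      \<comment> \<open>Comparing coefficients at \<open>w0\<close>: the remainder has only smaller
        words and \<open>f\<close> has only sorted ones, so nothing can balance
        \<open>k\<close>.\<close>
      have "lookup (f - ?g) w0 = 0"
        using J_keys[OF *(7), of w0] by (auto simp: in_keys_iff)
      moreover have "lookup f w0 = 0"
        using assms(2)[of w0] *(2) *(6)[symmetric] by (auto simp: in_keys_iff sorted_append)
      ultimately have "k = 0"
        using lookup_rel_ctx[OF *(1-5), of k] by (simp add: lookup_minus *(6))
      then show ?thesis using *(7) by simp
    qed
  qed
  then show ?case using J_bounded[of f "{w. wlt w w0}"] 1(1) by (auto simp: wlt_def)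
qed

text \<open>This is the linear independence of the standard monomials modulo the relations.\<close>

lemma J_sorted:
  assumes "f \<in> J (words m)" "\<And>w. w \<in> keys f \<Longrightarrow> sorted (letters w)"
  shows "f = 0"
  using J_bounded[OF assms(1)] J_sorted_below[OF _ assms(2)] by blast


section \<open>The ideal of relations\<close>

lemma ideal_J: "ideal (J (words m)) (free_algebra m)"
proof (rule idealI)
  show "ring (free_algebra m)" by (rule ring_free_algebra)
  then interpret R: ring "free_algebra m :: 'k ncpoly ring" .
  show "subgroup (J (words m)) (add_monoid (free_algebra m))"
  proof (rule R.add.subgroupI)
    show "J (words m) \<subseteq> carrier (free_algebra m)"
      using J_fa by (auto simp: carrier_free_algebra)
    show "J (words m) \<noteq> {}" using J.zero by auto
    show "\<ominus>\<^bsub>free_algebra m\<^esub> a \<in> J (words m)" if "a \<in> J (words m)" for a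
    proof -
      have "\<ominus>\<^bsub>free_algebra m\<^esub> a = - a"
        by (rule R.minus_equality)
          (use J_fa[OF that] in \<open>auto simp: free_algebra_def carrier_free_algebra[unfolded free_algebra_def, simplified]\<close>)
      then show ?thesis using J_uminus that by simp
    qed
    show "a \<oplus>\<^bsub>free_algebra m\<^esub> b \<in> J (words m)" if "a \<in> J (words m)" "b \<in> J (words m)" for a b
      using J_add that by (simp add: free_algebra_def)
  qed
  show "x \<otimes>\<^bsub>free_algebra m\<^esub> a \<in> J (words m)"
    if "a \<in> J (words m)" "x \<in> carrier (free_algebra m)" for a x
    using J_mult_left[of a "words m" x "words m"] that
    by (auto simp: free_algebra_def fa_def words_def)
  show "a \<otimes>\<^bsub>free_algebra m\<^esub> x \<in> J (words m)"
    if "a \<in> J (words m)" "x \<in> carrier (free_algebra m)" for a x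
    using J_mult_right[of a "words m" x "words m"] that
    by (auto simp: free_algebra_def fa_def words_def)
qed

text \<open>With \<open>S = words m\<close> the side condition on leading words admits every
  two-sided multiple of a relation, so the bounded combinations exhaust the generated ideal.\<close>

lemma galg_ideal_eq: "galg_ideal m c d = J (words m)"
proof
  let ?G = "{comm_rel c d i j | i j. 1 \<le> i \<and> i < j \<and> j \<le> m}"
  have "comm_rel c d i j \<in> J (words m)" if "1 \<le> i" "i < j" "j \<le> m" for i j
    using J_gen[of i j 0 0 "words m" 1] that by simp
  then show "galg_ideal m c d \<subseteq> J (words m)"
    using ideal_J unfolding galg_ideal_def genideal_def by blast
  show "J (words m) \<subseteq> galg_ideal m c d"
    unfolding galg_ideal_def genideal_def
  proof safe
    fix x I assume x: "x \<in> J (words m)" and I: "ideal I (free_algebra m)" and G: "?G \<subseteq> I"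
    interpret I: ideal I "free_algebra m" by fact
    note sub = additive_subgroup.zero_closed[OF ideal.axioms(1)[OF I]]
      additive_subgroup.a_closed[OF ideal.axioms(1)[OF I]]
    have mult: "(*) = monoid.mult (free_algebra m :: 'k ncpoly ring)" "(+) = ring.add (free_algebra m :: 'k ncpoly ring)"
      "0 = ring.zero (free_algebra m :: 'k ncpoly ring)"
      by (simp_all add: free_algebra_def)
    show "x \<in> I"
      using x
    proof (induction x rule: J.induct)
      case zero
      then show ?case unfolding mult by (rule sub)
    next
      case (step f i j u v k)
      have "rel i j \<in> I" using step G by blast
      moreover have "single u k \<in> carrier (free_algebra m)"
        "wmon v \<in> carrier (free_algebra m :: 'k ncpoly ring)"
        using step by (simp_all add: carrier_free_algebra)
      ultimately show ?case
        using step.IH unfolding mult by (intro sub I.I_l_closed I.I_r_closed)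
    qed
  qed
qed

section \<open>Normal forms modulo the ideal\<close>

abbreviation I :: "'k ncpoly set" where
  "I \<equiv> J (words m)"

lemma I_mult_left: "f \<in> I \<Longrightarrow> g \<in> fa m \<Longrightarrow> g * f \<in> I"
  by (rule J_mult_left[where S = "words m"]) (auto simp: fa_def)

lemma I_mult_right: "f \<in> I \<Longrightarrow> g \<in> fa m \<Longrightarrow> f * g \<in> I"
  by (rule J_mult_right[where S = "words m"]) (auto simp: fa_def)

lemma I_cong_mult:
  assumes "f - f' \<in> I" "g - g' \<in> I" "f' \<in> fa m" "g \<in> fa m"
  shows "f * g - f' * g' \<in> I"
proof -
  have "f * g - f' * g' = (f - f') * g + f' * (g - g')"
    by (simp add: left_diff_distrib right_diff_distrib)
  then show ?thesis using assms I_mult_left I_mult_right J_add by simp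
qed

text \<open>Lower terms in normal form: besides the bound on exponents, only sorted words are
  allowed.\<close>

definition Low :: "monomial \<Rightarrow> 'k ncpoly set" where
  "Low b = {g. keys g \<subseteq> sorted_words m \<and> (\<forall>w\<in>keys g. lt (exp_of w) b)}"

lemma Low_zero [simp]: "0 \<in> Low b"
  by (simp add: Low_def)

lemma Low_add: "f \<in> Low b \<Longrightarrow> g \<in> Low b \<Longrightarrow> f + g \<in> Low b"
  using keys_add[of f g] unfolding Low_def by blast

lemma Low_scal: "f \<in> Low b \<Longrightarrow> scal a * f \<in> Low b"
  using keys_scal[of a f] unfolding Low_def by blast

lemma Low_mono: "f \<in> Low b \<Longrightarrow> lt b b' \<Longrightarrow> f \<in> Low b'"
  using lt_trans unfolding Low_def by fast

text \<open>A swap keeps the exponent and multiplies the coefficient by a nonzero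
  \<open>c i j\<close>, while \<open>d i j\<close> contributes strictly smaller exponents only.
  Hence the top coefficient \<open>k\<close> is a product of nonzero scalars; its being nonzero is
  what later makes leading monomials multiplicative.\<close>

lemma word_nf:
  assumes "w \<in> words m"
  shows "\<exists>k. k \<noteq> 0 \<and> (\<exists>g \<in> Low (exp_of w). wmon w - (single (std_word (exp_of w)) k + g) \<in> I)"
  using assms
proof (induction w rule: wfp_induct_rule[OF wfp_wlt])
  case (1 w)
  show ?case
  proof (cases "sorted (letters w)")
    case True
    then show ?thesis
      by (intro exI[of _ 1] conjI bexI[of _ 0]) (simp_all add: std_word_exp_of J.zero)
  next
    case False
    then obtain ys j i zs where "letters w = ys @ [j, i] @ zs" and "i < j"
      using not_sorted_split by blast
    then have w: "w = Word ys + Word [j, i] + Word zs"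
      by (auto intro: free_monoid.expand)
    let ?u = "Word ys" and ?v = "Word zs"
    have ij: "1 \<le> i" "i < j" "j \<le> m" and uv: "?u \<in> words m" "?v \<in> words m"
      using 1(2) \<open>i < j\<close> unfolding w words_plus by (auto simp: words_def)
    let ?w1 = "?u + Word [i, j] + ?v"
    have e1: "exp_of ?w1 = exp_of w" by (simp add: w add.commute)
    have "wlt (Word [i, j]) (Word [j, i])" using ij by (intro wlt_permute) auto
    then have "wlt ?w1 w" using wlt_ctx uv unfolding w by blast
    moreover from this have "?w1 \<in> words m" by (simp add: wlt_def)
    ultimately have "\<exists>k. k \<noteq> 0 \<and> (\<exists>g \<in> Low (exp_of ?w1).
        wmon ?w1 - (single (std_word (exp_of ?w1)) k + g) \<in> I)"
      by (rule 1(1))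
    then obtain k g where k: "k \<noteq> 0" and g: "g \<in> Low (exp_of w)"
      and 2: "wmon ?w1 - (single (std_word (exp_of w)) k + g) \<in> I"
      unfolding e1 by blast
    \<comment> \<open>Here the leading terms of the words of \<open>f\<close> are themselves lower
      terms, so the exponent has to drop; the word ordering is needed for the induction
      hypothesis.\<close>
    have low: "\<exists>g \<in> Low (exp_of w). f - g \<in> I"
      if "keys f \<subseteq> {w'. wlt w' w \<and> lt (exp_of w') (exp_of w)}" for f
      using that
    proof (induction f rule: poly_induct)
      case zero
      show ?case using J.zero by (intro bexI[of _ 0]) auto
    next
      case (single w' a)
      then obtain b g where g: "g \<in> Low (exp_of w')"
        and "wmon w' - (single (std_word (exp_of w')) b + g) \<in> I"
        using 1(1)[of w'] by (auto simp: wlt_def)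
      then have "scal a * (wmon w' - (single (std_word (exp_of w')) b + g)) \<in> I"
        by (intro J_scal)
      then have "single w' a - scal a * (single (std_word (exp_of w')) b + g) \<in> I"
        unfolding right_diff_distrib scal_wmon .
      moreover have "single (std_word (exp_of w')) b \<in> Low (exp_of w)"
        using single by (auto simp: Low_def wlt_def exp_of_monomials)
      then have "scal a * (single (std_word (exp_of w')) b + g) \<in> Low (exp_of w)"
        using Low_mono[OF g, of "exp_of w"] single by (intro Low_scal Low_add) auto
      ultimately show ?case by blast
    next
      case (add f g)
      then obtain f' g' where "f' \<in> Low (exp_of w)" "g' \<in> Low (exp_of w)" "f - f' \<in> I" "g - g' \<in> I"
        by blast
      then show ?case
        using Low_add J_add[of "f - f'" _ "g - g'"]
        by (intro bexI[of _ "f' + g'"]) (auto simp: algebra_simps)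
    qed
    let ?t = "wmon ?u * std_poly (d i j) * wmon ?v"
    have "\<exists>g \<in> Low (exp_of w). ?t - g \<in> I"
    proof (rule low, rule subsetI)
      fix w' assume "w' \<in> keys ?t"
      then obtain w1 v' where "w' = w1 + v'" "w1 \<in> keys (wmon ?u * std_poly (d i j))"
          "v' \<in> keys (wmon ?v :: 'k ncpoly)"
        using keys_times by blast
      moreover from this obtain u' w2 where "w1 = u' + w2" "u' \<in> keys (wmon ?u :: 'k ncpoly)"
          "w2 \<in> keys (std_poly (d i j))"
        using keys_times by blast
      ultimately have w': "w' = ?u + w2 + ?v" "w2 \<in> keys (std_poly (d i j))"
        by (auto split: if_splits)
      have "w2 \<in> words m" "lt (exp_of w2) (var_exp j + var_exp i)"
        using std_word_lt[OF ij w'(2)] by (auto simp: add.commute)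
      then have "lt (exp_of w') (exp_of w)" "w' \<in> words m"
        using uv lt_ctx[of "exp_of w2" "var_exp j + var_exp i" "exp_of ?u" "exp_of ?v"]
        by (simp_all add: w' w exp_of_monomials)
      then show "w' \<in> {w'. wlt w' w \<and> lt (exp_of w') (exp_of w)}"
        using 1(2) by (simp add: wlt_def)
    qed
    then obtain h where h: "h \<in> Low (exp_of w)" "?t - h \<in> I" by blast
    have "wmon ?u * rel i j * wmon ?v \<in> I" using ij uv by (intro J_gen) auto
    moreover have "wmon ?u * rel i j * wmon ?v = wmon w - scal (c i j) * wmon ?w1 - ?t"
    proof -
      have "wmon ?u * rel i j * wmon ?v = wmon ?u * wmon (Word [j, i]) * wmon ?v
          - wmon ?u * single (Word [i, j]) (c i j) * wmon ?v - ?t"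
        unfolding comm_rel_alt by (simp only: left_diff_distrib right_diff_distrib)
      then show ?thesis unfolding scal_wmon by (simp add: mult_single w)
    qed
    ultimately have 3: "wmon w - scal (c i j) * wmon ?w1 - ?t \<in> I" by simp
    let ?g = "scal (c i j) * g + h"
    have "(wmon w - scal (c i j) * wmon ?w1 - ?t) + (?t - h)
        + scal (c i j) * (wmon ?w1 - (single (std_word (exp_of w)) k + g)) \<in> I"
      by (intro J_add J_scal 3 2 h)
    also have "(wmon w - scal (c i j) * wmon ?w1 - ?t) + (?t - h)
        + scal (c i j) * (wmon ?w1 - (single (std_word (exp_of w)) k + g))
      = wmon w - (single (std_word (exp_of w)) (c i j * k) + ?g)"
      by (simp add: right_diff_distrib distrib_left scal_def mult_single)
    finally show ?thesis
      using k galg_c[OF ij] g h by (intro exI[of _ "c i j * k"] conjI bexI[of _ ?g] Low_add Low_scal) auto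
  qed
qed

lemma poly_nf:
  assumes "f \<in> fa m"
  shows "\<exists>g. keys g \<subseteq> sorted_words m \<and> f - g \<in> I"
proof -
  have "keys f \<subseteq> words m" using assms by (simp add: fa_def)
  then show ?thesis
  proof (induction f rule: poly_induct)
    case zero
    show ?case using J.zero by (intro exI[of _ 0]) auto
  next
    case (single w k)
    then obtain b g where g: "g \<in> Low (exp_of w)"
      and "wmon w - (single (std_word (exp_of w)) b + g) \<in> I"
      using word_nf by blast
    then have "scal k * (wmon w - (single (std_word (exp_of w)) b + g)) \<in> I"
      by (intro J_scal)
    then have "single w k - scal k * (single (std_word (exp_of w)) b + g) \<in> I"
      unfolding right_diff_distrib scal_wmon .
    moreover have "keys (scal k * (single (std_word (exp_of w)) b + g)) \<subseteq> sorted_words m"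
      using g single
      by (intro subset_trans[OF keys_scal] subset_trans[OF keys_add])
        (auto simp: Low_def exp_of_monomials)
    ultimately show ?case by blast
  next
    case (add f g)
    then obtain f' g' where "keys f' \<subseteq> sorted_words m" "keys g' \<subseteq> sorted_words m" "f - f' \<in> I" "g - g' \<in> I"
      by blast
    then show ?case
      using keys_add[of f' g'] J_add[of "f - f'" _ "g - g'"]
      by (intro exI[of _ "f' + g'"]) (auto simp: algebra_simps)
  qed
qed

text \<open>On \<open>fa m\<close> the description is proper: existence is \<open>poly_nf\<close>,
  and two sorted representatives differ by a sorted element of the ideal, which is zero by
  \<open>J_sorted\<close>.\<close>

definition nf :: "'k ncpoly \<Rightarrow> 'k ncpoly" where
  "nf f = (THE g. keys g \<subseteq> sorted_words m \<and> f - g \<in> I)"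

lemma nf_eqI:
  assumes "keys g \<subseteq> sorted_words m" "f - g \<in> I"
  shows "nf f = g"
  unfolding nf_def
proof (rule the_equality)
  fix h assume h: "keys h \<subseteq> sorted_words m \<and> f - h \<in> I"
  then have "g - h \<in> I" using J_diff[OF _ assms(2), of "f - h"] by simp
  moreover have "sorted (letters w)" if "w \<in> keys (g - h)" for w
    using subsetD[OF keys_diff that] h assms(1) by (auto simp: sorted_words_def)
  ultimately have "g - h = 0" by (rule J_sorted)
  then show "h = g" by simp
qed (use assms in simp)

lemma nf_spec: "f \<in> fa m \<Longrightarrow> keys (nf f) \<subseteq> sorted_words m \<and> f - nf f \<in> I"
  using poly_nf nf_eqI by metis

lemma nf_fa: "f \<in> fa m \<Longrightarrow> nf f \<in> fa m"
  using nf_spec sorted_words_subset by (fastforce simp: fa_def)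

lemma nf_sorted: "keys g \<subseteq> sorted_words m \<Longrightarrow> nf g = g"
  by (rule nf_eqI) (simp_all add: J.zero)

lemma nf_0 [simp]: "nf 0 = 0"
  by (simp add: nf_sorted)

lemma nf_nf [simp]: "f \<in> fa m \<Longrightarrow> nf (nf f) = nf f"
  using nf_spec nf_sorted by blast

lemma nf_cong_iff: "f \<in> fa m \<Longrightarrow> g \<in> fa m \<Longrightarrow> nf f = nf g \<longleftrightarrow> f - g \<in> I"
proof
  assume fg: "f \<in> fa m" "g \<in> fa m"
  show "f - g \<in> I" if "nf f = nf g"
    using J_diff[of "f - nf f" _ "g - nf g"] nf_spec[OF fg(1)] nf_spec[OF fg(2)] that by simp
  show "nf f = nf g" if "f - g \<in> I"
    using J_add[OF that, of "g - nf g"] nf_spec[of g] fg by (intro nf_eqI) (auto simp: algebra_simps)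
qed

lemma nf_add: "f \<in> fa m \<Longrightarrow> g \<in> fa m \<Longrightarrow> nf (f + g) = nf f + nf g"
  using J_add[of "f - nf f" _ "g - nf g"] nf_spec[of f] nf_spec[of g] keys_add[of "nf f" "nf g"]
  by (intro nf_eqI) (auto simp: algebra_simps)

lemma nf_diff: "f \<in> fa m \<Longrightarrow> g \<in> fa m \<Longrightarrow> nf (f - g) = nf f - nf g"
  using J_diff[of "f - nf f" _ "g - nf g"] nf_spec[of f] nf_spec[of g] keys_diff[of "nf f" "nf g"]
  by (intro nf_eqI) (auto simp: algebra_simps)

lemma nf_scal: "f \<in> fa m \<Longrightarrow> nf (scal k * f) = scal k * nf f"
  using J_scal[of "f - nf f" _ k] nf_spec[of f] keys_scal[of k "nf f"]
  by (intro nf_eqI) (auto simp: right_diff_distrib)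

lemma nf_mult_cong:
  assumes "nf f = nf f'" "nf g = nf g'" "f \<in> fa m" "f' \<in> fa m" "g \<in> fa m" "g' \<in> fa m"
  shows "nf (f * g) = nf (f' * g')"
  using assms I_cong_mult[of f f' g g'] nf_cong_iff by simp

section \<open>Leading monomials and the absence of zero divisors\<close>

lemma nf_low:
  assumes "\<And>w. w \<in> keys f \<Longrightarrow> w \<in> words m \<and> lt (exp_of w) b"
  shows "nf f \<in> Low b"
proof -
  have "keys f \<subseteq> {w. w \<in> words m \<and> lt (exp_of w) b}" using assms by blast
  then have "f \<in> fa m \<and> nf f \<in> Low b"
  proof (induction f rule: poly_induct)
    case (single w k)
    then obtain a g where g: "g \<in> Low (exp_of w)"
      and 1: "wmon w - (single (std_word (exp_of w)) a + g) \<in> I"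
      using word_nf by blast
    have s: "single (std_word (exp_of w)) a \<in> Low b"
      using single by (auto simp: Low_def exp_of_monomials)
    moreover have "g \<in> Low b" using g single Low_mono by blast
    ultimately have "single (std_word (exp_of w)) a + g \<in> Low b" by (rule Low_add)
    moreover from this have "nf (wmon w) = single (std_word (exp_of w)) a + g"
      using 1 by (intro nf_eqI) (auto simp: Low_def)
    ultimately have "nf (wmon w) \<in> Low b" by simp
    then show ?case using single nf_scal[of "wmon w" k] by (auto simp: scal_wmon Low_scal dest: Low_scal[of _ _ k])
  qed (auto simp: nf_add Low_add)
  then show ?thesis by blast
qed

text \<open>A relation rather than a function, because the zero class has no leading monomial. It
  refers to the normal form and hence depends only on the class of \<open>f\<close>.\<close>

definition lm :: "'k ncpoly \<Rightarrow> monomial \<Rightarrow> bool" where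
  "lm f a \<longleftrightarrow> a \<in> monomials m \<and>
    (\<exists>k g. k \<noteq> 0 \<and> g \<in> Low a \<and> nf f = single (std_word a) k + g)"

lemma lookup_Low:
  assumes "g \<in> Low a"
  shows "lookup g (std_word a) = 0"
proof -
  have "std_word a \<notin> keys g" using assms by (auto simp: Low_def)
  then show ?thesis by (simp add: in_keys_iff)
qed

lemma lm_iff:
  assumes "f \<in> fa m"
  shows "lm f a \<longleftrightarrow> std_word a \<in> keys (nf f) \<and> (\<forall>w\<in>keys (nf f). w = std_word a \<or> lt (exp_of w) a)"
proof
  assume "lm f a"
  then obtain k g where *: "k \<noteq> 0" "g \<in> Low a" "nf f = single (std_word a) k + g"
    unfolding lm_def by blast
  have "lookup (nf f) (std_word a) = k"
    using * lookup_Low by (simp add: lookup_add)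
  moreover have "w = std_word a \<or> lt (exp_of w) a" if "w \<in> keys (nf f)" for w
    using subsetD[OF keys_add that[unfolded *(3)]] *(2) by (auto simp: Low_def split: if_splits)
  ultimately show "std_word a \<in> keys (nf f) \<and> (\<forall>w\<in>keys (nf f). w = std_word a \<or> lt (exp_of w) a)"
    using *(1) by (auto simp: in_keys_iff)
next
  assume *: "std_word a \<in> keys (nf f) \<and> (\<forall>w\<in>keys (nf f). w = std_word a \<or> lt (exp_of w) a)"
  let ?k = "lookup (nf f) (std_word a)"
  let ?g = "nf f - single (std_word a) ?k"
  have k: "keys (nf f) \<subseteq> sorted_words m" using nf_spec assms by blast
  have "?g \<in> Low a"
  proof -
    have "w \<in> keys (nf f) \<and> w \<noteq> std_word a" if "w \<in> keys ?g" for w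
      using that by (cases "w = std_word a") (auto simp: in_keys_iff lookup_minus lookup_single when_def)
    then show ?thesis using * k by (auto simp: Low_def)
  qed
  moreover have "nf f = single (std_word a) ?k + ?g" "?k \<noteq> 0" "a \<in> monomials m"
    using * k by (auto simp: in_keys_iff)
  ultimately show "lm f a" unfolding lm_def by blast
qed

lemma lm_exists:
  assumes "f \<in> fa m" "nf f \<noteq> 0"
  shows "\<exists>a. lm f a"
proof -
  let ?S = "exp_of ` keys (nf f)"
  have k: "keys (nf f) \<subseteq> sorted_words m" using nf_spec assms by blast
  have "\<exists>a\<in>?S. \<forall>b\<in>?S. b = a \<or> lt b a"
    by (rule finite_max) (use assms k in \<open>auto simp: exp_of_monomials sorted_words_def\<close>)
  then obtain w where w: "w \<in> keys (nf f)" "\<forall>v\<in>keys (nf f). exp_of v = exp_of w \<or> lt (exp_of v) (exp_of w)"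
    by blast
  have s: "std_word (exp_of v) = v" if "v \<in> keys (nf f)" for v
    using that k by (auto simp: sorted_words_def std_word_exp_of)
  have "lm f (exp_of w)"
    unfolding lm_iff[OF assms(1)]
  proof (intro conjI ballI)
    show "std_word (exp_of w) \<in> keys (nf f)" using w s by simp
    fix v assume v: "v \<in> keys (nf f)"
    then have "exp_of v = exp_of w \<or> lt (exp_of v) (exp_of w)" using w by blast
    then show "v = std_word (exp_of w) \<or> lt (exp_of v) (exp_of w)"
    proof
      assume "exp_of v = exp_of w"
      then have "std_word (exp_of w) = v" using s[OF v] by simp
      then show ?thesis by simp
    qed simp
  qed
  then show ?thesis ..
qed

lemma lm_nonzero: "f \<in> fa m \<Longrightarrow> lm f a \<Longrightarrow> nf f \<noteq> 0"
  by (auto simp: lm_iff)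

lemma lm_monomials: "lm f a \<Longrightarrow> a \<in> monomials m"
  by (simp add: lm_def)

lemma lm_word: "w \<in> words m \<Longrightarrow> lm (wmon w) (exp_of w)"
proof -
  assume w: "w \<in> words m"
  then obtain k g where *: "k \<noteq> 0" "g \<in> Low (exp_of w)"
      "wmon w - (single (std_word (exp_of w)) k + g) \<in> I"
    using word_nf by blast
  have "keys (single (std_word (exp_of w)) k + g) \<subseteq> sorted_words m"
    using *(2) w by (intro subset_trans[OF keys_add]) (auto simp: Low_def exp_of_monomials)
  then have "nf (wmon w) = single (std_word (exp_of w)) k + g"
    using *(3) by (rule nf_eqI)
  then show ?thesis using * w by (auto simp: lm_def exp_of_monomials)
qed

text \<open>The product of the two leading words need not be sorted, but by \<open>lm_word\<close>
  sorting it keeps the exponent and a nonzero coefficient. All other products have smaller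
  exponents, and \<open>nf_low\<close> keeps them smaller.\<close>

lemma lm_mult:
  assumes "f \<in> fa m" "g \<in> fa m" "lm f a" "lm g b"
  shows "lm (f * g) (a + b)"
proof -
  obtain k f' where f: "k \<noteq> 0" "f' \<in> Low a" "nf f = single (std_word a) k + f'"
    using assms(3) by (auto simp: lm_def)
  obtain l g' where g: "l \<noteq> 0" "g' \<in> Low b" "nf g = single (std_word b) l + g'"
    using assms(4) by (auto simp: lm_def)
  have a: "a \<in> monomials m" "b \<in> monomials m" using assms(3,4) by (auto simp: lm_def)
  let ?w = "std_word a + std_word b"
  have w: "?w \<in> words m" "exp_of ?w = a + b" using a by auto
  \<comment> \<open>All products except that of the two leading terms: \<open>?h1\<close> involves
    the lower part of \<open>g\<close>, \<open>?h2\<close> the lower part of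
    \<open>f\<close>.\<close>
  let ?h1 = "single (std_word a) k * g'" and ?h2 = "f' * nf g"
  let ?h = "?h1 + ?h2"
  have 1: "w \<in> words m \<and> lt (exp_of w) (a + b)" if h1: "w \<in> keys ?h1" for w
  proof -
    obtain u where "w = std_word a + u" "u \<in> keys g'"
      using keys_times[OF h1] by (auto split: if_splits)
    then show ?thesis
      using g(2) a lt_add'[of "exp_of u" b a] by (auto simp: Low_def sorted_words_def)
  qed
  have 2: "w \<in> words m \<and> lt (exp_of w) (a + b)" if h2: "w \<in> keys ?h2" for w
  proof -
    obtain u v where uv: "w = u + v" "u \<in> keys f'" "v \<in> keys (nf g)"
      using keys_times[OF h2] by blast
    have u: "u \<in> words m" "lt (exp_of u) a" using f(2) uv by (auto simp: Low_def sorted_words_def)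
    have "v \<in> words m" using uv nf_spec assms(2) sorted_words_subset by blast
    moreover have "exp_of v = b \<or> lt (exp_of v) b"
      using uv(3) assms(4) unfolding lm_iff[OF assms(2)] by auto
    moreover have "lt (exp_of u + exp_of v) (a + exp_of v)"
      using u \<open>v \<in> words m\<close> by (intro lt_add) (auto simp: exp_of_monomials)
    ultimately show ?thesis
      using uv(1) u lt_add'[of "exp_of v" b a] a lt_trans[of "exp_of u + exp_of v" "a + exp_of v" "a + b"] by auto
  qed
  have h: "w \<in> words m \<and> lt (exp_of w) (a + b)" if "w \<in> keys ?h" for w
    using subsetD[OF keys_add that] 1 2 by blast
  then have "nf ?h \<in> Low (a + b)" by (rule nf_low)
  have hfa: "?h \<in> fa m" using h by (auto simp: fa_def)
  have "nf (f * g) = nf (nf f * nf g)"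
    using assms by (intro nf_mult_cong) (auto simp: nf_fa)
  also have "nf f * nf g = scal (k * l) * wmon ?w + ?h"
  proof -
    have "nf f * nf g = single (std_word a) k * single (std_word b) l + ?h"
      unfolding f(3) distrib_right unfolding g(3) distrib_left by (simp only: add.assoc)
    then show ?thesis by (simp add: mult_single scal_wmon)
  qed
  also have "nf \<dots> = scal (k * l) * nf (wmon ?w) + nf ?h"
    using w hfa by (simp add: nf_add nf_scal)
  finally have eq: "nf (f * g) = scal (k * l) * nf (wmon ?w) + nf ?h" .
  obtain k' h' where k': "k' \<noteq> 0" "h' \<in> Low (a + b)"
      "nf (wmon ?w) = single (std_word (a + b)) k' + h'"
    using lm_word[OF w(1)] unfolding w(2) lm_def by blast
  have "nf (f * g) = single (std_word (a + b)) (k * l * k') + (scal (k * l) * h' + nf ?h)"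
    unfolding eq k'(3) by (simp add: distrib_left scal_def mult_single add.assoc)
  moreover have "scal (k * l) * h' + nf ?h \<in> Low (a + b)"
    using k' \<open>nf ?h \<in> Low (a + b)\<close> by (intro Low_add Low_scal)
  ultimately show ?thesis
    using a f g k' unfolding lm_def monomials_add by (metis mult_eq_0_iff)
qed

text \<open>Leading monomials add, so a product of nonzero classes again has one: the algebra is a
  domain.\<close>

lemma nf_mult_nonzero:
  assumes "f \<in> fa m" "g \<in> fa m" "nf f \<noteq> 0" "nf g \<noteq> 0"
  shows "nf (f * g) \<noteq> 0"
  using assms lm_exists lm_mult lm_nonzero by (metis fa_mult)

lemma nf_1 [simp]: "nf 1 = 1"
  by (rule nf_sorted) (auto simp: sorted_words_def)

end

section \<open>The Ore condition\<close>

lemma nat_seq_mono_subseq: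
  fixes t :: "nat \<Rightarrow> nat"
  obtains h :: "nat \<Rightarrow> nat" where "strict_mono h" "mono (t \<circ> h)"
proof -
  \<comment> \<open>A position whose value is minimal among all later ones exists beyond every
    \<open>N\<close>; the subsequence runs through such positions.\<close>
  have min: "\<exists>x\<ge>N. \<forall>k\<ge>x. t x \<le> t k" for N
    using ex_has_least_nat[of "\<lambda>x. N \<le> x" N t] by (meson order_refl order_trans)
  have "\<exists>h. \<forall>n. (\<forall>k\<ge>h n. t (h n) \<le> t k) \<and> h n < (h (Suc n) :: nat)"
  proof (rule dependent_nat_choice)
    show "\<exists>x. \<forall>k\<ge>x. t x \<le> t k" using min by blast
    show "\<exists>y. (\<forall>k\<ge>y. t y \<le> t k) \<and> x < y" for x :: nat
      using min[of "Suc x"] by auto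
  qed
  then obtain h :: "nat \<Rightarrow> nat" where h: "\<And>n k. h n \<le> k \<Longrightarrow> t (h n) \<le> t k" "\<And>n. h n < h (Suc n)"
    by blast
  have sm: "strict_mono h" using h(2) by (simp add: strict_mono_Suc_iff)
  then have "mono (t \<circ> h)" using h(1) by (auto simp: mono_def strict_mono_less_eq)
  then show ?thesis using that sm by blast
qed

text \<open>Coordinates are treated one at a time, since passing to a further subsequence keeps the
  earlier coordinates monotone.\<close>

lemma dickson_subseq:
  fixes s :: "nat \<Rightarrow> 'a \<Rightarrow> nat"
  assumes "finite X"
  shows "\<exists>h :: nat \<Rightarrow> nat. strict_mono h \<and> (\<forall>x\<in>X. mono (\<lambda>k. s (h k) x))"
  using assms
proof (induction X rule: finite_induct)
  case empty
  then show ?case by (intro exI[of _ id]) (auto simp: strict_mono_def)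
next
  case (insert x X)
  then obtain h :: "nat \<Rightarrow> nat" where h: "strict_mono h" "\<And>y. y \<in> X \<Longrightarrow> mono (\<lambda>k. s (h k) y)" by blast
  obtain g :: "nat \<Rightarrow> nat" where g: "strict_mono g" "mono ((\<lambda>k. s (h k) x) \<circ> g)"
    using nat_seq_mono_subseq .
  have "mono (\<lambda>k. s (h (g k)) y)" if "y \<in> X" for y
    using h(2)[OF that] g(1) by (simp add: mono_def strict_mono_less_eq)
  then show ?case
    using h(1) g by (intro exI[of _ "h \<circ> g"]) (auto simp: comp_def strict_mono_def)
qed

lemma dickson:
  fixes s :: "nat \<Rightarrow> monomial"
  assumes "\<And>k. s k \<in> monomials m"
  shows "\<exists>i j. i < j \<and> (\<exists>e\<in>monomials m. s j = s i + e)"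
proof -
  obtain h :: "nat \<Rightarrow> nat" where h: "strict_mono h"
      "\<And>x. x \<in> {1..m} \<Longrightarrow> mono (\<lambda>k. lookup (s (h k)) x)"
    using dickson_subseq[of "{1..m}" "\<lambda>k. lookup (s k)"] by fast
  have out: "lookup (s k) x = 0" if "x \<notin> {1..m}" for x k
    using assms[of k] that by (auto simp: monomials_def in_keys_iff)
  have le: "lookup (s (h 0)) x \<le> lookup (s (h 1)) x" for x
    using h(2)[of x] out[of x] by (cases "x \<in> {1..m}") (auto simp: mono_def)
  have "s (h 1) = s (h 0) + (s (h 1) - s (h 0))"
    using le by (intro poly_mapping_eqI) (simp add: lookup_add lookup_minus)
  moreover from this have "s (h 1) - s (h 0) \<in> monomials m"
    using assms[of "h 1"] by (metis monomials_add)
  ultimately show ?thesis using strict_monoD[OF h(1), of 0 1] by auto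
qed

section \<open>A stationary chain of right ideals and the right Ore condition\<close>

context galg_pbw
begin

lemma lm_cancel:
  assumes "f \<in> fa m" "g \<in> fa m" "lm f a" "lm g a"
  shows "\<exists>k. nf (f - scal k * g) \<in> Low a"
proof -
  obtain k f' where f: "k \<noteq> 0" "f' \<in> Low a" "nf f = single (std_word a) k + f'"
    using assms(3) by (auto simp: lm_def)
  obtain l g' where g: "l \<noteq> 0" "g' \<in> Low a" "nf g = single (std_word a) l + g'"
    using assms(4) by (auto simp: lm_def)
  \<comment> \<open>\<open>k / l\<close> is the quotient of the two leading coefficients.\<close>
  have "nf (f - scal (k / l) * g) = nf f - scal (k / l) * nf g"
    using assms by (simp add: nf_diff nf_scal)
  also have "\<dots> = f' + scal (- (k / l)) * g'"
    using g(1) by (simp add: f g distrib_left scal_def mult_single single_uminus)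
  finally have "nf (f - scal (k / l) * g) = f' + scal (- (k / l)) * g'" .
  then show ?thesis using f g by (metis Low_add Low_scal)
qed

text \<open>The right ideals \<open>a A + b a A + \<dots> + b ^ (i - 1) a A\<close>, read modulo \<^term>\<open>I\<close>.\<close>

primrec chain :: "'k ncpoly \<Rightarrow> 'k ncpoly \<Rightarrow> nat \<Rightarrow> 'k ncpoly set" where
  "chain a b 0 = I"
| "chain a b (Suc i) = {h \<in> fa m. \<exists>p\<in>fa m. \<exists>q\<in>chain a b i. h - (a * p + b * q) \<in> I}"

context
  fixes a b :: "'k ncpoly"
  assumes ab: "a \<in> fa m" "b \<in> fa m"
begin

lemma chain_fa: "h \<in> chain a b i \<Longrightarrow> h \<in> fa m"
  by (cases i) (auto simp: J_fa)

lemma I_chain: "h \<in> I \<Longrightarrow> h \<in> chain a b i"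
proof (induction i arbitrary: h)
  case (Suc i)
  then show ?case by (auto simp: J_fa J.zero intro!: bexI[of _ 0])
qed simp

lemma chain_mono: "i \<le> j \<Longrightarrow> chain a b i \<subseteq> chain a b j"
proof -
  have "chain a b i \<subseteq> chain a b (Suc i)" for i
    by (induction i) (use I_chain in fastforce)+
  then show "i \<le> j \<Longrightarrow> chain a b i \<subseteq> chain a b j" by (rule lift_Suc_mono_le)
qed

lemma chain_add: "h \<in> chain a b i \<Longrightarrow> h' \<in> chain a b i \<Longrightarrow> h + h' \<in> chain a b i"
proof (induction i arbitrary: h h')
  case (Suc i)
  then obtain p q p' q' where pq: "p \<in> fa m" "q \<in> chain a b i" "h - (a * p + b * q) \<in> I"
    "p' \<in> fa m" "q' \<in> chain a b i" "h' - (a * p' + b * q') \<in> I" "h \<in> fa m" "h' \<in> fa m"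
    by auto
  have "h + h' - (a * (p + p') + b * (q + q')) \<in> I"
    using J_add[OF pq(3) pq(6)] by (simp add: algebra_simps)
  moreover have "q + q' \<in> chain a b i" using Suc.IH pq by blast
  ultimately show ?case using pq unfolding chain.simps
    by (intro CollectI conjI bexI[of _ "p + p'"] bexI[of _ "q + q'"]) auto
qed (simp add: J_add)

lemma chain_mult: "h \<in> chain a b i \<Longrightarrow> g \<in> fa m \<Longrightarrow> h * g \<in> chain a b i"
proof (induction i arbitrary: h)
  case (Suc i)
  then obtain p q where pq: "p \<in> fa m" "q \<in> chain a b i" "h - (a * p + b * q) \<in> I" "h \<in> fa m"
    by auto
  have "h * g - (a * (p * g) + b * (q * g)) \<in> I"
    using I_mult_right[OF pq(3) Suc.prems(2)] by (simp add: algebra_simps)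
  moreover have "q * g \<in> chain a b i" using Suc pq by blast
  ultimately show ?case using pq Suc.prems unfolding chain.simps
    by (intro CollectI conjI bexI[of _ "p * g"] bexI[of _ "q * g"]) auto
qed (simp add: I_mult_right)

lemma chain_diff_scal:
  assumes "h \<in> chain a b i" "h' \<in> chain a b i"
  shows "h - scal k * h' \<in> chain a b i"
proof -
  have "h' * scal (- k) \<in> chain a b i" using assms(2) by (intro chain_mult) auto
  then have "h + h' * scal (- k) \<in> chain a b i" by (intro chain_add assms)
  then show ?thesis by (simp add: scal_comm scal_minus)
qed

text \<open>Otherwise pick, at every level, an element new at that level with minimal leading
  monomial. Dickson's lemma makes one of these monomials divide a later one, and the later element
  can then be reduced by the earlier one, against minimality.\<close>

lemma chain_stationary: "\<exists>i. chain a b (Suc i) \<subseteq> chain a b i"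
proof (rule ccontr)
  assume "\<not> ?thesis"
  then have ne: "\<exists>h. h \<in> chain a b (Suc i) - chain a b i" for i by blast
  define L where "L i = {e. \<exists>h. h \<in> chain a b (Suc i) - chain a b i \<and> lm h e}" for i
  have nz: "nf h \<noteq> 0" if h: "h \<in> chain a b (Suc i) - chain a b i" for h i
  proof
    assume "nf h = 0"
    then have "h \<in> I" using nf_cong_iff[of h 0] chain_fa h by simp
    then show False using I_chain h by blast
  qed
  have "\<exists>e\<in>L i. \<forall>e'. lt e' e \<longrightarrow> e' \<notin> L i" for i
  proof -
    obtain h where h: "h \<in> chain a b (Suc i) - chain a b i" using ne by blast
    then obtain e where "lm h e" using lm_exists[of h] nz[OF h] chain_fa by blast
    then have "e \<in> L i" using h by (auto simp: L_def)
    then show ?thesis using wfp_lt by (metis wfp_iff_ex_minimal empty_iff)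
  qed
  then obtain s where s: "\<And>i. s i \<in> L i" "\<And>i e. lt e (s i) \<Longrightarrow> e \<notin> L i" by metis
  have "\<And>i. s i \<in> monomials m" using s(1) lm_monomials by (auto simp: L_def)
  then obtain i j e where ij: "i < j" "e \<in> monomials m" "s j = s i + e" using dickson by blast
  obtain f where f: "f \<in> chain a b (Suc i)" "lm f (s i)" using s(1)[of i] by (auto simp: L_def)
  obtain g where g: "g \<in> chain a b (Suc j)" "g \<notin> chain a b j" "lm g (s j)"
    using s(1)[of j] by (auto simp: L_def)
  \<comment> \<open>This multiple of \<open>f\<close> has the leading monomial of \<open>g\<close>
    but lies in the smaller ideal, so subtracting it leaves \<open>g\<close> outside
    \<open>chain a b j\<close> and lowers its leading monomial.\<close>
  let ?h = "f * wmon (std_word e)"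
  have "?h \<in> chain a b (Suc i)" using f ij(2) by (intro chain_mult) auto
  then have h: "?h \<in> chain a b j" using chain_mono[of "Suc i" j] ij(1) by auto
  have "lm ?h (s i + exp_of (std_word e))"
    by (intro lm_mult lm_word f) (use chain_fa[OF f(1)] ij(2) in auto)
  then have "lm ?h (s j)" using ij(3) by simp
  then obtain k where k: "nf (g - scal k * ?h) \<in> Low (s j)"
    using lm_cancel chain_fa g h by blast
  have "g - scal k * ?h \<notin> chain a b j"
    using chain_diff_scal[of "g - scal k * ?h" j ?h "- k"] g(2) h by (auto simp: scal_minus)
  moreover have "g - scal k * ?h \<in> chain a b (Suc j)"
    by (intro chain_diff_scal g(1) subsetD[OF chain_mono h]) simp
  ultimately have *: "g - scal k * ?h \<in> chain a b (Suc j) - chain a b j" by blast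
  then obtain e' where e': "lm (g - scal k * ?h) e'" using lm_exists nz chain_fa by blast
  then have "lt e' (s j)"
    using k chain_fa * lm_iff[of "g - scal k * ?h" e'] by (auto simp: Low_def)
  moreover have "e' \<in> L j" using * e' by (auto simp: L_def)
  ultimately show False using s(2) by blast
qed

text \<open>If \<open>a A\<close> and \<open>b A\<close> met only in zero, the sum of the right
  ideals \<open>b ^ i a A\<close> would be direct and the chain strictly increasing.\<close>

lemma right_ore:
  assumes "nf a \<noteq> 0" "nf b \<noteq> 0"
  shows "\<exists>p\<in>fa m. \<exists>q\<in>fa m. nf (a * p) = nf (b * q) \<and> nf (a * p) \<noteq> 0"
proof (rule ccontr)
  assume "\<not> ?thesis"
  then have no: "nf (a * p) = 0" if "p \<in> fa m" "q \<in> fa m" "nf (a * p) = nf (b * q)" for p q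
    using that by blast
  have in_chain: "b ^ i * a \<in> chain a b (Suc i)" for i
  proof (induction i)
    case 0
    show ?case using ab unfolding chain.simps
      by (intro CollectI conjI bexI[of _ 1] bexI[of _ 0]) (simp_all add: J.zero)
  next
    case (Suc i)
    have "b ^ Suc i * a - (a * 0 + b * (b ^ i * a)) \<in> I" by (simp add: J.zero mult.assoc)
    then show ?case
      using Suc ab unfolding chain.simps(2)[of a b "Suc i"]
      by (intro CollectI conjI bexI[of _ 0] bexI[of _ "b ^ i * a"]) simp_all
  qed
  have "b ^ i * a \<notin> chain a b i" for i
  proof (induction i)
    case 0
    show ?case using assms(1) ab nf_cong_iff[of a 0] by auto
  next
    case (Suc i)
    show ?case
    proof
      assume "b ^ Suc i * a \<in> chain a b (Suc i)"
      then obtain p q where pq: "p \<in> fa m" "q \<in> chain a b i" "b ^ Suc i * a - (a * p + b * q) \<in> I"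
        by auto
      have q: "q \<in> fa m" using chain_fa pq(2) .
      \<comment> \<open>The element lies in both \<open>a A\<close> and \<open>b A\<close>, hence is
        zero; cancelling \<open>b\<close> would put \<open>b ^ i * a\<close> into the previous
        ideal.\<close>
      have "a * p - b * (b ^ i * a - q) \<in> I"
        using J_uminus[OF pq(3)] by (simp add: algebra_simps)
      then have eq: "nf (a * p) = nf (b * (b ^ i * a - q))"
        using ab q pq(1) by (simp add: nf_cong_iff)
      then have "nf (b * (b ^ i * a - q)) = 0" using no[OF pq(1) _ eq] ab q by simp
      then have "nf (b ^ i * a - q) = 0"
        using nf_mult_nonzero[of b "b ^ i * a - q"] ab q assms(2) by auto
      then have "b ^ i * a - q \<in> I" using nf_cong_iff[of "b ^ i * a - q" 0] ab q by simp
      then have "q + (b ^ i * a - q) \<in> chain a b i" using pq(2) I_chain chain_add by blast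
      then show False using Suc by simp
    qed
  qed
  then show False using chain_stationary in_chain by blast
qed

end

end

section \<open>The largest variable\<close>

definition var_count :: "nat \<Rightarrow> nat free_monoid \<Rightarrow> nat" where
  "var_count x w = count_list (letters w) x"

definition drop_var :: "nat \<Rightarrow> nat free_monoid \<Rightarrow> nat free_monoid" where
  "drop_var x w = Word (filter (\<lambda>y. y \<noteq> x) (letters w))"

text \<open>For sorted words with largest letter \<open>x\<close>, this is the left coefficient of
  \<open>x ^ i\<close>: all occurrences of \<open>x\<close> stand at the end and are
  deleted.\<close>

definition part :: "nat \<Rightarrow> nat \<Rightarrow> 'k::field ncpoly \<Rightarrow> 'k ncpoly" where
  "part x i g = (\<Sum>w\<in>keys g.
     if var_count x w = i then single (drop_var x w) (lookup g w) else 0)"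

lemma part_superset:
  assumes "finite S" "keys g \<subseteq> S"
  shows "part x i g = (\<Sum>w\<in>S.
     if var_count x w = i then single (drop_var x w) (lookup g w) else 0)"
  unfolding part_def
  by (rule sum.mono_neutral_left) (use assms in \<open>auto simp: in_keys_iff\<close>)

lemma part_add: "part x i (f + g) = part x i f + part x i g"
proof -
  let ?S = "keys f \<union> keys g"
  have S: "finite ?S" "keys f \<subseteq> ?S" "keys g \<subseteq> ?S" "keys (f + g) \<subseteq> ?S"
    using keys_add[of f g] by auto
  show ?thesis
    unfolding part_superset[OF S(1,2)] part_superset[OF S(1,3)] part_superset[OF S(1,4)]
      sum.distrib[symmetric]
    by (rule sum.cong) (auto simp: lookup_add single_add)
qed

lemma part_single: "part x i (single w k)
    = (if var_count x w = i then single (drop_var x w) k else 0)"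
  by (simp add: part_def)

lemma part_0 [simp]: "part x i 0 = 0"
  by (simp add: part_def)

lemma words_Suc_mono: "w \<in> words n \<Longrightarrow> w \<in> words (Suc n)"
  by (force simp: words_def)

lemma fa_Suc_mono [simp]: "f \<in> fa n \<Longrightarrow> f \<in> fa (Suc n)"
  by (auto simp: fa_def words_Suc_mono)

lemma sorted_words_Suc_mono: "w \<in> sorted_words n \<Longrightarrow> w \<in> sorted_words (Suc n)"
  by (simp add: sorted_words_def words_Suc_mono)

lemma var_power: "var x ^ i = wmon (Word (replicate i x))"
proof (induction i)
  case 0
  then show ?case by (simp flip: zero_free_monoid_def)
qed (simp add: var_def mult_single plus_free_monoid_def)

lemma count_list_replicate: "count_list (replicate k x) y = (if x = y then k else 0)"
  by (induction k) auto

lemma sorted_Suc_split: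
  assumes "sorted xs" "set xs \<subseteq> {1..Suc n}"
  shows "xs = filter (\<lambda>y. y \<noteq> Suc n) xs @ replicate (count_list xs (Suc n)) (Suc n)"
  using assms
proof (induction xs)
  case (Cons x xs)
  show ?case
  proof (cases "x = Suc n")
    case True
    then have "set xs \<subseteq> {Suc n}" using Cons.prems by force
    then have "xs = replicate (length xs) (Suc n)" by (induction xs) auto
    then obtain k where "xs = replicate k (Suc n)" by blast
    then show ?thesis using True by (simp add: filter_replicate count_list_replicate)
  next
    case False
    then show ?thesis using Cons by simp
  qed
qed simp

lemma sorted_words_split:
  assumes "w \<in> sorted_words (Suc n)"
  shows "w = drop_var (Suc n) w + Word (replicate (var_count (Suc n) w) (Suc n))"
    and "drop_var (Suc n) w \<in> sorted_words n"
proof -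
  show "w = drop_var (Suc n) w + Word (replicate (var_count (Suc n) w) (Suc n))"
    using sorted_Suc_split[of "letters w" n] assms
    by (cases w) (simp add: drop_var_def var_count_def plus_free_monoid_def sorted_words_def words_def)
  show "drop_var (Suc n) w \<in> sorted_words n"
    using assms by (force simp: sorted_words_def words_def drop_var_def sorted_wrt_filter)
qed

lemma words_no_var:
  assumes "w \<in> words n"
  shows "filter (\<lambda>y. y \<noteq> Suc n) (letters w) = letters w" "count_list (letters w) (Suc n) = 0"
  using assms by (auto simp: words_def count_list_0_iff intro!: filter_True)

lemma drop_var_plus:
  assumes "w \<in> words n"
  shows "drop_var (Suc n) (w + Word (replicate i (Suc n))) = w"
    and "var_count (Suc n) (w + Word (replicate i (Suc n))) = i"
proof -
  show "drop_var (Suc n) (w + Word (replicate i (Suc n))) = w"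
    "var_count (Suc n) (w + Word (replicate i (Suc n))) = i"
    using words_no_var[OF assms] by (auto simp: drop_var_def var_count_def count_list_replicate)
qed

lemma part_mono:
  assumes "b \<in> fa n"
  shows "part (Suc n) i (b * var (Suc n) ^ j) = (if i = j then b else 0)"
proof -
  have "keys b \<subseteq> words n" using assms by (simp add: fa_def)
  then show ?thesis
    by (induction b rule: poly_induct)
      (auto simp: var_power mult_single part_single drop_var_plus part_add distrib_right)
qed

locale galg_ext = A: galg_pbw "Suc n" c d r + B: galg_pbw n c d r'
  for n :: nat and c :: "nat \<Rightarrow> nat \<Rightarrow> 'k::field" and d :: "nat \<Rightarrow> nat \<Rightarrow> 'k cpoly"
    and r r' :: "monomial rel" +
  assumes dominant: "k \<in> {1..n} \<Longrightarrow> A.lt (var_exp k) (var_exp (Suc n))"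
begin

section \<open>Expansion in powers of the largest variable\<close>

abbreviation D :: "'k ncpoly" where
  "D \<equiv> var (Suc n)"

abbreviation coef :: "nat \<Rightarrow> 'k ncpoly \<Rightarrow> 'k ncpoly" where
  "coef i f \<equiv> part (Suc n) i (A.nf f)"

lemma D_fa [simp]: "D \<in> fa (Suc n)"
  by simp

lemma I_subset: "f \<in> B.I \<Longrightarrow> f \<in> A.I"
  by (induction f rule: B.J.induct) (auto intro: A.J.intros simp: words_Suc_mono simp del: words_plus
    simp flip: words_plus)

text \<open>Sorted words of B are sorted words of A and the relations of B are among those of A, so
  a normal form in B is one in A. In particular B embeds into A.\<close>

lemma nf_eq: "b \<in> fa n \<Longrightarrow> A.nf b = B.nf b"
  using B.nf_spec[of b] I_subset sorted_words_Suc_mono by (intro A.nf_eqI) auto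

lemma nf_mono:
  assumes "b \<in> fa n"
  shows "A.nf (b * D ^ i) = B.nf b * D ^ i"
proof (rule A.nf_eqI)
  have k: "keys (B.nf b) \<subseteq> sorted_words n" using B.nf_spec assms by blast
  show "keys (B.nf b * D ^ i) \<subseteq> sorted_words (Suc n)"
  proof
    fix w assume "w \<in> keys (B.nf b * D ^ i)"
    then obtain u where "w = u + Word (replicate i (Suc n))" "u \<in> keys (B.nf b)"
      by (auto simp: var_power dest!: keys_times split: if_splits)
    then show "w \<in> sorted_words (Suc n)"
      using k by (force simp: sorted_words_def words_def sorted_append)
  qed
  have "(b - B.nf b) * D ^ i \<in> A.I"
    using B.nf_spec[OF assms] I_subset by (intro A.I_mult_right) auto
  then show "b * D ^ i - B.nf b * D ^ i \<in> A.I" by (simp add: left_diff_distrib)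
qed

lemma coef_mono: "b \<in> fa n \<Longrightarrow> coef i (b * D ^ j) = (if i = j then B.nf b else 0)"
  by (simp add: nf_mono part_mono B.nf_fa)

lemma coef_add: "f \<in> fa (Suc n) \<Longrightarrow> g \<in> fa (Suc n) \<Longrightarrow> coef i (f + g) = coef i f + coef i g"
  by (simp add: A.nf_add part_add)

text \<open>By the basis of sorted words, every class of A is a sum of classes
  \<open>b * D ^ i\<close> with \<open>b\<close> in B.\<close>

lemma ext_induct [consumes 1, case_names cong add mono]:
  assumes f: "f \<in> fa (Suc n)"
    and cong: "\<And>f g. f \<in> fa (Suc n) \<Longrightarrow> g \<in> fa (Suc n) \<Longrightarrow> A.nf f = A.nf g \<Longrightarrow> P f \<Longrightarrow> P g"
    and add: "\<And>f g. f \<in> fa (Suc n) \<Longrightarrow> g \<in> fa (Suc n) \<Longrightarrow> P f \<Longrightarrow> P g \<Longrightarrow> P (f + g)"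
    and mono: "\<And>b i. b \<in> fa n \<Longrightarrow> P (b * D ^ i)"
  shows "P f"
proof -
  have *: "g \<in> fa (Suc n) \<and> P g" if "keys g \<subseteq> sorted_words (Suc n)" for g
    using that
  proof (induction g rule: poly_induct)
    case zero
    then show ?case using mono[of 0 0] by simp
  next
    case (single w k)
    have "single w k = single (drop_var (Suc n) w) k * D ^ var_count (Suc n) w"
      using sorted_words_split(1)[OF single] by (simp add: var_power mult_single)
    moreover have fa: "single (drop_var (Suc n) w) k \<in> fa n"
      using sorted_words_split(2)[OF single] by (simp add: sorted_words_def)
    moreover have "single (drop_var (Suc n) w) k * D ^ var_count (Suc n) w \<in> fa (Suc n)"
      by (intro fa_mult fa_power fa_Suc_mono[OF fa] D_fa)
    ultimately show ?case
      using mono[of "single (drop_var (Suc n) w) k" "var_count (Suc n) w"] by simp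
  qed (simp add: add)
  have "keys (A.nf f) \<subseteq> sorted_words (Suc n)" using A.nf_spec f by blast
  from *[OF this] show ?thesis using cong[of "A.nf f" f] f by simp
qed

lemma coef_fa:
  assumes "f \<in> fa (Suc n)"
  shows "coef i f \<in> fa n \<and> B.nf (coef i f) = coef i f"
  using assms
proof (induction f rule: ext_induct)
  case (cong f g)
  then show ?case by simp
next
  case (add f g)
  then show ?case by (simp add: coef_add B.nf_add)
next
  case (mono b j)
  then show ?case by (simp add: coef_mono B.nf_fa)
qed

lemma coef_bounded:
  assumes "f \<in> fa (Suc n)"
  shows "\<exists>N. \<forall>i>N. coef i f = 0"
  using assms
proof (induction f rule: ext_induct)
  case (cong f g)
  then show ?case by simp
next
  case (add f g)
  then obtain N N' where "\<forall>i>N. coef i f = 0" "\<forall>i>N'. coef i g = 0" by blast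
  then show ?case using add by (intro exI[of _ "max N N'"]) (simp add: coef_add)
next
  case (mono b j)
  then show ?case by (intro exI[of _ j]) (simp add: coef_mono)
qed

text \<open>A sorted word is recovered from its number of letters \<open>Suc n\<close> and from what
  is left after deleting them, so distinct words cannot cancel inside one coefficient.\<close>

lemma coef_zero:
  assumes "f \<in> fa (Suc n)" "\<And>i. coef i f = 0"
  shows "A.nf f = 0"
proof (rule ccontr)
  assume "A.nf f \<noteq> 0"
  then obtain w where w: "w \<in> keys (A.nf f)" by (metis all_not_in_conv keys_eq_empty)
  have k: "keys (A.nf f) \<subseteq> sorted_words (Suc n)" using A.nf_spec assms by blast
  let ?x = "Suc n"
  have "lookup (coef (var_count ?x w) f) (drop_var ?x w)
    = (\<Sum>v\<in>keys (A.nf f). if v = w then lookup (A.nf f) w else 0)"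
    unfolding part_def lookup_sum
  proof (rule sum.cong)
    fix v assume v: "v \<in> keys (A.nf f)"
    have sp: "v = drop_var ?x v + Word (replicate (var_count ?x v) ?x)"
      "w = drop_var ?x w + Word (replicate (var_count ?x w) ?x)"
      using sorted_words_split(1) v w k by blast+
    have "v = w" if "var_count ?x v = var_count ?x w" "drop_var ?x v = drop_var ?x w"
      using sp that by metis
    then show "lookup (if var_count ?x v = var_count ?x w
          then single (drop_var ?x v) (lookup (A.nf f) v) else 0) (drop_var ?x w)
        = (if v = w then lookup (A.nf f) w else 0)"
      by (auto simp: lookup_single when_def)
  qed simp
  also have "\<dots> = lookup (A.nf f) w" using w by simp
  finally show False using w assms(2) by (simp add: in_keys_iff)
qed

text \<open>A monomial divisible by \<open>D ^ 2\<close> is at least \<open>D ^ 2\<close>, which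
  exceeds \<open>x\<^sub>k D\<close> because \<open>x\<^sub>k\<close> is smaller than
  \<open>D\<close>; but the monomials of \<open>d k (Suc n)\<close> lie below
  \<open>x\<^sub>k D\<close>.\<close>

lemma keys_d_degree:
  assumes k: "k \<in> {1..n}" and a: "a \<in> keys (d k (Suc n))"
  shows "lookup a (Suc n) \<le> 1"
proof (rule ccontr)
  assume "\<not> ?thesis"
  then have ge: "lookup a (Suc n) \<ge> 2" by simp
  let ?e = "var_exp (Suc n)" and ?ek = "var_exp k"
  have lt: "A.lt a (?ek + ?e)" using A.keys_d[of k "Suc n" a] k a by simp
  then have am: "a \<in> monomials (Suc n)" using A.lt_monomials by blast
  \<comment> \<open>\<open>a\<close> divided by \<open>D ^ 2\<close>; the truncated subtraction of
    exponents is exact by \<open>ge\<close>.\<close>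
  let ?a0 = "a - (?e + ?e)"
  have a0: "a = ?a0 + (?e + ?e)"
    using ge by (intro poly_mapping_eqI) (auto simp: lookup_add lookup_minus var_exp_def lookup_single when_def)
  then have a0m: "?a0 \<in> monomials (Suc n)" using am by (metis monomials_add)
  have em: "?e \<in> monomials (Suc n)" by simp
  have 1: "A.lt (?ek + ?e) (?e + ?e)" using A.lt_add dominant k em by blast
  have "A.lt (?ek + ?e) a"
  proof (cases "?a0 = 0")
    case True
    then show ?thesis using 1 a0 by simp
  next
    case False
    then have "A.lt (0 + (?e + ?e)) (?a0 + (?e + ?e))"
      using A.zero_le[OF a0m] em by (intro A.lt_add) (auto simp: monomials_add)
    then show ?thesis using 1 A.lt_trans a0 by (metis add_0)
  qed
  then show False using lt A.lt_trans A.lt_irrefl by blast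
qed

text \<open>\<open>D\<close> is moved to the right past one letter at a time. Each relation is of
  degree at most one in \<open>D\<close>, so the degree does not grow.\<close>

lemma D_comm_exists:
  assumes "b \<in> fa n"
  shows "\<exists>b1\<in>fa n. \<exists>b0\<in>fa n. A.nf (D * b) = A.nf (b1 * D + b0)"
proof -
  have lin: "\<exists>e\<in>fa n. \<exists>f\<in>fa n. g = e * D + f"
    if "keys g \<subseteq> {w \<in> sorted_words (Suc n). var_count (Suc n) w \<le> 1}" for g
    using that
  proof (induction g rule: poly_induct)
    case zero
    show ?case by (intro bexI[of _ 0]) auto
  next
    case (single w k)
    let ?s = "single (drop_var (Suc n) w) k"
    have s: "?s \<in> fa n" using sorted_words_split(2) single by (auto simp: sorted_words_def)
    have *: "single w k = ?s * D ^ var_count (Suc n) w"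
      using sorted_words_split(1)[of w n] single by (simp add: var_power mult_single)
    have "var_count (Suc n) w = 0 \<or> var_count (Suc n) w = 1" using single by auto
    then show ?case
    proof
      assume "var_count (Suc n) w = 0"
      then have "single w k = 0 * D + ?s" using * by simp
      then show ?thesis using s by (intro bexI[of _ 0] bexI[of _ ?s]) simp_all
    next
      assume "var_count (Suc n) w = 1"
      then have "single w k = ?s * D + 0" using * by simp
      then show ?thesis using s by (intro bexI[of _ ?s] bexI[of _ 0]) simp_all
    qed
  next
    case (add g h)
    then obtain e f e' f' where "e \<in> fa n" "f \<in> fa n" "g = e * D + f"
      "e' \<in> fa n" "f' \<in> fa n" "h = e' * D + f'" by blast
    then show ?case
      by (intro bexI[of _ "e + e'"] bexI[of _ "f + f'"]) (auto simp: algebra_simps)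
  qed
  have word: "\<exists>b1\<in>fa n. \<exists>b0\<in>fa n. A.nf (D * wmon (Word xs)) = A.nf (b1 * D + b0)"
    if "set xs \<subseteq> {1..n}" for xs
    using that
  proof (induction xs)
    case Nil
    show ?case by (intro bexI[of _ 1] bexI[of _ 0]) (auto simp flip: zero_free_monoid_def)
  next
    case (Cons x xs)
    then have x: "x \<in> {1..n}" and xs: "Word xs \<in> words n" "Word xs \<in> words (Suc n)" by auto
    obtain b1 b0 where b: "b1 \<in> fa n" "b0 \<in> fa n" "A.nf (D * wmon (Word xs)) = A.nf (b1 * D + b0)"
      using Cons by auto
    have "keys (std_poly (d x (Suc n))) \<subseteq> {w \<in> sorted_words (Suc n). var_count (Suc n) w \<le> 1}"
    proof
      fix w assume "w \<in> keys (std_poly (d x (Suc n)))"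
      then obtain a where a: "w = std_word a" "a \<in> keys (d x (Suc n))" using keys_std_poly by fast
      have "a \<in> monomials (Suc n)" using A.galg_d[of x "Suc n"] x a by auto
      moreover have "var_count (Suc n) w \<le> 1"
        using keys_d_degree[OF x a(2)] by (metis a(1) exp_of_std_word lookup_exp_of var_count_def)
      ultimately show "w \<in> {w \<in> sorted_words (Suc n). var_count (Suc n) w \<le> 1}" using a by simp
    qed
    then obtain e f where ef: "e \<in> fa n" "f \<in> fa n" "std_poly (d x (Suc n)) = e * D + f"
      using lin by blast
    \<comment> \<open>The relation reads \<open>D x = (c x + e) D + f\<close>, and this is its
      coefficient of \<open>D\<close>.\<close>
    let ?b1 = "scal (c x (Suc n)) * var x + e"
    have v: "var x \<in> fa n" using x by (simp only: fa_var)
    have "comm_rel c d x (Suc n) \<in> A.I" using A.J_gen[of x "Suc n" 0 0 _ 1] x by simp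
    then have "A.nf (D * var x) = A.nf (?b1 * D + f)"
      using v ef by (subst A.nf_cong_iff) (auto simp: comm_rel_def algebra_simps)
    then have "A.nf (D * var x * wmon (Word xs)) = A.nf ((?b1 * D + f) * wmon (Word xs))"
      using v ef xs by (intro A.nf_mult_cong) simp_all
    also have "(?b1 * D + f) * wmon (Word xs) = ?b1 * (D * wmon (Word xs)) + f * wmon (Word xs)"
      by (simp add: distrib_right mult.assoc)
    also have "A.nf \<dots> = A.nf (?b1 * (b1 * D + b0) + f * wmon (Word xs))"
      using v ef xs b A.nf_mult_cong[OF refl b(3), of ?b1] by (simp add: A.nf_add)
    also have "?b1 * (b1 * D + b0) + f * wmon (Word xs)
        = ?b1 * b1 * D + (?b1 * b0 + f * wmon (Word xs))"
      by (simp add: distrib_left mult.assoc)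
    finally have "A.nf (D * var x * wmon (Word xs)) = A.nf (?b1 * b1 * D + (?b1 * b0 + f * wmon (Word xs)))" .
    moreover have "D * wmon (Word (x # xs)) = D * var x * wmon (Word xs)"
      unfolding mult.assoc by (simp add: var_def mult_single plus_free_monoid_def)
    moreover have "?b1 * b1 \<in> fa n" "?b1 * b0 + f * wmon (Word xs) \<in> fa n"
      using v ef xs b by simp_all
    ultimately show ?case
      by (intro bexI[of _ "?b1 * b1"] bexI[of _ "?b1 * b0 + f * wmon (Word xs)"]) simp_all
  qed
  have "keys b \<subseteq> words n" using assms by (simp add: fa_def)
  then have "b \<in> fa n \<and> (\<exists>b1\<in>fa n. \<exists>b0\<in>fa n. A.nf (D * b) = A.nf (b1 * D + b0))"
  proof (induction b rule: poly_induct)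
    case zero
    show ?case by (auto intro!: bexI[of _ 0])
  next
    case (single w k)
    then obtain b1 b0 where b: "b1 \<in> fa n" "b0 \<in> fa n" "A.nf (D * wmon w) = A.nf (b1 * D + b0)"
      using word[of "letters w"] by (auto simp: words_def)
    have "D * single w k = scal k * (D * wmon w)"
    proof -
      have "D * scal k * wmon w = scal k * D * wmon w" by (simp only: scal_comm[of D k])
      then show ?thesis by (simp only: mult.assoc scal_wmon)
    qed
    then have "A.nf (D * single w k) = A.nf (scal k * (b1 * D + b0))"
      using b single by (simp add: A.nf_scal words_Suc_mono)
    also have "scal k * (b1 * D + b0) = scal k * b1 * D + scal k * b0"
      by (simp add: distrib_left mult.assoc)
    finally show ?case
      using b single by (intro conjI bexI[of _ "scal k * b1"] bexI[of _ "scal k * b0"]) simp_all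
  next
    case (add f g)
    then obtain b1 b0 b1' b0' where b: "b1 \<in> fa n" "b0 \<in> fa n" "A.nf (D * f) = A.nf (b1 * D + b0)"
      "b1' \<in> fa n" "b0' \<in> fa n" "A.nf (D * g) = A.nf (b1' * D + b0')" by blast
    have "A.nf (D * (f + g)) = A.nf ((b1 * D + b0) + (b1' * D + b0'))"
      using b add by (simp add: distrib_left A.nf_add)
    also have "(b1 * D + b0) + (b1' * D + b0') = (b1 + b1') * D + (b0 + b0')"
      by (simp add: algebra_simps)
    finally show ?case using b add by (intro conjI bexI[of _ "b1 + b1'"] bexI[of _ "b0 + b0'"]) simp_all
  qed
  then show ?thesis by blast
qed

section \<open>The twist \<open>sg\<close> and the twisted derivation \<open>dl\<close> on B\<close>

definition sg :: "'k ncpoly \<Rightarrow> 'k ncpoly" where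
  "sg b = coef 1 (D * b)"

text \<open>Like \<open>sg\<close>, read off the normal form of \<open>D * b\<close>: both maps
  depend only on the class of \<open>b\<close> and return normal forms.\<close>

definition dl :: "'k ncpoly \<Rightarrow> 'k ncpoly" where
  "dl b = coef 0 (D * b)"

lemma sg_fa [simp]: "b \<in> fa n \<Longrightarrow> sg b \<in> fa n"
  and dl_fa [simp]: "b \<in> fa n \<Longrightarrow> dl b \<in> fa n"
  and nf_sg: "b \<in> fa n \<Longrightarrow> B.nf (sg b) = sg b"
  and nf_dl: "b \<in> fa n \<Longrightarrow> B.nf (dl b) = dl b"
  using coef_fa[of "D * b"] by (simp_all add: sg_def dl_def)

lemma coef_linear:
  assumes "b1 \<in> fa n" "b0 \<in> fa n"
  shows "coef 1 (b1 * D + b0) = B.nf b1" "coef 0 (b1 * D + b0) = B.nf b0"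
proof -
  have "coef i (b1 * D) = (if i = 1 then B.nf b1 else 0)" "coef i b0 = (if i = 0 then B.nf b0 else 0)" for i
    using coef_mono[of b1 i 1] coef_mono[of b0 i 0] assms by simp_all
  then show "coef 1 (b1 * D + b0) = B.nf b1" "coef 0 (b1 * D + b0) = B.nf b0"
    using assms by (simp_all add: coef_add)
qed

lemma sg_dl_unique:
  assumes "b1 \<in> fa n" "b0 \<in> fa n" "A.nf (D * b) = A.nf (b1 * D + b0)"
  shows "sg b = B.nf b1" "dl b = B.nf b0"
  using assms coef_linear[of b1 b0] by (simp_all add: sg_def dl_def)

lemma D_comm:
  assumes "b \<in> fa n"
  shows "A.nf (D * b) = A.nf (sg b * D + dl b)"
proof -
  obtain b1 b0 where b: "b1 \<in> fa n" "b0 \<in> fa n" "A.nf (D * b) = A.nf (b1 * D + b0)"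
    using D_comm_exists[OF assms] by blast
  have "A.nf (B.nf b1 * D) = A.nf (b1 * D)"
    by (intro A.nf_mult_cong) (use b nf_eq[of "b1"] nf_eq[of "B.nf b1"] B.nf_fa in simp_all)
  then show ?thesis
    using b nf_eq[of "b0"] nf_eq[of "B.nf b0"]
    unfolding sg_dl_unique[OF b] by (simp add: A.nf_add B.nf_fa)
qed

lemma sg_cong: "b \<in> fa n \<Longrightarrow> b' \<in> fa n \<Longrightarrow> B.nf b = B.nf b' \<Longrightarrow> sg b = sg b'"
  and dl_cong: "b \<in> fa n \<Longrightarrow> b' \<in> fa n \<Longrightarrow> B.nf b = B.nf b' \<Longrightarrow> dl b = dl b'"
proof -
  assume "b \<in> fa n" "b' \<in> fa n" "B.nf b = B.nf b'"
  then have "A.nf (D * b) = A.nf (D * b')"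
    by (intro A.nf_mult_cong) (simp_all add: nf_eq)
  then show "sg b = sg b'" "dl b = dl b'" by (simp_all add: sg_def dl_def)
qed

lemma sg_add: "b \<in> fa n \<Longrightarrow> b' \<in> fa n \<Longrightarrow> sg (b + b') = sg b + sg b'"
  and dl_add: "b \<in> fa n \<Longrightarrow> b' \<in> fa n \<Longrightarrow> dl (b + b') = dl b + dl b'"
  by (simp_all add: sg_def dl_def distrib_left coef_add)

lemma sg_scal: "sg (scal k) = scal k" and dl_scal: "dl (scal k) = 0"
proof -
  have k: "B.nf (scal k) = scal k"
    by (rule B.nf_sorted) (auto simp: scal_def sorted_words_def)
  have "A.nf (D * scal k) = A.nf (scal k * D + 0)" by (simp add: scal_comm)
  from sg_dl_unique[OF _ _ this] k show "sg (scal k) = scal k" "dl (scal k) = 0" by simp_all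
qed

text \<open>Moving \<open>D\<close> past \<open>b\<close> and then past \<open>b'\<close> expands
  \<open>D b b'\<close>; the uniqueness of the coefficients gives both rules.\<close>

lemma sg_mult: "b \<in> fa n \<Longrightarrow> b' \<in> fa n \<Longrightarrow> sg (b * b') = B.nf (sg b * sg b')"
  and dl_mult: "b \<in> fa n \<Longrightarrow> b' \<in> fa n \<Longrightarrow> dl (b * b') = B.nf (sg b * dl b' + dl b * b')"
proof -
  assume b: "b \<in> fa n" "b' \<in> fa n"
  have "A.nf (D * b * b') = A.nf ((sg b * D + dl b) * b')"
    using b D_comm by (intro A.nf_mult_cong) simp_all
  also have "(sg b * D + dl b) * b' = sg b * (D * b') + dl b * b'"
    by (simp add: distrib_right mult.assoc)
  also have "A.nf \<dots> = A.nf (sg b * (sg b' * D + dl b') + dl b * b')"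
    using b A.nf_mult_cong[OF refl D_comm[OF b(2)], of "sg b"] by (simp add: A.nf_add)
  also have "sg b * (sg b' * D + dl b') + dl b * b' = sg b * sg b' * D + (sg b * dl b' + dl b * b')"
    by (simp add: distrib_left mult.assoc)
  finally have "A.nf (D * (b * b')) = A.nf (sg b * sg b' * D + (sg b * dl b' + dl b * b'))"
    by (simp add: mult.assoc)
  from sg_dl_unique[OF _ _ this] b
  show "sg (b * b') = B.nf (sg b * sg b')" "dl (b * b') = B.nf (sg b * dl b' + dl b * b')" by simp_all
qed

text \<open>The leading monomial of \<open>D b\<close> is that of \<open>b\<close> times
  \<open>D\<close>. In \<open>sg b * D + dl b\<close> only the first summand has words ending in
  \<open>D\<close>, so the leading word comes from \<open>sg b\<close>, and \<open>D\<close> can be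
  cancelled.\<close>

lemma lm_sg:
  assumes "b \<in> fa n" "A.lm b a"
  shows "A.lm (sg b) a"
proof -
  let ?e = "var_exp (Suc n)" and ?D = "Word [Suc n]"
  have D: "A.lm D ?e" using A.lm_word[of ?D] by (simp add: var_def)
  then have lmD: "A.lm (D * b) (a + ?e)"
    using A.lm_mult[of D b ?e a] assms by (simp add: add.commute)
  have k: "keys (A.nf b) \<subseteq> sorted_words n" using assms nf_eq B.nf_spec by simp
  have "std_word a \<in> sorted_words n" using assms k A.lm_iff[of b a] by auto
  then have aw: "std_word a \<in> words n" "sorted (letters (std_word a))" by (auto simp: sorted_words_def)
  \<comment> \<open>As \<open>a\<close> involves only the first \<open>n\<close> variables,
    appending the largest letter leaves the word sorted.\<close>
  have "std_word (a + ?e) = std_word (exp_of (std_word a + ?D))" by simp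
  also have "\<dots> = std_word a + ?D"
    using aw by (intro std_word_exp_of) (force simp: sorted_append words_def)
  finally have std: "std_word (a + ?e) = std_word a + ?D" .
  have nf: "A.nf (D * b) = sg b * D + dl b"
  proof -
    have "A.nf (sg b * D) = sg b * D" "A.nf (dl b) = dl b"
      using nf_mono[of "sg b" 1] nf_mono[of "dl b" 0] assms(1) by (simp_all add: nf_sg nf_dl)
    then show ?thesis using D_comm assms(1) by (simp add: A.nf_add)
  qed
  have kd: "w \<in> words n" if "w \<in> keys (dl b)" for w
    using dl_fa[OF assms(1)] that by (auto simp: fa_def)
  have ks: "w \<in> words n" if "w \<in> keys (sg b)" for w
    using sg_fa[OF assms(1)] that by (auto simp: fa_def)
  have look: "lookup (A.nf (D * b)) (w + ?D) = lookup (sg b) w" for w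
  proof -
    have "w + ?D \<notin> keys (dl b)" using kd[of "w + ?D"] by auto
    moreover have "lookup (g * D) (w + ?D) = lookup g w" for g :: "'k ncpoly"
    proof -
      have "keys g \<subseteq> UNIV" by simp
      then show ?thesis
        by (induction g rule: poly_induct)
          (auto simp: var_def mult_single lookup_single when_def distrib_right lookup_add)
    qed
    ultimately show ?thesis by (simp add: nf lookup_add in_keys_iff)
  qed
  have sgk: "A.nf (sg b) = sg b" using assms(1) by (simp add: nf_eq nf_sg)
  have am: "a \<in> monomials (Suc n)" "?e \<in> monomials (Suc n)" using assms(2) A.lm_monomials by auto
  have *: "std_word a + ?D \<in> keys (A.nf (D * b))"
    "\<And>w. w \<in> keys (A.nf (D * b)) \<Longrightarrow> w = std_word a + ?D \<or> A.lt (exp_of w) (a + ?e)"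
    using lmD A.lm_iff[of "D * b" "a + ?e"] assms(1) by (auto simp: std)
  show ?thesis
    unfolding A.lm_iff[OF fa_Suc_mono[OF sg_fa[OF assms(1)]]] sgk
  proof (intro conjI ballI)
    show "std_word a \<in> keys (sg b)" using *(1) look[of "std_word a"] by (simp add: in_keys_iff)
    fix w assume w: "w \<in> keys (sg b)"
    then have "w + ?D \<in> keys (A.nf (D * b))" using look[of w] by (simp add: in_keys_iff)
    then have "w + ?D = std_word a + ?D \<or> A.lt (exp_of (w + ?D)) (a + ?e)" by (rule *(2))
    then show "w = std_word a \<or> A.lt (exp_of w) a"
    proof
      assume lt: "A.lt (exp_of (w + ?D)) (a + ?e)"
      have "exp_of w \<in> monomials (Suc n)" using ks[OF w] by (simp add: exp_of_monomials words_Suc_mono)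
      then consider "A.lt (exp_of w) a" | "exp_of w = a" | "A.lt a (exp_of w)" using A.lt_total am by blast
      then show ?thesis
      proof cases
        case 3
        then have "A.lt (a + ?e) (exp_of w + ?e)" using am by (intro A.lt_add)
        then show ?thesis using lt A.lt_trans[of "a + ?e" "exp_of w + ?e" "a + ?e"] by simp
      qed (use lt in auto)
    qed simp
  qed
qed

lemma sg_nonzero:
  assumes "b \<in> fa n" "B.nf b \<noteq> 0"
  shows "B.nf (sg b) \<noteq> 0"
proof -
  obtain a where "A.lm b a" using A.lm_exists[of b] assms nf_eq by auto
  then have "A.nf (sg b) \<noteq> 0"
    using A.lm_nonzero[OF fa_Suc_mono[OF sg_fa[OF assms(1)]] lm_sg[OF assms(1)]] by blast
  then show ?thesis using assms nf_eq by simp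
qed

text \<open>\<open>sg s\<close> has the leading monomial of \<open>s\<close>, so subtracting a
  scalar multiple of it from \<open>s\<close> leaves zero or a remainder with smaller leading
  monomial, which is in the image by induction.\<close>

lemma sg_surj:
  assumes "s \<in> fa n"
  shows "\<exists>b\<in>fa n. sg b = B.nf s"
proof -
  have "\<forall>s\<in>fa n. A.lm s a \<longrightarrow> (\<exists>b\<in>fa n. sg b = B.nf s)" for a
  proof (induction a rule: wfp_induct_rule[OF A.wfp_lt])
    case (1 a)
    show ?case
    proof (intro ballI impI)
      fix s assume s: "s \<in> fa n" "A.lm s a"
      obtain k where k: "A.nf (s - scal k * sg s) \<in> A.Low a"
        using A.lm_cancel[of s "sg s" a] s lm_sg by auto
      let ?s = "s - scal k * sg s"
      have sfa: "?s \<in> fa n" using s by simp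
      have "\<exists>b\<in>fa n. sg b = B.nf ?s"
      proof (cases "A.nf ?s = 0")
        case True
        then have "sg 0 = B.nf ?s" using sg_scal[of 0] nf_eq sfa by simp
        then show ?thesis by auto
      next
        case False
        then obtain a' where a': "A.lm ?s a'" using A.lm_exists[OF fa_Suc_mono[OF sfa]] by blast
        then have "A.lt a' a"
          using k A.lm_iff[of ?s a'] sfa by (auto simp: A.Low_def)
        then show ?thesis using 1 a' sfa by blast
      qed
      then obtain b where b: "b \<in> fa n" "sg b = B.nf ?s" by blast
      \<comment> \<open>Adding \<open>k s\<close> to the preimage of the remainder restores the part
        \<open>k\<close> times \<open>sg s\<close> that was subtracted.\<close>
      have "sg (b + scal k * s) = sg b + B.nf (scal k * sg s)"
        using b s by (simp add: sg_add sg_mult sg_scal)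
      also have "\<dots> = B.nf s" using b s by (simp add: B.nf_diff)
      finally show "\<exists>b\<in>fa n. sg b = B.nf s" using b s by (intro bexI[of _ "b + scal k * s"]) auto
    qed
  qed
  moreover have "\<exists>b\<in>fa n. sg b = B.nf s" if "B.nf s = 0"
    using that sg_scal[of 0] by (intro bexI[of _ 0]) simp_all
  ultimately show ?thesis using A.lm_exists[of s] assms nf_eq by (metis fa_Suc_mono)
qed

section \<open>The right Ore condition for A\<close>

text \<open>The Ore condition for one fixed numerator \<open>a\<close> against all denominators, a
  form that passes to sums and products.\<close>

definition right_fraction :: "'k ncpoly \<Rightarrow> bool" where
  "right_fraction a \<longleftrightarrow> a \<in> fa (Suc n) \<and> (\<forall>s\<in>fa n. B.nf s \<noteq> 0 \<longrightarrow>
    (\<exists>t\<in>fa n. \<exists>f\<in>fa (Suc n). B.nf t \<noteq> 0 \<and> A.nf (a * t) = A.nf (s * f)))"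

lemma right_fractionE:
  assumes "right_fraction a" "s \<in> fa n" "B.nf s \<noteq> 0"
  obtains t f where "t \<in> fa n" "f \<in> fa (Suc n)" "B.nf t \<noteq> 0" "A.nf (a * t) = A.nf (s * f)"
  using assms unfolding right_fraction_def by blast

lemma A_cong_right:
  "A.nf f = A.nf g \<Longrightarrow> f \<in> fa (Suc n) \<Longrightarrow> g \<in> fa (Suc n) \<Longrightarrow> h \<in> fa (Suc n) \<Longrightarrow> A.nf (f * h) = A.nf (g * h)"
  by (rule A.nf_mult_cong) simp_all

lemma A_cong_left:
  "A.nf f = A.nf g \<Longrightarrow> f \<in> fa (Suc n) \<Longrightarrow> g \<in> fa (Suc n) \<Longrightarrow> h \<in> fa (Suc n) \<Longrightarrow> A.nf (h * f) = A.nf (h * g)"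
  by (rule A.nf_mult_cong) simp_all

lemma right_fraction_base:
  assumes "b \<in> fa n"
  shows "right_fraction b"
  unfolding right_fraction_def
proof (intro conjI ballI impI)
  fix s assume s: "s \<in> fa n" "B.nf s \<noteq> 0"
  show "\<exists>t\<in>fa n. \<exists>f\<in>fa (Suc n). B.nf t \<noteq> 0 \<and> A.nf (b * t) = A.nf (s * f)"
  proof (cases "B.nf b = 0")
    case True
    then have "A.nf (b * 1) = A.nf (s * 0)" using nf_eq assms by simp
    then show ?thesis by (intro bexI[of _ 1] bexI[of _ 0]) auto
  next
    case False
    then obtain t f where t: "t \<in> fa n" "f \<in> fa n" "B.nf (b * t) = B.nf (s * f)" "B.nf (b * t) \<noteq> 0"
      using B.right_ore[OF assms s(1)] s(2) by blast
    have "B.nf t \<noteq> 0"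
    proof
      assume "B.nf t = 0"
      then have "B.nf (b * t) = B.nf (b * 0)" using assms t by (intro B.nf_mult_cong) auto
      then show False using t(4) by simp
    qed
    moreover have "A.nf (b * t) = A.nf (s * f)" using t assms s by (simp add: nf_eq)
    ultimately show ?thesis using t by (intro bexI[of _ t] bexI[of _ f]) simp_all
  qed
qed (use assms in simp)

text \<open>The denominator travels through \<open>a\<close>, where it turns into \<open>t\<close>,
  and then \<open>t\<close> travels through \<open>b\<close>.\<close>

lemma right_fraction_mult:
  assumes "right_fraction a" "right_fraction b"
  shows "right_fraction (a * b)"
proof -
  have fa: "a \<in> fa (Suc n)" "b \<in> fa (Suc n)" using assms by (auto simp: right_fraction_def)
  have "\<exists>t\<in>fa n. \<exists>f\<in>fa (Suc n). B.nf t \<noteq> 0 \<and> A.nf (a * b * t) = A.nf (s * f)"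
    if s: "s \<in> fa n" "B.nf s \<noteq> 0" for s
  proof -
    obtain t f where t: "t \<in> fa n" "f \<in> fa (Suc n)" "B.nf t \<noteq> 0" "A.nf (a * t) = A.nf (s * f)"
      using right_fractionE[OF assms(1) s] .
    obtain u g where u: "u \<in> fa n" "g \<in> fa (Suc n)" "B.nf u \<noteq> 0" "A.nf (b * u) = A.nf (t * g)"
      using right_fractionE[OF assms(2) t(1,3)] .
    have "A.nf (a * (b * u)) = A.nf (a * (t * g))" using A_cong_left[OF u(4)] fa t u by simp
    also have "\<dots> = A.nf (s * f * g)"
      using A_cong_right[OF t(4), of g] fa t u s by (simp add: mult.assoc)
    finally have "A.nf (a * b * u) = A.nf (s * (f * g))" by (simp add: mult.assoc)
    then show ?thesis using t u by (intro bexI[of _ u] bexI[of _ "f * g"]) auto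
  qed
  then show ?thesis using fa unfolding right_fraction_def by (intro conjI ballI impI) auto
qed

text \<open>The denominators found for the two summands have a common right multiple in B by
  \<open>right_ore\<close>.\<close>

lemma right_fraction_add:
  assumes "right_fraction a" "right_fraction b"
  shows "right_fraction (a + b)"
proof -
  have fa: "a \<in> fa (Suc n)" "b \<in> fa (Suc n)" using assms by (auto simp: right_fraction_def)
  have "\<exists>t\<in>fa n. \<exists>f\<in>fa (Suc n). B.nf t \<noteq> 0 \<and> A.nf ((a + b) * t) = A.nf (s * f)"
    if s: "s \<in> fa n" "B.nf s \<noteq> 0" for s
  proof -
    obtain t f where t: "t \<in> fa n" "f \<in> fa (Suc n)" "B.nf t \<noteq> 0" "A.nf (a * t) = A.nf (s * f)"
      using right_fractionE[OF assms(1) s] .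
    obtain u g where u: "u \<in> fa n" "g \<in> fa (Suc n)" "B.nf u \<noteq> 0" "A.nf (b * u) = A.nf (s * g)"
      using right_fractionE[OF assms(2) s] .
    obtain p q where pq: "p \<in> fa n" "q \<in> fa n" "B.nf (t * p) = B.nf (u * q)" "B.nf (t * p) \<noteq> 0"
      using B.right_ore[OF t(1) u(1) t(3) u(3)] by blast
    have "A.nf (a * (t * p)) = A.nf (s * f * p)"
      using A_cong_right[OF t(4), of p] fa t(1,2) s(1) pq(1,2) by (simp add: mult.assoc)
    moreover have "A.nf (b * (t * p)) = A.nf (s * g * q)"
    proof -
      have "A.nf (t * p) = A.nf (u * q)" using pq(1-3) t(1) u(1) by (simp add: nf_eq)
      then have "A.nf (b * (t * p)) = A.nf (b * (u * q))" using A_cong_left[of "t * p" "u * q" b] fa t(1) u(1) pq(1,2) by simp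
      also have "\<dots> = A.nf (s * g * q)"
        using A_cong_right[OF u(4), of q] fa u(1,2) s(1) pq(1,2) by (simp add: mult.assoc)
      finally show ?thesis .
    qed
    ultimately have "A.nf ((a + b) * (t * p)) = A.nf (s * (f * p + g * q))"
      using fa t(1,2) u(1,2) s(1) pq(1,2) by (simp add: distrib_left distrib_right A.nf_add mult.assoc)
    then show ?thesis using t(1,2) u(1,2) pq
      by (intro bexI[of _ "t * p"] bexI[of _ "f * p + g * q"]) simp_all
  qed
  then show ?thesis using fa unfolding right_fraction_def by (intro conjI ballI impI) auto
qed

lemma right_fraction_D: "right_fraction D"
proof -
  have "\<exists>t\<in>fa n. \<exists>f\<in>fa (Suc n). B.nf t \<noteq> 0 \<and> A.nf (D * t) = A.nf (s * f)"
    if s: "s \<in> fa n" "B.nf s \<noteq> 0" for s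
  proof -
    \<comment> \<open>Surjectivity of the twist gives \<open>D b = s D + dl b\<close>. The first
      summand is already a left multiple by \<open>s\<close>, and the second is repaired by a right
      factor \<open>t\<close> from B.\<close>
    obtain b where b: "b \<in> fa n" "sg b = B.nf s" using sg_surj s(1) by blast
    have "B.nf b \<noteq> 0" using b s sg_cong[of b 0] sg_scal[of 0] by auto
    obtain t f where t: "t \<in> fa n" "f \<in> fa (Suc n)" "B.nf t \<noteq> 0" "A.nf (dl b * t) = A.nf (s * f)"
      using right_fractionE[OF right_fraction_base[OF dl_fa[OF b(1)]] s] .
    have "A.nf (sg b) = A.nf s" using b s by (simp add: nf_eq B.nf_fa)
    then have 1: "A.nf (sg b * (D * t)) = A.nf (s * (D * t))"
      by (rule A_cong_right) (use b(1) s(1) t(1) in simp_all)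
    have "A.nf (D * b * t) = A.nf ((sg b * D + dl b) * t)"
      by (rule A_cong_right[OF D_comm[OF b(1)]]) (use b(1) t(1) in simp_all)
    also have "\<dots> = A.nf (s * (D * t + f))"
      using 1 t(1,2,4) b(1) s(1) by (simp add: distrib_left distrib_right A.nf_add mult.assoc)
    finally have "A.nf (D * (b * t)) = A.nf (s * (D * t + f))" by (simp add: mult.assoc)
    moreover have "B.nf (b * t) \<noteq> 0" using B.nf_mult_nonzero b t \<open>B.nf b \<noteq> 0\<close> by blast
    ultimately show ?thesis using b(1) t(1,2)
      by (intro bexI[of _ "b * t"] bexI[of _ "D * t + f"]) simp_all
  qed
  then show ?thesis unfolding right_fraction_def by (intro conjI ballI impI) auto
qed

lemma right_fraction: "f \<in> fa (Suc n) \<Longrightarrow> right_fraction f"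
proof (induction f rule: ext_induct)
  case (cong f g)
  have "A.nf (g * t) = A.nf (f * t)" if "t \<in> fa n" for t
    using A_cong_right[OF cong(3)] cong that by simp
  then show ?case using cong by (simp add: right_fraction_def)
next
  case (add f g)
  then show ?case by (simp add: right_fraction_add)
next
  case (mono b i)
  have "right_fraction (D ^ i)"
    by (induction i) (use right_fraction_base[of 1] in \<open>auto intro: right_fraction_mult right_fraction_D\<close>)
  then show ?case using right_fraction_mult right_fraction_base mono by blast
qed

end

section \<open>Universal property of Ore localizations\<close>

lemma ring_hom_inv_Units:
  assumes "ring R" "ring S" "h \<in> ring_hom R S" "x \<in> Units R"
  shows "h x \<in> Units S"
proof -
  interpret R: ring R by fact
  interpret S: ring S by fact
  have "h x \<otimes>\<^bsub>S\<^esub> h (inv\<^bsub>R\<^esub> x) = \<one>\<^bsub>S\<^esub>" "h (inv\<^bsub>R\<^esub> x) \<otimes>\<^bsub>S\<^esub> h x = \<one>\<^bsub>S\<^esub>"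
    using ring_hom_mult[OF assms(3), of x "inv\<^bsub>R\<^esub> x"] ring_hom_mult[OF assms(3), of "inv\<^bsub>R\<^esub> x" x]
      ring_hom_one[OF assms(3)] assms(4) by (simp_all add: R.Units_closed)
  moreover have "h x \<in> carrier S" "h (inv\<^bsub>R\<^esub> x) \<in> carrier S"
    by (intro ring_hom_closed[OF assms(3)] R.Units_closed R.Units_inv_closed assms(4))+
  ultimately show ?thesis unfolding Units_def by blast
qed

locale localization =
  R: ring R + L: ring L for R (structure) and S and L :: "('b, 'n) ring_scheme" and \<phi> +
  assumes loc: "ore_localization R S L \<phi>" and S: "submonoid S R"
begin

lemma S_closed: "s \<in> S \<Longrightarrow> s \<in> carrier R"
  using submonoid.subset[OF S] by blast

lemma S_mult: "s \<in> S \<Longrightarrow> t \<in> S \<Longrightarrow> s \<otimes> t \<in> S"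
  using submonoid.m_closed[OF S] by blast

lemma hom: "\<phi> \<in> ring_hom R L" and unit: "s \<in> S \<Longrightarrow> \<phi> s \<in> Units L"
  and inj: "inj_on \<phi> (carrier R)"
  using loc by (auto simp: ore_localization_def)

lemma phi_closed: "a \<in> carrier R \<Longrightarrow> \<phi> a \<in> carrier L"
  using hom ring_hom_closed by fast

lemma fraction:
  assumes "x \<in> carrier L"
  shows "\<exists>s\<in>S. \<exists>a\<in>carrier R. \<phi> s \<otimes>\<^bsub>L\<^esub> x = \<phi> a"
proof -
  obtain s a where *: "s \<in> S" "a \<in> carrier R" "x = inv\<^bsub>L\<^esub> \<phi> s \<otimes>\<^bsub>L\<^esub> \<phi> a"
    using loc assms unfolding ore_localization_def by blast
  then have "\<phi> s \<otimes>\<^bsub>L\<^esub> x = \<phi> a"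
    using unit[OF *(1)] phi_closed[OF *(2)] by (simp add: L.m_assoc[symmetric] L.Units_closed)
  then show ?thesis using * by blast
qed

text \<open>The left Ore condition follows from the existence of the localization: the right
  fraction of \<open>a\<close> by \<open>s\<close> is an element of \<open>L\<close>, hence a left
  fraction, and injectivity brings the cleared equation back to \<open>R\<close>.\<close>

lemma left_ore:
  assumes "a \<in> carrier R" "s \<in> S"
  shows "\<exists>u\<in>S. \<exists>v\<in>carrier R. u \<otimes> a = v \<otimes> s"
proof -
  let ?x = "\<phi> a \<otimes>\<^bsub>L\<^esub> inv\<^bsub>L\<^esub> \<phi> s"
  have c: "\<phi> a \<in> carrier L" "\<phi> s \<in> Units L" "inv\<^bsub>L\<^esub> \<phi> s \<in> carrier L" "\<phi> s \<in> carrier L"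
    using assms unit phi_closed S_closed by auto
  then obtain u v where uv: "u \<in> S" "v \<in> carrier R" "\<phi> u \<otimes>\<^bsub>L\<^esub> ?x = \<phi> v"
    using fraction[of ?x] by auto
  have u: "\<phi> u \<in> carrier L" using uv phi_closed S_closed by blast
  have "\<phi> u \<otimes>\<^bsub>L\<^esub> \<phi> a = \<phi> u \<otimes>\<^bsub>L\<^esub> ?x \<otimes>\<^bsub>L\<^esub> \<phi> s"
    using c u by (simp add: L.m_assoc)
  then have "\<phi> (u \<otimes> a) = \<phi> (v \<otimes> s)"
    using uv assms S_closed by (simp add: ring_hom_mult[OF hom])
  then show ?thesis
    using inj_onD[OF inj] uv assms S_closed by blast
qed

lemma hom_eq:
  assumes T: "ring T" and g: "g \<in> ring_hom L T" "h \<in> ring_hom L T"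
    and eq: "\<And>a. a \<in> carrier R \<Longrightarrow> g (\<phi> a) = h (\<phi> a)" and x: "x \<in> carrier L"
  shows "g x = h x"
proof -
  interpret T: ring T by fact
  obtain s a where sa: "s \<in> S" "a \<in> carrier R" "\<phi> s \<otimes>\<^bsub>L\<^esub> x = \<phi> a" using fraction x by blast
  have s: "\<phi> s \<in> carrier L" using sa phi_closed S_closed by blast
  have U: "g (\<phi> s) \<in> Units T"
    using ring_hom_inv_Units[OF L.ring_axioms T g(1) unit[OF sa(1)]] .
  have "g (\<phi> s) \<otimes>\<^bsub>T\<^esub> g x = g (\<phi> s) \<otimes>\<^bsub>T\<^esub> h x"
    using ring_hom_mult[OF g(1) s x] ring_hom_mult[OF g(2) s x] eq sa S_closed by simp
  then show ?thesis using U T.Units_l_cancel ring_hom_closed[OF _ x] g by blast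
qed

text \<open>The value at a left fraction is forced; \<open>left_ore\<close> shows that it does not
  depend on the fraction and supplies the common denominators for sums and products.\<close>

lemma hom_exists:
  assumes T: "ring T" and f: "f \<in> ring_hom R T" "\<And>s. s \<in> S \<Longrightarrow> f s \<in> Units T"
  shows "\<exists>h\<in>ring_hom L T. \<forall>a\<in>carrier R. h (\<phi> a) = f a"
proof -
  interpret T: ring T by fact
  have fc: "a \<in> carrier R \<Longrightarrow> f a \<in> carrier T" for a using f(1) ring_hom_closed by fast
  \<comment> \<open>\<open>y\<close> is the image of \<open>x\<close> if it solves the transported
    equation for some fraction representing \<open>x\<close>; no representative has to be
    chosen.\<close>
  define H where "H x y \<longleftrightarrow> y \<in> carrier T \<and>
    (\<exists>s\<in>S. \<exists>a\<in>carrier R. \<phi> s \<otimes>\<^bsub>L\<^esub> x = \<phi> a \<and> f s \<otimes>\<^bsub>T\<^esub> y = f a)" for x y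
  have HI: "H x y" if "y \<in> carrier T" "s \<in> S" "a \<in> carrier R"
    "\<phi> s \<otimes>\<^bsub>L\<^esub> x = \<phi> a" "f s \<otimes>\<^bsub>T\<^esub> y = f a" for x y s a
    unfolding H_def using that by blast
  have ex: "\<exists>y. H x y" if x: "x \<in> carrier L" for x
  proof -
    obtain s a where sa: "s \<in> S" "a \<in> carrier R" "\<phi> s \<otimes>\<^bsub>L\<^esub> x = \<phi> a" using fraction[OF x] by blast
    have "f s \<otimes>\<^bsub>T\<^esub> (inv\<^bsub>T\<^esub> f s \<otimes>\<^bsub>T\<^esub> f a) = f a"
      using f(2)[OF sa(1)] fc[OF sa(2)] by (simp add: T.m_assoc[symmetric] T.Units_closed)
    then have "H x (inv\<^bsub>T\<^esub> f s \<otimes>\<^bsub>T\<^esub> f a)"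
      using sa f(2)[OF sa(1)] fc[OF sa(2)] by (intro HI[of _ s a]) auto
    then show ?thesis ..
  qed
  have uniq: "y = y'" if x: "x \<in> carrier L" and H: "H x y" "H x y'" for x y y'
  proof -
    obtain s a where sa: "s \<in> S" "a \<in> carrier R" "\<phi> s \<otimes>\<^bsub>L\<^esub> x = \<phi> a" "f s \<otimes>\<^bsub>T\<^esub> y = f a"
      using H(1) by (auto simp: H_def)
    obtain t b where tb: "t \<in> S" "b \<in> carrier R" "\<phi> t \<otimes>\<^bsub>L\<^esub> x = \<phi> b" "f t \<otimes>\<^bsub>T\<^esub> y' = f b"
      using H(2) by (auto simp: H_def)
    have y: "y \<in> carrier T" "y' \<in> carrier T" using H by (auto simp: H_def)
    have st: "s \<in> carrier R" "t \<in> carrier R" using sa tb S_closed by auto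
    obtain u v where uv: "u \<in> S" "v \<in> carrier R" "u \<otimes> s = v \<otimes> t"
      using left_ore[OF st(1) tb(1)] by blast
    have u: "u \<in> carrier R" using uv S_closed by blast
    have "\<phi> (u \<otimes> a) = \<phi> (u \<otimes> s) \<otimes>\<^bsub>L\<^esub> x"
      using sa st u x by (simp add: ring_hom_mult[OF hom] L.m_assoc phi_closed)
    also have "\<dots> = \<phi> (v \<otimes> b)"
      unfolding uv(3) using tb st uv x by (simp add: ring_hom_mult[OF hom] L.m_assoc phi_closed)
    finally have ab: "u \<otimes> a = v \<otimes> b" using inj_onD[OF inj] u uv sa tb by blast
    have "f (u \<otimes> s) \<otimes>\<^bsub>T\<^esub> y = f (u \<otimes> a)"
      using sa st u y by (simp add: ring_hom_mult[OF f(1)] T.m_assoc fc)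
    also have "\<dots> = f (v \<otimes> t) \<otimes>\<^bsub>T\<^esub> y'"
      unfolding ab using tb st uv y by (simp add: ring_hom_mult[OF f(1)] T.m_assoc fc)
    finally have "f (u \<otimes> s) \<otimes>\<^bsub>T\<^esub> y = f (u \<otimes> s) \<otimes>\<^bsub>T\<^esub> y'" by (simp add: uv(3))
    then show ?thesis using T.Units_l_cancel[OF f(2)[OF S_mult[OF uv(1) sa(1)]]] y by blast
  qed
  define h where "h x = (THE y. H x y)" for x
  have hH: "H x (h x)" if "x \<in> carrier L" for x
  proof -
    have "\<exists>!y. H x y" using ex[OF that] uniq[OF that] by (auto intro: ex_ex1I)
    then show ?thesis unfolding h_def by (rule theI')
  qed
  have hI: "h x = y" if "x \<in> carrier L" "H x y" for x y
    using uniq[OF that(1) hH[OF that(1)] that(2)] .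
  have hc: "h x \<in> carrier T" if "x \<in> carrier L" for x using hH[OF that] by (simp add: H_def)
  have ha: "h (\<phi> a) = f a" if "a \<in> carrier R" for a
  proof (rule hI)
    have "\<phi> \<one> \<otimes>\<^bsub>L\<^esub> \<phi> a = \<phi> a" "f \<one> \<otimes>\<^bsub>T\<^esub> f a = f a"
      using that by (simp_all add: ring_hom_one[OF hom] ring_hom_one[OF f(1)] phi_closed fc)
    then show "H (\<phi> a) (f a)"
      using that fc submonoid.one_closed[OF S] by (intro HI[of _ \<one> a]) auto
  qed (use that phi_closed in blast)
  have "h \<in> ring_hom L T"
  proof (rule ring_hom_memI)
    show "h x \<in> carrier T" if "x \<in> carrier L" for x using hc that .
    show "h \<one>\<^bsub>L\<^esub> = \<one>\<^bsub>T\<^esub>"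
      using ha[of \<one>] by (simp add: ring_hom_one[OF hom] ring_hom_one[OF f(1)])
    fix x x' assume x: "x \<in> carrier L" "x' \<in> carrier L"
    have y: "h x \<in> carrier T" "h x' \<in> carrier T" using hc x by auto
    obtain s a where sa: "s \<in> S" "a \<in> carrier R" "\<phi> s \<otimes>\<^bsub>L\<^esub> x = \<phi> a" "f s \<otimes>\<^bsub>T\<^esub> h x = f a"
      using hH[OF x(1)] by (auto simp: H_def)
    obtain t b where tb: "t \<in> S" "b \<in> carrier R" "\<phi> t \<otimes>\<^bsub>L\<^esub> x' = \<phi> b" "f t \<otimes>\<^bsub>T\<^esub> h x' = f b"
      using hH[OF x(2)] by (auto simp: H_def)
    have st: "s \<in> carrier R" "t \<in> carrier R" using sa tb S_closed by auto
    show "h (x \<otimes>\<^bsub>L\<^esub> x') = h x \<otimes>\<^bsub>T\<^esub> h x'"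
    proof (rule hI)
      \<comment> \<open>Moving the numerator \<open>a\<close> of \<open>x\<close> past the
        denominator \<open>t\<close> of \<open>x'\<close> turns the product into one fraction with
        denominator \<open>u s\<close>.\<close>
      obtain u v where uv: "u \<in> S" "v \<in> carrier R" "u \<otimes> a = v \<otimes> t"
        using left_ore[OF sa(2) tb(1)] by blast
      have u: "u \<in> carrier R" using uv S_closed by blast
      have "\<phi> (u \<otimes> s) \<otimes>\<^bsub>L\<^esub> (x \<otimes>\<^bsub>L\<^esub> x') = \<phi> u \<otimes>\<^bsub>L\<^esub> (\<phi> s \<otimes>\<^bsub>L\<^esub> x) \<otimes>\<^bsub>L\<^esub> x'"
        using x st u by (simp add: ring_hom_mult[OF hom] L.m_assoc phi_closed)
      also have "\<dots> = \<phi> (v \<otimes> t) \<otimes>\<^bsub>L\<^esub> x'"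
        using sa u by (simp add: ring_hom_mult[OF hom] uv(3)[symmetric])
      also have "\<dots> = \<phi> (v \<otimes> b)"
        using x st uv tb by (simp add: ring_hom_mult[OF hom] L.m_assoc phi_closed)
      finally have 1: "\<phi> (u \<otimes> s) \<otimes>\<^bsub>L\<^esub> (x \<otimes>\<^bsub>L\<^esub> x') = \<phi> (v \<otimes> b)" .
      have "f (u \<otimes> s) \<otimes>\<^bsub>T\<^esub> (h x \<otimes>\<^bsub>T\<^esub> h x') = f u \<otimes>\<^bsub>T\<^esub> (f s \<otimes>\<^bsub>T\<^esub> h x) \<otimes>\<^bsub>T\<^esub> h x'"
        using y st u by (simp add: ring_hom_mult[OF f(1)] T.m_assoc fc)
      also have "\<dots> = f (v \<otimes> t) \<otimes>\<^bsub>T\<^esub> h x'"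
        using sa u by (simp add: ring_hom_mult[OF f(1)] uv(3)[symmetric])
      also have "\<dots> = f (v \<otimes> b)"
        using y st uv tb by (simp add: ring_hom_mult[OF f(1)] T.m_assoc fc)
      finally have 2: "f (u \<otimes> s) \<otimes>\<^bsub>T\<^esub> (h x \<otimes>\<^bsub>T\<^esub> h x') = f (v \<otimes> b)" .
      show "H (x \<otimes>\<^bsub>L\<^esub> x') (h x \<otimes>\<^bsub>T\<^esub> h x')"
        by (rule HI[OF _ S_mult[OF uv(1) sa(1)] _ 1 2]) (use y uv(2) tb(2) in auto)
    qed (use x in simp)
    show "h (x \<oplus>\<^bsub>L\<^esub> x') = h x \<oplus>\<^bsub>T\<^esub> h x'"
    proof (rule hI)
      \<comment> \<open>\<open>u s = v t\<close> is a common left denominator of both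
        summands.\<close>
      obtain u v where uv: "u \<in> S" "v \<in> carrier R" "u \<otimes> s = v \<otimes> t"
        using left_ore[OF st(1) tb(1)] by blast
      have u: "u \<in> carrier R" using uv S_closed by blast
      have us: "\<phi> (u \<otimes> s) \<in> carrier L" "f (u \<otimes> s) \<in> carrier T"
        using u st phi_closed fc by auto
      have "\<phi> (u \<otimes> s) \<otimes>\<^bsub>L\<^esub> x = \<phi> (u \<otimes> a)"
        using x st u sa by (simp add: ring_hom_mult[OF hom] L.m_assoc phi_closed)
      moreover have "\<phi> (u \<otimes> s) \<otimes>\<^bsub>L\<^esub> x' = \<phi> (v \<otimes> b)"
        unfolding uv(3) using x st uv tb by (simp add: ring_hom_mult[OF hom] L.m_assoc phi_closed)
      ultimately have 1: "\<phi> (u \<otimes> s) \<otimes>\<^bsub>L\<^esub> (x \<oplus>\<^bsub>L\<^esub> x') = \<phi> (u \<otimes> a \<oplus> v \<otimes> b)"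
        using x us u uv sa tb by (simp add: L.r_distr ring_hom_add[OF hom])
      have "f (u \<otimes> s) \<otimes>\<^bsub>T\<^esub> h x = f (u \<otimes> a)"
        using y st u sa by (simp add: ring_hom_mult[OF f(1)] T.m_assoc fc)
      moreover have "f (u \<otimes> s) \<otimes>\<^bsub>T\<^esub> h x' = f (v \<otimes> b)"
        unfolding uv(3) using y st uv tb by (simp add: ring_hom_mult[OF f(1)] T.m_assoc fc)
      ultimately have 2: "f (u \<otimes> s) \<otimes>\<^bsub>T\<^esub> (h x \<oplus>\<^bsub>T\<^esub> h x') = f (u \<otimes> a \<oplus> v \<otimes> b)"
        using y us u uv sa tb by (simp add: T.r_distr ring_hom_add[OF f(1)])
      have "u \<otimes> a \<oplus> v \<otimes> b \<in> carrier R" using u uv sa tb by simp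
      then show "H (x \<oplus>\<^bsub>L\<^esub> x') (h x \<oplus>\<^bsub>T\<^esub> h x')"
        by (intro HI[OF _ S_mult[OF uv(1) sa(1)] _ 1 2]) (use y in auto)
    qed (use x in simp)
  qed
  then show ?thesis using ha by blast
qed

end

text \<open>The two induced homomorphisms compose to maps that agree with the identity on
  \<open>R\<close>, hence everywhere by \<open>hom_eq\<close>.\<close>

lemma ore_localization_unique:
  assumes "ring R" "submonoid S R" "ore_localization R S L \<phi>" "ore_localization R S L' \<phi>'"
  shows "\<exists>\<Phi>\<in>ring_iso L L'. \<forall>a\<in>carrier R. \<Phi> (\<phi> a) = \<phi>' a"
proof -
  interpret R: ring R by fact
  have r: "ring L" "ring L'" using assms by (simp_all add: ore_localization_def)
  interpret L: localization R S L \<phi>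
    using assms r by (simp add: localization_def localization_axioms_def)
  interpret L': localization R S L' \<phi>'
    using assms r by (simp add: localization_def localization_axioms_def)
  obtain h where h: "h \<in> ring_hom L L'" "\<And>a. a \<in> carrier R \<Longrightarrow> h (\<phi> a) = \<phi>' a"
    using L.hom_exists[OF r(2) L'.hom L'.unit] by blast
  obtain h' where h': "h' \<in> ring_hom L' L" "\<And>a. a \<in> carrier R \<Longrightarrow> h' (\<phi>' a) = \<phi> a"
    using L'.hom_exists[OF r(1) L.hom L.unit] by blast
  have "(h' \<circ> h) x = id x" if "x \<in> carrier L" for x
    by (rule L.hom_eq[OF r(1) ring_hom_trans[OF h(1) h'(1)] _ _ that])
      (auto simp: h h' ring_hom_def)
  moreover have "(h \<circ> h') x = id x" if "x \<in> carrier L'" for x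
    by (rule L'.hom_eq[OF r(2) ring_hom_trans[OF h'(1) h(1)] _ _ that])
      (auto simp: h h' ring_hom_def)
  ultimately have "bij_betw h (carrier L) (carrier L')"
    using ring_hom_closed[OF h(1)] ring_hom_closed[OF h'(1)]
    by (intro bij_betwI[of _ _ _ h']) auto
  then show ?thesis using h by (auto simp: ring_iso_def)
qed

section \<open>Extending twisted derivations to a localization\<close>

text \<open>\<open>(a, b, c)\<close> stands for the upper triangular matrix with diagonal \<open>a, c\<close> and corner \<open>b\<close>:
  a pair \<open>(\<sigma>, \<delta>)\<close> of an endomorphism and a \<open>\<sigma>\<close>-derivation is the same thing as a homomorphism
  \<open>a \<mapsto> (\<sigma> a, \<delta> a, a)\<close>.\<close>

definition triangular :: "('q, 'm) ring_scheme \<Rightarrow> ('q \<times> 'q \<times> 'q) ring" where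
  "triangular Q = \<lparr>carrier = carrier Q \<times> carrier Q \<times> carrier Q,
    monoid.mult = (\<lambda>(a, b, c) (a', b', c'). (a \<otimes>\<^bsub>Q\<^esub> a', a \<otimes>\<^bsub>Q\<^esub> b' \<oplus>\<^bsub>Q\<^esub> b \<otimes>\<^bsub>Q\<^esub> c', c \<otimes>\<^bsub>Q\<^esub> c')),
    one = (\<one>\<^bsub>Q\<^esub>, \<zero>\<^bsub>Q\<^esub>, \<one>\<^bsub>Q\<^esub>), zero = (\<zero>\<^bsub>Q\<^esub>, \<zero>\<^bsub>Q\<^esub>, \<zero>\<^bsub>Q\<^esub>),
    add = (\<lambda>(a, b, c) (a', b', c'). (a \<oplus>\<^bsub>Q\<^esub> a', b \<oplus>\<^bsub>Q\<^esub> b', c \<oplus>\<^bsub>Q\<^esub> c'))\<rparr>"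

lemma ring_triangular:
  fixes Q (structure)
  assumes "ring Q"
  shows "ring (triangular Q)"
proof -
  interpret Q: ring Q by fact
  have "\<exists>y\<in>carrier (triangular Q). y \<oplus>\<^bsub>triangular Q\<^esub> x = \<zero>\<^bsub>triangular Q\<^esub>"
    if "x \<in> carrier (triangular Q)" for x
    using that
    by (intro bexI[of _ "case x of (a, b, c) \<Rightarrow> (\<ominus> a, \<ominus> b, \<ominus> c)"])
      (auto simp: triangular_def Q.l_neg)
  then show ?thesis
    by (intro ringI abelian_groupI monoidI)
      (auto simp: triangular_def Q.m_assoc Q.a_ac Q.l_distr Q.r_distr)
qed

lemma triangular_Units:
  fixes Q (structure)
  assumes "ring Q" "a \<in> Units Q" "b \<in> carrier Q" "c \<in> Units Q"
  shows "(a, b, c) \<in> Units (triangular Q)"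
proof -
  interpret Q: ring Q by fact
  let ?y = "(inv a, \<ominus> (inv a \<otimes> b \<otimes> inv c), inv c)"
  have c: "a \<in> carrier Q" "c \<in> carrier Q" "inv a \<in> carrier Q" "inv c \<in> carrier Q"
    using assms by auto
  have "a \<otimes> (inv a \<otimes> b \<otimes> inv c) = b \<otimes> inv c"
    using assms c by (simp add: Q.m_assoc[symmetric])
  moreover have "inv a \<otimes> b \<otimes> inv c \<otimes> c = inv a \<otimes> b"
    using assms c by (simp add: Q.m_assoc)
  ultimately have "?y \<otimes>\<^bsub>triangular Q\<^esub> (a, b, c) = \<one>\<^bsub>triangular Q\<^esub>"
    "(a, b, c) \<otimes>\<^bsub>triangular Q\<^esub> ?y = \<one>\<^bsub>triangular Q\<^esub>"
    using assms c by (simp_all add: triangular_def Q.l_minus Q.r_minus Q.l_neg Q.r_neg)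
  moreover have "?y \<in> carrier (triangular Q)" "(a, b, c) \<in> carrier (triangular Q)"
    using assms c by (simp_all add: triangular_def)
  ultimately show ?thesis unfolding Units_def by blast
qed

lemma (in localization) extend_derivation:
  assumes s: "s \<in> ring_hom R R" "\<And>x. x \<in> S \<Longrightarrow> s x \<in> S"
    and d: "\<And>a. a \<in> carrier R \<Longrightarrow> d a \<in> carrier R"
    "\<And>a b. a \<in> carrier R \<Longrightarrow> b \<in> carrier R \<Longrightarrow> d (a \<oplus> b) = d a \<oplus> d b"
    "\<And>a b. a \<in> carrier R \<Longrightarrow> b \<in> carrier R \<Longrightarrow> d (a \<otimes> b) = s a \<otimes> d b \<oplus> d a \<otimes> b"
  shows "\<exists>\<sigma>\<in>ring_hom L L. \<exists>\<delta>\<in>carrier L \<rightarrow> carrier L.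
    (\<forall>x\<in>carrier L. \<forall>y\<in>carrier L. \<delta> (x \<oplus>\<^bsub>L\<^esub> y) = \<delta> x \<oplus>\<^bsub>L\<^esub> \<delta> y) \<and>
    (\<forall>x\<in>carrier L. \<forall>y\<in>carrier L. \<delta> (x \<otimes>\<^bsub>L\<^esub> y) = \<sigma> x \<otimes>\<^bsub>L\<^esub> \<delta> y \<oplus>\<^bsub>L\<^esub> \<delta> x \<otimes>\<^bsub>L\<^esub> y) \<and>
    (\<forall>a\<in>carrier R. \<sigma> (\<phi> a) = \<phi> (s a) \<and> \<delta> (\<phi> a) = \<phi> (d a))"
proof -
  let ?T = "triangular L"
  let ?f = "\<lambda>a. (\<phi> (s a), \<phi> (d a), \<phi> a)"
  have T: "ring ?T" by (rule ring_triangular) (rule L.ring_axioms)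
  have sc: "s a \<in> carrier R" if "a \<in> carrier R" for a using ring_hom_closed[OF s(1)] that .
  have "d \<one> = d \<one> \<oplus> d \<one>" using d(3)[of \<one> \<one>] d(1)[of \<one>] ring_hom_one[OF s(1)] by simp
  then have d1: "d \<one> = \<zero>" using d(1)[of \<one>] by simp
  have "\<phi> \<zero> = \<zero>\<^bsub>L\<^esub>" by (rule ring_hom_zero[OF hom R.ring_axioms L.ring_axioms])
  then have f: "?f \<in> ring_hom R ?T"
    using sc d phi_closed
    by (intro ring_hom_memI) (simp_all add: triangular_def d1 ring_hom_mult[OF hom] ring_hom_add[OF hom]
      ring_hom_one[OF hom] ring_hom_mult[OF s(1)] ring_hom_add[OF s(1)] ring_hom_one[OF s(1)])
  have "?f x \<in> Units ?T" if "x \<in> S" for x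
    using that s(2) d(1) by (intro triangular_Units L.ring_axioms unit phi_closed) (auto simp: S_closed)
  then obtain h where h: "h \<in> ring_hom L ?T" "\<And>a. a \<in> carrier R \<Longrightarrow> h (\<phi> a) = ?f a"
    using hom_exists[OF T f] by blast
  let ?a = "\<lambda>x. fst (h x)" and ?b = "\<lambda>x. fst (snd (h x))" and ?c = "\<lambda>x. snd (snd (h x))"
  have hx: "h x = (?a x, ?b x, ?c x)" for x by simp
  have cl: "?a x \<in> carrier L" "?b x \<in> carrier L" "?c x \<in> carrier L" if "x \<in> carrier L" for x
    using ring_hom_closed[OF h(1) that] by (auto simp: triangular_def)
  have mult: "?a (x \<otimes>\<^bsub>L\<^esub> y) = ?a x \<otimes>\<^bsub>L\<^esub> ?a y"
      "?b (x \<otimes>\<^bsub>L\<^esub> y) = ?a x \<otimes>\<^bsub>L\<^esub> ?b y \<oplus>\<^bsub>L\<^esub> ?b x \<otimes>\<^bsub>L\<^esub> ?c y"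
      "?c (x \<otimes>\<^bsub>L\<^esub> y) = ?c x \<otimes>\<^bsub>L\<^esub> ?c y" if "x \<in> carrier L" "y \<in> carrier L" for x y
    using ring_hom_mult[OF h(1) that] by (auto simp: triangular_def case_prod_beta)
  have add: "?a (x \<oplus>\<^bsub>L\<^esub> y) = ?a x \<oplus>\<^bsub>L\<^esub> ?a y"
      "?b (x \<oplus>\<^bsub>L\<^esub> y) = ?b x \<oplus>\<^bsub>L\<^esub> ?b y"
      "?c (x \<oplus>\<^bsub>L\<^esub> y) = ?c x \<oplus>\<^bsub>L\<^esub> ?c y" if "x \<in> carrier L" "y \<in> carrier L" for x y
    using ring_hom_add[OF h(1) that] by (auto simp: triangular_def case_prod_beta)
  have one: "?a \<one>\<^bsub>L\<^esub> = \<one>\<^bsub>L\<^esub>" "?c \<one>\<^bsub>L\<^esub> = \<one>\<^bsub>L\<^esub>"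
    using ring_hom_one[OF h(1)] by (auto simp: triangular_def)
  have a: "?a \<in> ring_hom L L" and c: "?c \<in> ring_hom L L"
    by (rule ring_hom_memI; use cl mult add one in simp)+
  \<comment> \<open>The last diagonal entry extends the identity of \<open>R\<close>, so uniqueness
    makes it the identity of \<open>L\<close>; the rule for the corner then becomes the twisted
    product rule.\<close>
  have c_id: "?c x = id x" if "x \<in> carrier L" for x
    by (rule hom_eq[OF L.ring_axioms c _ _ that]) (auto simp: h ring_hom_def)
  show ?thesis
    by (intro bexI[of _ ?a] bexI[of _ ?b] conjI ballI a) (use cl mult add c_id h(2) in auto)
qed

section \<open>Ore extensions\<close>

text \<open>Linearity over the field is left out here; it follows later from the behaviour of
  \<sigma> and \<delta> on scalars.\<close>

locale skew_ring = ring C for C (structure) +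
  fixes \<sigma> \<delta>
  assumes sigma: "\<sigma> \<in> ring_hom C C"
    and delta_closed [simp]: "a \<in> carrier C \<Longrightarrow> \<delta> a \<in> carrier C"
    and delta_add: "a \<in> carrier C \<Longrightarrow> b \<in> carrier C \<Longrightarrow> \<delta> (a \<oplus> b) = \<delta> a \<oplus> \<delta> b"
    and delta_mult: "a \<in> carrier C \<Longrightarrow> b \<in> carrier C \<Longrightarrow> \<delta> (a \<otimes> b) = \<sigma> a \<otimes> \<delta> b \<oplus> \<delta> a \<otimes> b"
begin

lemma sigma_closed [simp]: "a \<in> carrier C \<Longrightarrow> \<sigma> a \<in> carrier C"
  using ring_hom_closed[OF sigma] .

lemma sigma_0 [simp]: "\<sigma> \<zero> = \<zero>"
  by (rule ring_hom_zero[OF sigma ring_axioms ring_axioms])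

lemma delta_0 [simp]: "\<delta> \<zero> = \<zero>"
proof -
  have "\<delta> \<zero> \<oplus> \<delta> \<zero> = \<delta> \<zero>" using delta_add[of \<zero> \<zero>] by simp
  then show ?thesis using delta_closed[OF zero_closed] by simp
qed

lemma delta_1 [simp]: "\<delta> \<one> = \<zero>"
proof -
  have "\<delta> \<one> \<oplus> \<delta> \<one> = \<delta> \<one>" using delta_mult[of \<one> \<one>] ring_hom_one[OF sigma] by simp
  then show ?thesis using delta_closed[OF one_closed] by simp
qed

abbreviation T :: "(nat \<Rightarrow> 'a) \<Rightarrow> nat \<Rightarrow> 'a" where
  "T \<equiv> ore_shift C \<sigma> \<delta>"

text \<open>Arbitrary sequences, not only finitely supported ones: \<open>ore_shift\<close> looks at
  two neighbouring coefficients, so its laws need no finiteness.\<close>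

definition coeffs :: "(nat \<Rightarrow> 'a) set" where
  "coeffs = {q. \<forall>k. q k \<in> carrier C}"

definition bounded :: "nat \<Rightarrow> (nat \<Rightarrow> 'a) \<Rightarrow> bool" where
  "bounded N q \<longleftrightarrow> (\<forall>k\<ge>N. q k = \<zero>)"

lemma coeffsD: "q \<in> coeffs \<Longrightarrow> q k \<in> carrier C"
  by (simp add: coeffs_def)

lemma up_iff: "q \<in> up C \<longleftrightarrow> q \<in> coeffs \<and> (\<exists>N. bounded N q)"
proof -
  have "(\<exists>n. bound \<zero> n q) \<longleftrightarrow> (\<exists>N. bounded N q)"
  proof
    assume "\<exists>n. bound \<zero> n q"
    then obtain n where "bound \<zero> n q" ..
    then have "bounded (Suc n) q" by (auto simp: bounded_def bound_def)
    then show "\<exists>N. bounded N q" ..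
  next
    assume "\<exists>N. bounded N q"
    then obtain N where "bounded N q" ..
    then have "bound \<zero> N q" by (auto simp: bounded_def bound_def)
    then show "\<exists>n. bound \<zero> n q" ..
  qed
  then show ?thesis by (auto simp: up_def coeffs_def)
qed

lemma bounded_mono: "bounded N q \<Longrightarrow> N \<le> M \<Longrightarrow> bounded M q"
  by (simp add: bounded_def)

lemma T_0: "q \<in> coeffs \<Longrightarrow> T q 0 = \<delta> (q 0)"
  by (simp add: ore_shift_def coeffsD)

lemma T_Suc: "T q (Suc k) = \<sigma> (q k) \<oplus> \<delta> (q (Suc k))"
  by (simp add: ore_shift_def)

lemma T_coeffs [simp]: "q \<in> coeffs \<Longrightarrow> T q \<in> coeffs"
  by (auto simp: coeffs_def ore_shift_def split: nat.split)

lemma T_pow_coeffs [simp]: "q \<in> coeffs \<Longrightarrow> (T ^^ i) q \<in> coeffs"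
  by (induction i) auto

lemma T_bounded: "bounded N q \<Longrightarrow> bounded (Suc N) (T q)"
  by (auto simp: bounded_def ore_shift_def split: nat.split)

lemma T_pow_bounded: "bounded N q \<Longrightarrow> bounded (N + i) ((T ^^ i) q)"
  by (induction i) (auto simp: T_bounded)

lemma T_add:
  assumes "p \<in> coeffs" "q \<in> coeffs"
  shows "T (\<lambda>k. p k \<oplus> q k) = (\<lambda>k. T p k \<oplus> T q k)"
proof
  fix k
  show "T (\<lambda>k. p k \<oplus> q k) k = T p k \<oplus> T q k"
    using assms by (cases k)
      (simp_all add: ore_shift_def delta_add ring_hom_add[OF sigma] coeffsD a_ac)
qed

text \<open>The rule \<open>\<partial> a = \<sigma>(a) \<partial> + \<delta>(a)\<close>, as an
  identity of operators on sequences.\<close>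

lemma T_smult:
  assumes "a \<in> carrier C" "q \<in> coeffs"
  shows "T (\<lambda>k. a \<otimes> q k) k = \<sigma> a \<otimes> T q k \<oplus> \<delta> a \<otimes> q k"
  using assms by (cases k)
    (simp_all add: ore_shift_def delta_mult ring_hom_mult[OF sigma] coeffsD r_distr a_ac)

lemma add_coeffs [simp]: "p \<in> coeffs \<Longrightarrow> q \<in> coeffs \<Longrightarrow> (\<lambda>k. p k \<oplus> q k) \<in> coeffs"
  by (simp add: coeffs_def)

lemma smult_coeffs [simp]: "a \<in> carrier C \<Longrightarrow> q \<in> coeffs \<Longrightarrow> (\<lambda>k. a \<otimes> q k) \<in> coeffs"
  by (simp add: coeffs_def)

lemma T_pow_add:
  assumes "p \<in> coeffs" "q \<in> coeffs"
  shows "(T ^^ i) (\<lambda>k. p k \<oplus> q k) = (\<lambda>k. (T ^^ i) p k \<oplus> (T ^^ i) q k)"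
  by (induction i) (simp_all add: T_add assms)

text \<open>The product with a fixed range of summation. The true product sums over the support of
  \<open>p\<close>, which changes with \<open>p\<close>; the fixed range allows induction on
  \<open>N\<close>.\<close>

definition mulN :: "nat \<Rightarrow> (nat \<Rightarrow> 'a) \<Rightarrow> (nat \<Rightarrow> 'a) \<Rightarrow> nat \<Rightarrow> 'a" where
  "mulN N p q = (\<lambda>k. \<Oplus>i\<in>{..N}. p i \<otimes> (T ^^ i) q k)"

definition mul :: "(nat \<Rightarrow> 'a) \<Rightarrow> (nat \<Rightarrow> 'a) \<Rightarrow> nat \<Rightarrow> 'a" where
  "mul p q = (\<lambda>k. \<Oplus>i\<in>{i. p i \<noteq> \<zero>}. p i \<otimes> (T ^^ i) q k)"

lemma term_closed [simp]:
  "p \<in> coeffs \<Longrightarrow> q \<in> coeffs \<Longrightarrow> p i \<otimes> (T ^^ i) q k \<in> carrier C"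
  by (simp add: coeffsD)

lemma mulN_coeffs [simp]: "p \<in> coeffs \<Longrightarrow> q \<in> coeffs \<Longrightarrow> mulN N p q \<in> coeffs"
proof -
  assume "p \<in> coeffs" "q \<in> coeffs"
  then have "mulN N p q k \<in> carrier C" for k
    unfolding mulN_def by (intro finsum_closed) auto
  then show ?thesis by (simp add: coeffs_def)
qed

lemma mul_eq_mulN:
  assumes "p \<in> coeffs" "q \<in> coeffs" "bounded (Suc N) p"
  shows "mul p q = mulN N p q"
proof
  fix k
  have "{i. p i \<noteq> \<zero>} \<subseteq> {..N}" using assms(3) by (auto simp: bounded_def not_less_eq_eq[symmetric])
  then show "mul p q k = mulN N p q k"
    unfolding mul_def mulN_def
    by (intro add.finprod_mono_neutral_cong_left) (use assms in \<open>auto simp: coeffsD\<close>)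
qed

lemma mulN_Suc:
  assumes "p \<in> coeffs" "q \<in> coeffs"
  shows "mulN (Suc N) p q = (\<lambda>k. p (Suc N) \<otimes> (T ^^ Suc N) q k \<oplus> mulN N p q k)"
  unfolding mulN_def by (rule ext, rule finsum_Suc) (use assms term_closed in blast)

lemma mulN_0: "p \<in> coeffs \<Longrightarrow> q \<in> coeffs \<Longrightarrow> mulN 0 p q = (\<lambda>k. p 0 \<otimes> q k)"
  by (simp add: mulN_def coeffsD)

lemma mulN_add_left:
  assumes "p \<in> coeffs" "p' \<in> coeffs" "q \<in> coeffs"
  shows "mulN N (\<lambda>k. p k \<oplus> p' k) q = (\<lambda>k. mulN N p q k \<oplus> mulN N p' q k)"
  using assms by (induction N) (simp_all add: mulN_0 mulN_Suc l_distr coeffsD a_ac)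

lemma mulN_add_right:
  assumes "p \<in> coeffs" "q \<in> coeffs" "q' \<in> coeffs"
  shows "mulN N p (\<lambda>k. q k \<oplus> q' k) = (\<lambda>k. mulN N p q k \<oplus> mulN N p q' k)"
  using assms by (induction N) (simp_all add: mulN_0 mulN_Suc r_distr coeffsD a_ac T_pow_add
    T_add del: funpow.simps)

lemma mulN_smult:
  assumes "a \<in> carrier C" "p \<in> coeffs" "q \<in> coeffs"
  shows "mulN N (\<lambda>k. a \<otimes> p k) q = (\<lambda>k. a \<otimes> mulN N p q k)"
  using assms by (induction N) (simp_all add: mulN_0 mulN_Suc r_distr coeffsD m_assoc)

text \<open>Applying \<open>T\<close> termwise and collecting the factor of \<open>T ^^ i\<close>
  gives \<open>\<sigma>(p (i - 1)) + \<delta>(p i)\<close>, which is coefficient \<open>i\<close> of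
  \<open>T p\<close>. The last term overhangs and vanishes as soon as \<open>p N\<close> is
  zero.\<close>

lemma mulN_T_aux:
  assumes "p \<in> coeffs" "q \<in> coeffs"
  shows "T (mulN N p q) k = mulN N (T p) q k \<oplus> \<sigma> (p N) \<otimes> (T ^^ Suc N) q k"
proof (induction N)
  case 0
  show ?case
    using assms by (simp add: mulN_0 T_smult T_0 coeffsD a_ac)
next
  case (Suc N)
  let ?q = "(T ^^ Suc N) q"
  have c: "?q \<in> coeffs" using assms T_pow_coeffs by blast
  have "T (mulN (Suc N) p q) k = T (\<lambda>k. p (Suc N) \<otimes> ?q k) k \<oplus> T (mulN N p q) k"
    using assms c by (simp add: mulN_Suc T_add coeffsD del: funpow.simps)
  also have "\<dots> = \<sigma> (p (Suc N)) \<otimes> T ?q k \<oplus> \<delta> (p (Suc N)) \<otimes> ?q k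
      \<oplus> (mulN N (T p) q k \<oplus> \<sigma> (p N) \<otimes> ?q k)"
    using assms c Suc by (simp add: T_smult coeffsD del: funpow.simps)
  also have "\<dots> = (\<sigma> (p N) \<oplus> \<delta> (p (Suc N))) \<otimes> ?q k \<oplus> mulN N (T p) q k \<oplus> \<sigma> (p (Suc N)) \<otimes> T ?q k"
    using assms c by (simp add: l_distr coeffsD a_ac del: funpow.simps)
  also have "\<dots> = mulN (Suc N) (T p) q k \<oplus> \<sigma> (p (Suc N)) \<otimes> T ?q k"
    using assms c by (simp add: mulN_Suc T_Suc coeffsD a_ac del: funpow.simps)
  finally show ?case by simp
qed

text \<open>Associativity with first factor \<partial>; the general case follows because the product
  is left linear in its first factor.\<close>

lemma mul_T:
  assumes "p \<in> up C" "q \<in> coeffs"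
  shows "mul (T p) q = T (mul p q)"
proof -
  obtain N where N: "p \<in> coeffs" "bounded N p" using assms up_iff by blast
  then have b: "bounded (Suc N) p" "bounded (Suc N) (T p)" "p N = \<zero>"
    using T_bounded bounded_mono by (auto simp: bounded_def)
  show ?thesis
    unfolding mul_eq_mulN[OF N(1) assms(2) b(1)] mul_eq_mulN[OF T_coeffs[OF N(1)] assms(2) b(2)]
    using N b assms(2) by (intro ext) (simp add: mulN_T_aux coeffsD del: funpow.simps)
qed

lemma up_coeffs: "q \<in> up C \<Longrightarrow> q \<in> coeffs"
  by (simp add: up_iff)

lemma T_up [simp]: "q \<in> up C \<Longrightarrow> T q \<in> up C"
  using T_bounded by (auto simp: up_iff)

lemma T_pow_up [simp]: "q \<in> up C \<Longrightarrow> (T ^^ i) q \<in> up C"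
  by (induction i) auto

lemma mul_T_pow:
  assumes "p \<in> up C" "q \<in> coeffs"
  shows "mul ((T ^^ i) p) q = (T ^^ i) (mul p q)"
  by (induction i) (simp_all add: mul_T assms)

lemma mul_coeffs [simp]: "p \<in> up C \<Longrightarrow> q \<in> coeffs \<Longrightarrow> mul p q \<in> coeffs"
proof -
  assume "p \<in> up C" "q \<in> coeffs"
  moreover from this obtain N where "p \<in> coeffs" "bounded N p" using up_iff by blast
  ultimately show ?thesis using mul_eq_mulN[of p q N] bounded_mono[of N p "Suc N"] by simp
qed

lemma mul_up [simp]:
  assumes "p \<in> up C" "q \<in> up C"
  shows "mul p q \<in> up C"
proof -
  obtain N where N: "p \<in> coeffs" "bounded (Suc N) p" using assms(1) up_iff bounded_mono[OF _ le_SucI] by blast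
  obtain M where M: "q \<in> coeffs" "bounded M q" using assms(2) up_iff by blast
  have "bounded (M + N) (mulN N p q)"
    unfolding bounded_def mulN_def
  proof (intro allI impI)
    fix k assume k: "M + N \<le> k"
    have "(T ^^ i) q k = \<zero>" if "i \<le> N" for i
      using T_pow_bounded[OF M(2), of i] k that by (simp add: bounded_def)
    then have "(\<Oplus>i\<in>{..N}. p i \<otimes> (T ^^ i) q k) = (\<Oplus>i\<in>{..N}. \<zero>)"
      using N by (intro finsum_cong') (auto simp: coeffsD)
    then show "(\<Oplus>i\<in>{..N}. p i \<otimes> (T ^^ i) q k) = \<zero>" by simp
  qed
  then show ?thesis
    using mul_eq_mulN[OF N(1) M(1) N(2)] assms M by (auto simp: up_iff)
qed

lemma up_two_bound:
  assumes "p \<in> up C" "q \<in> up C"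
  obtains N where "bounded (Suc N) p" "bounded (Suc N) q"
proof -
  obtain N M where "bounded N p" "bounded M q" using assms up_iff by blast
  then show ?thesis using that[of "max N M"] bounded_mono by (meson le_SucI max.cobounded1 max.cobounded2)
qed

lemma mul_add_left:
  assumes "p \<in> up C" "p' \<in> up C" "q \<in> coeffs"
  shows "mul (\<lambda>k. p k \<oplus> p' k) q = (\<lambda>k. mul p q k \<oplus> mul p' q k)"
proof -
  obtain N where N: "bounded (Suc N) p" "bounded (Suc N) p'" using up_two_bound assms by blast
  then have "bounded (Suc N) (\<lambda>k. p k \<oplus> p' k)" by (simp add: bounded_def)
  then show ?thesis
    using N assms by (simp add: mul_eq_mulN[where N = N] up_coeffs mulN_add_left)
qed

lemma mul_add_right:
  assumes "p \<in> up C" "q \<in> coeffs" "q' \<in> coeffs"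
  shows "mul p (\<lambda>k. q k \<oplus> q' k) = (\<lambda>k. mul p q k \<oplus> mul p q' k)"
proof -
  obtain N where N: "bounded (Suc N) p" using up_two_bound assms by blast
  then show ?thesis
    using assms by (simp add: mul_eq_mulN[where N = N] up_coeffs mulN_add_right)
qed

lemma mul_smult:
  assumes "a \<in> carrier C" "p \<in> up C" "q \<in> coeffs"
  shows "mul (\<lambda>k. a \<otimes> p k) q = (\<lambda>k. a \<otimes> mul p q k)"
proof -
  obtain N where N: "bounded (Suc N) p" using up_two_bound assms by blast
  then have "bounded (Suc N) (\<lambda>k. a \<otimes> p k)" using assms by (simp add: bounded_def)
  then show ?thesis
    using N assms by (simp add: mul_eq_mulN[where N = N] up_coeffs mulN_smult)
qed

lemma smult_up [simp]: "a \<in> carrier C \<Longrightarrow> p \<in> up C \<Longrightarrow> (\<lambda>k. a \<otimes> p k) \<in> up C"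
  by (rule up_smult_closed)

lemma zero_up [simp]: "(\<lambda>k. \<zero>) \<in> up C"
  by (simp add: up_iff coeffs_def bounded_def)

lemma add_up [simp]: "p \<in> up C \<Longrightarrow> q \<in> up C \<Longrightarrow> (\<lambda>k. p k \<oplus> q k) \<in> up C"
  by (rule up_add_closed)

lemma mulN_up [simp]: "p \<in> up C \<Longrightarrow> q \<in> up C \<Longrightarrow> mulN N p q \<in> up C"
  by (induction N) (simp_all add: mulN_0 mulN_Suc up_coeffs coeffsD del: funpow.simps)

lemma mul_mulN:
  assumes "p \<in> up C" "q \<in> up C" "s \<in> coeffs"
  shows "mul (mulN N p q) s = mulN N p (mul q s)"
proof (induction N)
  case 0
  show ?case using assms by (simp add: mulN_0 up_coeffs coeffsD mul_smult)
next
  case (Suc N)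
  have "mul (mulN (Suc N) p q) s
      = mul (\<lambda>k. p (Suc N) \<otimes> (T ^^ Suc N) q k \<oplus> mulN N p q k) s"
    using assms by (simp add: mulN_Suc up_coeffs del: funpow.simps)
  also have "\<dots> = (\<lambda>k. p (Suc N) \<otimes> (T ^^ Suc N) (mul q s) k \<oplus> mulN N p (mul q s) k)"
    using assms Suc by (simp add: mul_add_left mul_smult mul_T_pow up_coeffs coeffsD del: funpow.simps)
  finally show ?case using assms by (simp add: mulN_Suc up_coeffs del: funpow.simps)
qed

lemma mul_assoc:
  assumes "p \<in> up C" "q \<in> up C" "s \<in> up C"
  shows "mul (mul p q) s = mul p (mul q s)"
proof -
  obtain N where N: "bounded (Suc N) p" using up_two_bound[OF assms(1,1)] by blast
  note c = up_coeffs[OF assms(1)] up_coeffs[OF assms(2)] up_coeffs[OF assms(3)]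
  have "mul (mul p q) s = mul (mulN N p q) s" by (simp only: mul_eq_mulN[OF c(1,2) N])
  also have "\<dots> = mulN N p (mul q s)" using mul_mulN[OF assms(1,2) c(3)] .
  also have "\<dots> = mul p (mul q s)"
    using mul_eq_mulN[OF c(1) mul_coeffs[OF assms(2) c(3)] N] by simp
  finally show ?thesis .
qed

section \<open>Monomials and the ring structure of the Ore extension\<close>

definition cmon :: "'a \<Rightarrow> nat \<Rightarrow> nat \<Rightarrow> 'a" where
  "cmon a i = (\<lambda>k. if k = i then a else \<zero>)"

lemma cmon_up [simp]: "a \<in> carrier C \<Longrightarrow> cmon a i \<in> up C"
  unfolding up_iff
  by (intro conjI exI[of _ "Suc i"]) (auto simp: coeffs_def bounded_def cmon_def)

lemma mul_cmon:
  assumes "a \<in> carrier C" "q \<in> coeffs"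
  shows "mul (cmon a i) q = (\<lambda>k. a \<otimes> (T ^^ i) q k)"
proof
  fix k
  have c: "(T ^^ i) q k \<in> carrier C" using assms by (simp add: coeffsD)
  show "mul (cmon a i) q k = a \<otimes> (T ^^ i) q k"
  proof (cases "a = \<zero>")
    case True
    then show ?thesis using c by (simp add: mul_def cmon_def)
  next
    case False
    then have "{j. cmon a i j \<noteq> \<zero>} = {i}" by (auto simp: cmon_def)
    then show ?thesis using assms(1) c unfolding mul_def by (simp add: cmon_def)
  qed
qed

lemma T_cmon: "T (cmon \<one> i) = cmon \<one> (Suc i)"
proof
  fix k show "T (cmon \<one> i) k = cmon \<one> (Suc i) k"
    by (cases k) (auto simp: ore_shift_def cmon_def ring_hom_one[OF sigma])
qed

lemma T_pow_cmon: "(T ^^ i) (cmon \<one> 0) = cmon \<one> i"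
  by (induction i) (simp_all add: T_cmon)

lemma mul_one: "q \<in> up C \<Longrightarrow> mul q (cmon \<one> 0) = q"
proof
  fix k assume q: "q \<in> up C"
  obtain M where M: "bounded (Suc M) q" using up_two_bound[OF q q] by blast
  then have N: "bounded (Suc (max M k)) q" "k \<le> max M k"
    using bounded_mono[OF M, of "Suc (max M k)"] by simp_all
  \<comment> \<open>The range must contain the index \<open>k\<close>, where the only nonzero
    summand can occur, as well as the support of \<open>q\<close>.\<close>
  define N where "N = max M k"
  note N = N[folded N_def]
  have "mul q (cmon \<one> 0) k = (\<Oplus>i\<in>{..N}. q i \<otimes> cmon \<one> i k)"
    using q N by (simp add: mul_eq_mulN[where N = N] up_coeffs mulN_def T_pow_cmon)
  also have "\<dots> = (\<Oplus>i\<in>{..N}. if k = i then q i else \<zero>)"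
    using q by (intro finsum_cong') (auto simp: cmon_def coeffsD up_coeffs)
  also have "\<dots> = q k"
    using q N by (intro finsum_singleton) (auto simp: coeffsD up_coeffs)
  finally show "mul q (cmon \<one> 0) k = q k" .
qed

lemma ore_ext_simps:
  "carrier (ore_ext C \<sigma> \<delta>) = up C"
  "p \<otimes>\<^bsub>ore_ext C \<sigma> \<delta>\<^esub> q = mul p q"
  "\<one>\<^bsub>ore_ext C \<sigma> \<delta>\<^esub> = cmon \<one> 0"
  "\<zero>\<^bsub>ore_ext C \<sigma> \<delta>\<^esub> = (\<lambda>k. \<zero>)"
  "p \<in> up C \<Longrightarrow> q \<in> up C \<Longrightarrow> p \<oplus>\<^bsub>ore_ext C \<sigma> \<delta>\<^esub> q = (\<lambda>k. p k \<oplus> q k)"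
  by (simp_all add: ore_ext_def UP_def mul_def cmon_def)

lemma ore_const_cmon: "a \<in> carrier C \<Longrightarrow> ore_const C a = cmon a 0"
  by (simp add: ore_const_def UP_def cmon_def)

lemma ore_var_cmon: "ore_var C = cmon \<one> 1"
  by (simp add: ore_var_def UP_def cmon_def)

lemma ring_ore_ext: "ring (ore_ext C \<sigma> \<delta>)"
proof (rule ringI)
  show "abelian_group (ore_ext C \<sigma> \<delta>)"
  proof (rule abelian_groupI)
    show "\<exists>y\<in>carrier (ore_ext C \<sigma> \<delta>). y \<oplus>\<^bsub>ore_ext C \<sigma> \<delta>\<^esub> p = \<zero>\<^bsub>ore_ext C \<sigma> \<delta>\<^esub>"
      if "p \<in> carrier (ore_ext C \<sigma> \<delta>)" for p
      using that up_a_inv_closed[of p]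
      by (intro bexI[of _ "\<lambda>i. \<ominus> p i"]) (simp_all add: ore_ext_simps l_neg coeffsD up_coeffs)
  qed (simp_all add: ore_ext_simps up_coeffs coeffsD a_ac)
  show "monoid (ore_ext C \<sigma> \<delta>)"
    by (rule monoidI)
      (simp_all add: ore_ext_simps mul_assoc mul_one mul_cmon up_coeffs coeffsD)
qed (simp_all add: ore_ext_simps mul_add_left mul_add_right up_coeffs)

lemma const_hom: "ore_const C \<in> ring_hom C (ore_ext C \<sigma> \<delta>)"
proof (rule ring_hom_memI)
  fix a b assume ab: "a \<in> carrier C" "b \<in> carrier C"
  show "ore_const C (a \<otimes> b) = ore_const C a \<otimes>\<^bsub>ore_ext C \<sigma> \<delta>\<^esub> ore_const C b"
    using ab by (simp add: ore_const_cmon ore_ext_simps mul_cmon up_coeffs) (auto simp: cmon_def)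
  show "ore_const C (a \<oplus> b) = ore_const C a \<oplus>\<^bsub>ore_ext C \<sigma> \<delta>\<^esub> ore_const C b"
    using ab by (simp add: ore_const_cmon ore_ext_simps) (auto simp: cmon_def)
qed (simp_all add: ore_const_cmon ore_ext_simps)

end

section \<open>The localization\<close>

context galg_pbw
begin

abbreviation Alg :: "'k ncpoly set ring" where
  "Alg \<equiv> galg m c d"

abbreviation cls :: "'k ncpoly \<Rightarrow> 'k ncpoly set" where
  "cls \<equiv> galg_class m c d"

lemma ring_Alg: "ring Alg"
  unfolding galg_def galg_ideal_eq by (rule ideal.quotient_is_ring[OF ideal_J])

lemma cls_image: "cls f = (\<lambda>h. h + f) ` I"
  by (auto simp: galg_class_def galg_ideal_eq a_r_coset_def r_coset_def free_algebra_def)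

lemma cls_hom: "cls \<in> ring_hom (free_algebra m) Alg"
  using ideal.rcos_ring_hom[OF ideal_J]
  by (simp add: galg_class_def[abs_def] galg_def galg_ideal_eq)

lemma cls_simps:
  shows cls_closed: "f \<in> fa m \<Longrightarrow> cls f \<in> carrier Alg"
    and cls_mult: "f \<in> fa m \<Longrightarrow> g \<in> fa m \<Longrightarrow> cls (f * g) = cls f \<otimes>\<^bsub>Alg\<^esub> cls g"
    and cls_add: "f \<in> fa m \<Longrightarrow> g \<in> fa m \<Longrightarrow> cls (f + g) = cls f \<oplus>\<^bsub>Alg\<^esub> cls g"
    and cls_one: "cls 1 = \<one>\<^bsub>Alg\<^esub>"
proof -
  note h = ring_hom_closed[OF cls_hom] ring_hom_mult[OF cls_hom] ring_hom_add[OF cls_hom] ring_hom_one[OF cls_hom]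
  show "f \<in> fa m \<Longrightarrow> cls f \<in> carrier Alg"
    "f \<in> fa m \<Longrightarrow> g \<in> fa m \<Longrightarrow> cls (f * g) = cls f \<otimes>\<^bsub>Alg\<^esub> cls g"
    "f \<in> fa m \<Longrightarrow> g \<in> fa m \<Longrightarrow> cls (f + g) = cls f \<oplus>\<^bsub>Alg\<^esub> cls g"
    "cls 1 = \<one>\<^bsub>Alg\<^esub>"
    using h[unfolded carrier_free_algebra] by (simp_all add: free_algebra_def)
qed

lemma cls_eq_iff:
  assumes "f \<in> fa m" "g \<in> fa m"
  shows "cls f = cls g \<longleftrightarrow> nf f = nf g"
proof -
  have "cls f = cls g \<longleftrightarrow> f - g \<in> I"
  proof
    assume "cls f = cls g"
    moreover have "f \<in> cls f" unfolding cls_image using J.zero by (intro image_eqI[of _ _ 0]) simp_all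
    ultimately have "f \<in> (\<lambda>h. h + g) ` I" by (simp add: cls_image)
    then show "f - g \<in> I" by auto
  next
    assume fg: "f - g \<in> I"
    have 1: "h + f \<in> (\<lambda>h. h + g) ` I" if "h \<in> I" for h
      using J_add[OF fg that] by (intro image_eqI[of _ _ "h + (f - g)"]) simp_all
    have 2: "h + g \<in> (\<lambda>h. h + f) ` I" if "h \<in> I" for h
      using J_diff[OF that fg] by (intro image_eqI[of _ _ "h - (f - g)"]) simp_all
    show "cls f = cls g" unfolding cls_image using 1 2 by auto
  qed
  then show ?thesis using nf_cong_iff assms by simp
qed

lemma cls_zero: "\<zero>\<^bsub>Alg\<^esub> = cls 0"
  unfolding cls_image by (simp add: galg_def FactRing_def galg_ideal_eq)

lemma cls_zero_iff: "f \<in> fa m \<Longrightarrow> cls f = \<zero>\<^bsub>Alg\<^esub> \<longleftrightarrow> nf f = 0"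
  unfolding cls_zero by (simp add: cls_eq_iff)

lemma carrier_Alg: "carrier Alg = cls ` fa m"
  unfolding galg_def galg_class_def FactRing_def
  by (auto simp: A_RCOSETS_def RCOSETS_def a_r_coset_def carrier_free_algebra[symmetric])

definition rep :: "'k ncpoly set \<Rightarrow> 'k ncpoly" where
  "rep X = (SOME f. f \<in> fa m \<and> cls f = X)"

lemma rep:
  assumes "X \<in> carrier Alg"
  shows "rep X \<in> fa m" "cls (rep X) = X"
proof -
  have "\<exists>f. f \<in> fa m \<and> cls f = X" using assms by (auto simp: carrier_Alg)
  then have "rep X \<in> fa m \<and> cls (rep X) = X" unfolding rep_def by (rule someI_ex)
  then show "rep X \<in> fa m" "cls (rep X) = X" by auto
qed

lemma nf_rep_cls: "f \<in> fa m \<Longrightarrow> nf (rep (cls f)) = nf f"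
  using rep[of "cls f"] cls_closed cls_eq_iff by simp

lemma nonzero_submonoid: "submonoid (carrier Alg - {\<zero>\<^bsub>Alg\<^esub>}) Alg"
proof
  interpret Q: ring Alg by (rule ring_Alg)
  show "carrier Alg - {\<zero>\<^bsub>Alg\<^esub>} \<subseteq> carrier Alg" by blast
  show "\<one>\<^bsub>Alg\<^esub> \<in> carrier Alg - {\<zero>\<^bsub>Alg\<^esub>}"
    using cls_zero_iff[of 1] by (simp add: cls_one)
  fix X Y assume XY: "X \<in> carrier Alg - {\<zero>\<^bsub>Alg\<^esub>}" "Y \<in> carrier Alg - {\<zero>\<^bsub>Alg\<^esub>}"
  then obtain f g where fg: "f \<in> fa m" "g \<in> fa m" "X = cls f" "Y = cls g"
    by (auto simp: carrier_Alg)
  then have "nf f \<noteq> 0" "nf g \<noteq> 0" using XY cls_zero_iff by auto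
  then have "nf (f * g) \<noteq> 0" using nf_mult_nonzero fg by blast
  then show "X \<otimes>\<^bsub>Alg\<^esub> Y \<in> carrier Alg - {\<zero>\<^bsub>Alg\<^esub>}"
    using fg cls_zero_iff[of "f * g"] by (simp add: cls_mult cls_closed)
qed

end

section \<open>The denominators and the maps induced on the ring of fractions\<close>

context galg_ext
begin

definition denoms :: "'k ncpoly set set" where
  "denoms = galg_incl (Suc n) c d ` (carrier B.Alg - {\<zero>\<^bsub>B.Alg\<^esub>})"

text \<open>The ideal of B is absorbed by that of A, so the sum of cosets is the coset of
  \<open>b\<close> in A.\<close>

lemma incl_cls: "galg_incl (Suc n) c d (B.cls b) = A.cls b"
proof -
  have "galg_incl (Suc n) c d (B.cls b) = (\<Union>x\<in>A.I. \<Union>y\<in>B.cls b. {x + y})"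
    by (simp add: galg_incl_def A.galg_ideal_eq set_add_def set_mult_def free_algebra_def)
  also have "\<dots> = (\<lambda>h. h + b) ` A.I"
  proof (intro equalityI subsetI)
    fix z assume "z \<in> (\<Union>x\<in>A.I. \<Union>y\<in>B.cls b. {x + y})"
    then obtain x h where z: "z = x + (h + b)" "x \<in> A.I" "h \<in> B.I" unfolding B.cls_image by blast
    have "h + x \<in> A.I" by (rule A.J_add[OF z(2) I_subset[OF z(3)]])
    then show "z \<in> (\<lambda>h. h + b) ` A.I"
      by (intro image_eqI[of _ _ "h + x"]) (simp_all add: z(1) ac_simps)
  next
    fix z assume "z \<in> (\<lambda>h. h + b) ` A.I"
    then obtain x where x: "z = x + b" "x \<in> A.I" by blast
    have "b \<in> B.cls b" unfolding B.cls_image by (intro image_eqI[of _ _ 0]) (simp_all add: B.J.zero)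
    then show "z \<in> (\<Union>x\<in>A.I. \<Union>y\<in>B.cls b. {x + y})" using x by blast
  qed
  finally show ?thesis by (simp add: A.cls_image)
qed

lemma denoms_eq: "denoms = {A.cls b | b. b \<in> fa n \<and> B.nf b \<noteq> 0}"
proof -
  have eq: "carrier B.Alg - {\<zero>\<^bsub>B.Alg\<^esub>} = B.cls ` {b \<in> fa n. B.nf b \<noteq> 0}"
    unfolding B.carrier_Alg using B.cls_zero_iff by auto
  show ?thesis unfolding denoms_def eq image_image incl_cls by blast
qed

lemma denomsI: "b \<in> fa n \<Longrightarrow> B.nf b \<noteq> 0 \<Longrightarrow> A.cls b \<in> denoms"
  by (auto simp: denoms_eq)

lemma denoms_submonoid: "submonoid denoms A.Alg"
proof
  show "denoms \<subseteq> carrier A.Alg" by (auto simp: denoms_eq A.cls_closed)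
  show "\<one>\<^bsub>A.Alg\<^esub> \<in> denoms" using denomsI[of 1] by (simp add: A.cls_one)
  fix X Y assume "X \<in> denoms" "Y \<in> denoms"
  then obtain f g where fg: "f \<in> fa n" "B.nf f \<noteq> 0" "X = A.cls f" "g \<in> fa n" "B.nf g \<noteq> 0" "Y = A.cls g"
    by (auto simp: denoms_eq)
  then have "A.cls (f * g) \<in> denoms" by (intro denomsI fa_mult B.nf_mult_nonzero)
  then show "X \<otimes>\<^bsub>A.Alg\<^esub> Y \<in> denoms" using fg by (simp add: A.cls_mult)
qed

lemma denoms_ore_set: "ore_set A.Alg denoms"
  unfolding ore_set_def
proof (intro conjI ballI)
  show "submonoid denoms A.Alg" by (rule denoms_submonoid)
  show "\<zero>\<^bsub>A.Alg\<^esub> \<notin> denoms"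
  proof
    assume "\<zero>\<^bsub>A.Alg\<^esub> \<in> denoms"
    then obtain b where b: "b \<in> fa n" "B.nf b \<noteq> 0" "A.cls b = \<zero>\<^bsub>A.Alg\<^esub>" by (auto simp: denoms_eq)
    then have "A.nf b = 0" using A.cls_zero_iff[of b] by simp
    then show False using b nf_eq by simp
  qed
  fix X Y assume XY: "X \<in> denoms" "Y \<in> carrier A.Alg"
  obtain s where s: "s \<in> fa n" "B.nf s \<noteq> 0" "X = A.cls s" using XY(1) by (auto simp: denoms_eq)
  obtain a where a: "a \<in> fa (Suc n)" "Y = A.cls a" using XY(2) by (auto simp: A.carrier_Alg)
  obtain t f where t: "t \<in> fa n" "f \<in> fa (Suc n)" "B.nf t \<noteq> 0" "A.nf (a * t) = A.nf (s * f)"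
    using right_fractionE[OF right_fraction[OF a(1)] s(1,2)] .
  have "A.cls (a * t) = A.cls (s * f)" using t a s by (subst A.cls_eq_iff) simp_all
  then have "Y \<otimes>\<^bsub>A.Alg\<^esub> A.cls t = X \<otimes>\<^bsub>A.Alg\<^esub> A.cls f"
    using t(1,2) a s by (simp add: A.cls_mult)
  then show "\<exists>s2\<in>denoms. \<exists>a2\<in>carrier A.Alg. Y \<otimes>\<^bsub>A.Alg\<^esub> s2 = X \<otimes>\<^bsub>A.Alg\<^esub> a2"
    using denomsI[OF t(1,3)] A.cls_closed[OF t(2)] by blast
qed

text \<open>\<open>sg\<close> and \<open>dl\<close> descend from polynomials to classes, where
  \<open>extend_derivation\<close> carries them over to fractions.\<close>

lemma derivation_of_quot_ring:
  fixes Q :: "'q ring"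
  assumes Q: "quot_ring B.Alg Q \<psi>"
  shows "\<exists>\<sigma> \<delta>. skew_ring Q \<sigma> \<delta> \<and>
    (\<forall>b\<in>fa n. \<sigma> (\<psi> (B.cls b)) = \<psi> (B.cls (sg b)) \<and> \<delta> (\<psi> (B.cls b)) = \<psi> (B.cls (dl b)))"
proof -
  let ?S = "carrier B.Alg - {\<zero>\<^bsub>B.Alg\<^esub>}"
  have loc: "ore_localization B.Alg ?S Q \<psi>" using Q by (simp add: quot_ring_def)
  then have rQ: "ring Q" by (simp add: ore_localization_def)
  interpret BQ: localization B.Alg ?S Q \<psi>
    using loc rQ B.ring_Alg B.nonzero_submonoid by (simp add: localization_def localization_axioms_def)
  \<comment> \<open>The choice of representative is harmless, since \<open>sg\<close> and
    \<open>dl\<close> depend only on the normal form.\<close>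
  let ?s = "\<lambda>X. B.cls (sg (B.rep X))" and ?d = "\<lambda>X. B.cls (dl (B.rep X))"
  have sd: "?s (B.cls b) = B.cls (sg b)" "?d (B.cls b) = B.cls (dl b)" if "b \<in> fa n" for b
    using sg_cong[of "B.rep (B.cls b)" b] dl_cong[of "B.rep (B.cls b)" b] that
      B.rep[OF B.cls_closed[OF that]] B.nf_rep_cls[OF that] by simp_all
  have eq_nf: "B.cls (B.nf b) = B.cls b" if "b \<in> fa n" for b
    using that B.nf_fa by (simp add: B.cls_eq_iff)
  have sg_hom: "?s \<in> ring_hom B.Alg B.Alg"
  proof (rule ring_hom_memI)
    fix X Y assume "X \<in> carrier B.Alg" "Y \<in> carrier B.Alg"
    then obtain f g where fg: "f \<in> fa n" "g \<in> fa n" "X = B.cls f" "Y = B.cls g"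
      by (auto simp: B.carrier_Alg)
    show "?s X \<in> carrier B.Alg" using fg by (simp add: sd B.cls_closed)
    have "f * g \<in> fa n" "f + g \<in> fa n" using fg by simp_all
    note sd' = sd(1)[OF fg(1)] sd(1)[OF fg(2)] sd(1)[OF this(1)] sd(1)[OF this(2)]
    show "?s (X \<otimes>\<^bsub>B.Alg\<^esub> Y) = ?s X \<otimes>\<^bsub>B.Alg\<^esub> ?s Y"
      unfolding fg(3,4) B.cls_mult[OF fg(1,2), symmetric] sd'
      using fg(1,2) by (simp add: sg_mult eq_nf B.cls_mult)
    show "?s (X \<oplus>\<^bsub>B.Alg\<^esub> Y) = ?s X \<oplus>\<^bsub>B.Alg\<^esub> ?s Y"
      unfolding fg(3,4) B.cls_add[OF fg(1,2), symmetric] sd'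
      using fg(1,2) by (simp add: sg_add B.cls_add)
  next
    show "?s \<one>\<^bsub>B.Alg\<^esub> = \<one>\<^bsub>B.Alg\<^esub>" using sd(1)[of 1] sg_scal[of 1] by (simp add: B.cls_one)
  qed
  \<comment> \<open>Injectivity of the twist enters here: denominators must be sent to
    denominators.\<close>
  have sS: "?s X \<in> carrier B.Alg - {\<zero>\<^bsub>B.Alg\<^esub>}" if X: "X \<in> ?S" for X
  proof -
    obtain f where f: "f \<in> fa n" "X = B.cls f" using X by (auto simp: B.carrier_Alg)
    then have "B.nf f \<noteq> 0" using X B.cls_zero_iff by auto
    then have "B.cls (sg f) \<noteq> \<zero>\<^bsub>B.Alg\<^esub>"
      using sg_nonzero[OF f(1)] B.cls_zero_iff[OF sg_fa[OF f(1)]] by blast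
    then show ?thesis unfolding f(2) sd(1)[OF f(1)] using B.cls_closed[OF sg_fa[OF f(1)]] by blast
  qed
  have d_closed: "?d X \<in> carrier B.Alg" if "X \<in> carrier B.Alg" for X
    using that B.rep by (simp add: B.cls_closed)
  have d_add: "?d (X \<oplus>\<^bsub>B.Alg\<^esub> Y) = ?d X \<oplus>\<^bsub>B.Alg\<^esub> ?d Y"
    and d_mult: "?d (X \<otimes>\<^bsub>B.Alg\<^esub> Y) = ?s X \<otimes>\<^bsub>B.Alg\<^esub> ?d Y \<oplus>\<^bsub>B.Alg\<^esub> ?d X \<otimes>\<^bsub>B.Alg\<^esub> Y"
    if XY: "X \<in> carrier B.Alg" "Y \<in> carrier B.Alg" for X Y
  proof -
    obtain f g where fg: "f \<in> fa n" "g \<in> fa n" "X = B.cls f" "Y = B.cls g"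
      using XY by (auto simp: B.carrier_Alg)
    have "f * g \<in> fa n" "f + g \<in> fa n" using fg by simp_all
    note sd' = sd(1)[OF fg(1)] sd(2)[OF fg(1)] sd(2)[OF fg(2)] sd(2)[OF this(1)] sd(2)[OF this(2)]
    show "?d (X \<oplus>\<^bsub>B.Alg\<^esub> Y) = ?d X \<oplus>\<^bsub>B.Alg\<^esub> ?d Y"
      unfolding fg(3,4) B.cls_add[OF fg(1,2), symmetric] sd'
      using fg(1,2) by (simp add: dl_add B.cls_add)
    show "?d (X \<otimes>\<^bsub>B.Alg\<^esub> Y) = ?s X \<otimes>\<^bsub>B.Alg\<^esub> ?d Y \<oplus>\<^bsub>B.Alg\<^esub> ?d X \<otimes>\<^bsub>B.Alg\<^esub> Y"
      unfolding fg(3,4) B.cls_mult[OF fg(1,2), symmetric] sd'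
      using fg(1,2) by (simp add: dl_mult eq_nf B.cls_add B.cls_mult)
  qed
  from BQ.extend_derivation[OF sg_hom sS d_closed d_add d_mult]
  obtain \<sigma> \<delta> where *: "\<sigma> \<in> ring_hom Q Q" "\<delta> \<in> carrier Q \<rightarrow> carrier Q"
    "\<forall>x\<in>carrier Q. \<forall>y\<in>carrier Q. \<delta> (x \<oplus>\<^bsub>Q\<^esub> y) = \<delta> x \<oplus>\<^bsub>Q\<^esub> \<delta> y"
    "\<forall>x\<in>carrier Q. \<forall>y\<in>carrier Q. \<delta> (x \<otimes>\<^bsub>Q\<^esub> y) = \<sigma> x \<otimes>\<^bsub>Q\<^esub> \<delta> y \<oplus>\<^bsub>Q\<^esub> \<delta> x \<otimes>\<^bsub>Q\<^esub> y"
    "\<forall>X\<in>carrier B.Alg. \<sigma> (\<psi> X) = \<psi> (?s X) \<and> \<delta> (\<psi> X) = \<psi> (?d X)"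
    by blast
  have "skew_ring Q \<sigma> \<delta>"
    using * rQ by (auto simp: skew_ring_def skew_ring_axioms_def)
  moreover have "\<forall>b\<in>fa n. \<sigma> (\<psi> (B.cls b)) = \<psi> (B.cls (sg b)) \<and> \<delta> (\<psi> (B.cls b)) = \<psi> (B.cls (dl b))"
    using *(5) sd B.cls_closed by simp
  ultimately show ?thesis by blast
qed

end

section \<open>The embedding of A into the Ore extension\<close>

locale galg_ore_ext = galg_ext n c d r r' + Q: skew_ring Q \<sigma> \<delta>
  for n :: nat and c :: "nat \<Rightarrow> nat \<Rightarrow> 'k::field" and d :: "nat \<Rightarrow> nat \<Rightarrow> 'k cpoly"
    and r r' :: "monomial rel" and Q :: "'q ring" (structure) and \<sigma> \<delta> +
  fixes \<psi> :: "'k ncpoly set \<Rightarrow> 'q"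
  assumes quot: "ore_localization B.Alg (carrier B.Alg - {\<zero>\<^bsub>B.Alg\<^esub>}) Q \<psi>"
    and sigma_psi: "b \<in> fa n \<Longrightarrow> \<sigma> (\<psi> (B.cls b)) = \<psi> (B.cls (sg b))"
    and delta_psi: "b \<in> fa n \<Longrightarrow> \<delta> (\<psi> (B.cls b)) = \<psi> (B.cls (dl b))"
begin

sublocale BQ: localization B.Alg "carrier B.Alg - {\<zero>\<^bsub>B.Alg\<^esub>}" Q \<psi>
  using quot Q.ring_axioms B.ring_Alg B.nonzero_submonoid
  by (simp add: localization_def localization_axioms_def)

abbreviation E :: "(nat \<Rightarrow> 'q) ring" where
  "E \<equiv> ore_ext Q \<sigma> \<delta>"

definition ps :: "'k ncpoly \<Rightarrow> 'q" where
  "ps b = \<psi> (B.cls b)"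

lemma ps_closed [simp]: "b \<in> fa n \<Longrightarrow> ps b \<in> carrier Q"
  by (simp add: ps_def BQ.phi_closed B.cls_closed)

lemma ps_mult: "a \<in> fa n \<Longrightarrow> b \<in> fa n \<Longrightarrow> ps (a * b) = ps a \<otimes> ps b"
  by (simp add: ps_def B.cls_mult ring_hom_mult[OF BQ.hom] B.cls_closed)

lemma ps_add: "a \<in> fa n \<Longrightarrow> b \<in> fa n \<Longrightarrow> ps (a + b) = ps a \<oplus> ps b"
  by (simp add: ps_def B.cls_add ring_hom_add[OF BQ.hom] B.cls_closed)

lemma ps_one [simp]: "ps 1 = \<one>"
  by (simp add: ps_def B.cls_one ring_hom_one[OF BQ.hom])

lemma ps_zero [simp]: "ps 0 = \<zero>"
  unfolding ps_def B.cls_zero[symmetric]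
  by (rule ring_hom_zero[OF BQ.hom B.ring_Alg Q.ring_axioms])

lemma ps_eq_iff: "a \<in> fa n \<Longrightarrow> b \<in> fa n \<Longrightarrow> ps a = ps b \<longleftrightarrow> B.nf a = B.nf b"
  unfolding ps_def using inj_on_eq_iff[OF BQ.inj] B.cls_closed B.cls_eq_iff by simp

lemma ps_nf [simp]: "b \<in> fa n \<Longrightarrow> ps (B.nf b) = ps b"
  by (simp add: ps_eq_iff B.nf_fa)

lemma ps_unit: "b \<in> fa n \<Longrightarrow> B.nf b \<noteq> 0 \<Longrightarrow> ps b \<in> Units Q"
  unfolding ps_def using B.cls_zero_iff B.cls_closed by (intro BQ.unit) auto

lemma ps_fraction:
  assumes "x \<in> carrier Q"
  shows "\<exists>s\<in>fa n. \<exists>b\<in>fa n. B.nf s \<noteq> 0 \<and> ps s \<otimes> x = ps b"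
proof -
  obtain X Y where XY: "X \<in> carrier B.Alg - {\<zero>\<^bsub>B.Alg\<^esub>}" "Y \<in> carrier B.Alg"
      "\<psi> X \<otimes> x = \<psi> Y"
    using BQ.fraction[OF assms] by blast
  then obtain s b where sb: "s \<in> fa n" "X = B.cls s" "b \<in> fa n" "Y = B.cls b"
    by (auto simp: B.carrier_Alg)
  then have "B.nf s \<noteq> 0" using XY(1) B.cls_zero_iff by auto
  then show ?thesis using sb XY(3) unfolding ps_def by blast
qed

text \<open>The left Ore condition of B, obtained from the given ring of fractions.\<close>

lemma ps_left_ore:
  assumes "a \<in> fa n" "s \<in> fa n" "B.nf s \<noteq> 0"
  shows "\<exists>u\<in>fa n. \<exists>v\<in>fa n. B.nf u \<noteq> 0 \<and> B.nf (u * a) = B.nf (v * s)"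
proof -
  have "B.cls s \<in> carrier B.Alg - {\<zero>\<^bsub>B.Alg\<^esub>}" using assms B.cls_zero_iff B.cls_closed by auto
  then obtain X Y where XY: "X \<in> carrier B.Alg - {\<zero>\<^bsub>B.Alg\<^esub>}" "Y \<in> carrier B.Alg"
      "X \<otimes>\<^bsub>B.Alg\<^esub> B.cls a = Y \<otimes>\<^bsub>B.Alg\<^esub> B.cls s"
    using BQ.left_ore[OF B.cls_closed[OF assms(1)]] by blast
  then obtain u v where uv: "u \<in> fa n" "X = B.cls u" "v \<in> fa n" "Y = B.cls v"
    by (auto simp: B.carrier_Alg)
  then have "B.nf u \<noteq> 0" using XY(1) B.cls_zero_iff by auto
  moreover have "B.cls (u * a) = B.cls (v * s)" using XY(3) uv assms by (simp add: B.cls_mult)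
  then have "B.nf (u * a) = B.nf (v * s)" using uv assms B.cls_eq_iff by simp
  ultimately show ?thesis using uv by blast
qed

definition phi :: "'k ncpoly \<Rightarrow> nat \<Rightarrow> 'q" where
  "phi f = (\<lambda>i. ps (coef i f))"

lemma phi_up [simp]: "f \<in> fa (Suc n) \<Longrightarrow> phi f \<in> up Q"
proof -
  assume f: "f \<in> fa (Suc n)"
  obtain N where "\<forall>i>N. coef i f = 0" using coef_bounded[OF f] by blast
  then have "bound \<zero> N (phi f)" by (intro bound.intro) (simp add: phi_def)
  then show "phi f \<in> up Q" using f coef_fa by (intro mem_upI) (auto simp: phi_def)
qed

lemma phi_coeffs [simp]: "f \<in> fa (Suc n) \<Longrightarrow> phi f \<in> Q.coeffs"
  by (simp add: Q.up_coeffs)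

lemma phi_add: "f \<in> fa (Suc n) \<Longrightarrow> g \<in> fa (Suc n) \<Longrightarrow> phi (f + g) = (\<lambda>k. phi f k \<oplus> phi g k)"
  using coef_fa by (simp add: phi_def coef_add ps_add)

lemma phi_cong: "A.nf f = A.nf g \<Longrightarrow> phi f = phi g"
  by (simp add: phi_def)

lemma phi_mono: "b \<in> fa n \<Longrightarrow> phi (b * D ^ i) = Q.cmon (ps b) i"
  by (auto simp: phi_def coef_mono Q.cmon_def)

lemma phi_const: "b \<in> fa n \<Longrightarrow> phi b = Q.cmon (ps b) 0"
  using phi_mono[of b 0] by simp

text \<open>B embeds into its ring of fractions, so equal images force equal coefficients in B, and
  \<open>coef_zero\<close> applies to the difference.\<close>

lemma phi_inj:
  assumes "f \<in> fa (Suc n)" "g \<in> fa (Suc n)" "phi f = phi g"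
  shows "A.nf f = A.nf g"
proof -
  have fg: "f - g \<in> fa (Suc n)" using assms by simp
  have "coef i (f - g) = 0" for i
  proof -
    have "coef i f = coef i g"
      using fun_cong[OF assms(3), of i] coef_fa[OF assms(1), of i] coef_fa[OF assms(2), of i]
      by (simp add: phi_def ps_eq_iff)
    moreover have "coef i (f - g) + coef i g = coef i f"
      using coef_add[OF fg assms(2), of i] by simp
    ultimately show ?thesis by simp
  qed
  then have "A.nf (f - g) = 0" by (rule coef_zero[OF fg])
  then show ?thesis using assms by (simp add: A.nf_diff)
qed

lemma phi_smult:
  assumes "b \<in> fa n" "g \<in> fa (Suc n)"
  shows "phi (b * g) = (\<lambda>k. ps b \<otimes> phi g k)"
  using assms(2)
proof (induction g rule: ext_induct)
  case (cong f g)
  have "A.nf (b * f) = A.nf (b * g)" using A_cong_left[OF cong(3)] cong assms by simp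
  then have "phi (b * f) = phi (b * g)" "phi f = phi g" using cong phi_cong by blast+
  then show ?case using cong by simp
next
  case (add f g)
  then show ?case
    using assms by (simp add: distrib_left phi_add Q.r_distr Q.coeffsD)
next
  case (mono b' i)
  have "phi (b * b' * D ^ i) = Q.cmon (ps b \<otimes> ps b') i"
    using mono assms by (simp add: phi_mono ps_mult)
  then show ?case
    using mono assms by (auto simp: phi_mono mult.assoc Q.cmon_def)
qed

text \<open>On \<open>b D ^ i\<close> the relation \<open>D b = sg b D + dl b\<close> produces
  exactly the two terms of \<open>ore_shift\<close>, because \<sigma> and \<delta> extend
  \<open>sg\<close> and \<open>dl\<close>.\<close>

lemma phi_D:
  assumes "g \<in> fa (Suc n)"
  shows "phi (D * g) = Q.T (phi g)"
  using assms
proof (induction g rule: ext_induct)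
  case (cong f g)
  have "A.nf (D * f) = A.nf (D * g)" using A_cong_left[OF cong(3)] cong by simp
  then have "phi (D * f) = phi (D * g)" "phi f = phi g" using cong phi_cong by blast+
  then show ?case using cong by simp
next
  case (add f g)
  then show ?case by (simp add: distrib_left phi_add Q.T_add)
next
  case (mono b i)
  have "A.nf (D * b * D ^ i) = A.nf ((sg b * D + dl b) * D ^ i)"
    by (rule A_cong_right[OF D_comm[OF mono]]) (use mono in simp_all)
  then have "phi (D * (b * D ^ i)) = phi (sg b * D ^ Suc i + dl b * D ^ i)"
    by (intro phi_cong) (simp add: distrib_right mult.assoc)
  also have "\<dots> = (\<lambda>k. Q.cmon (ps (sg b)) (Suc i) k \<oplus> Q.cmon (ps (dl b)) i k)"
    using mono by (simp add: phi_add phi_mono del: power_Suc)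
  also have "\<dots> = Q.T (Q.cmon (ps b) i)"
  proof
    fix k
    have "\<sigma> (ps b) = ps (sg b)" "\<delta> (ps b) = ps (dl b)" "ps (sg b) \<in> carrier Q" "ps (dl b) \<in> carrier Q"
      using mono sigma_psi delta_psi by (simp_all add: ps_def[symmetric])
    then show "Q.cmon (ps (sg b)) (Suc i) k \<oplus> Q.cmon (ps (dl b)) i k = Q.T (Q.cmon (ps b) i) k"
      by (cases k) (auto simp: ore_shift_def Q.cmon_def)
  qed
  finally show ?case using mono by (simp add: phi_mono)
qed

lemma phi_D_pow: "g \<in> fa (Suc n) \<Longrightarrow> phi (D ^ i * g) = (Q.T ^^ i) (phi g)"
  by (induction i) (simp_all add: mult.assoc phi_D)

lemma phi_mult:
  assumes "f \<in> fa (Suc n)" "g \<in> fa (Suc n)"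
  shows "phi (f * g) = Q.mul (phi f) (phi g)"
  using assms(1)
proof (induction f rule: ext_induct)
  case (cong f f')
  have "A.nf (f * g) = A.nf (f' * g)" using A_cong_right[OF cong(3)] cong assms by simp
  then have "phi (f * g) = phi (f' * g)" "phi f = phi f'" using cong phi_cong by blast+
  then show ?case using cong by simp
next
  case (add f f')
  then show ?case using assms by (simp add: distrib_right phi_add Q.mul_add_left)
next
  case (mono b i)
  have "phi (b * (D ^ i * g)) = Q.mul (Q.cmon (ps b) i) (phi g)"
    using mono assms by (simp add: phi_smult phi_D_pow Q.mul_cmon)
  then show ?case using mono by (simp add: phi_mono mult.assoc)
qed

definition Phi :: "'k ncpoly set \<Rightarrow> nat \<Rightarrow> 'q" where
  "Phi X = phi (A.rep X)"

lemma Phi_cls: "f \<in> fa (Suc n) \<Longrightarrow> Phi (A.cls f) = phi f"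
  unfolding Phi_def by (rule phi_cong) (rule A.nf_rep_cls)

lemma Phi_hom: "Phi \<in> ring_hom A.Alg E"
proof (rule ring_hom_memI)
  fix X Y assume "X \<in> carrier A.Alg" "Y \<in> carrier A.Alg"
  then obtain f g where fg: "f \<in> fa (Suc n)" "g \<in> fa (Suc n)" "X = A.cls f" "Y = A.cls g"
    by (auto simp: A.carrier_Alg)
  show "Phi X \<in> carrier E" using fg by (simp add: Phi_cls Q.ore_ext_simps)
  have "Phi (A.cls (f * g)) = Phi X \<otimes>\<^bsub>E\<^esub> Phi Y"
    using fg by (simp add: Phi_cls Q.ore_ext_simps phi_mult)
  then show "Phi (X \<otimes>\<^bsub>A.Alg\<^esub> Y) = Phi X \<otimes>\<^bsub>E\<^esub> Phi Y" using fg by (simp add: A.cls_mult)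
  have "Phi (A.cls (f + g)) = Phi X \<oplus>\<^bsub>E\<^esub> Phi Y"
    using fg by (simp add: Phi_cls Q.ore_ext_simps phi_add)
  then show "Phi (X \<oplus>\<^bsub>A.Alg\<^esub> Y) = Phi X \<oplus>\<^bsub>E\<^esub> Phi Y" using fg by (simp add: A.cls_add)
next
  show "Phi \<one>\<^bsub>A.Alg\<^esub> = \<one>\<^bsub>E\<^esub>"
    using Phi_cls[of 1] phi_const[of 1] by (simp add: A.cls_one Q.ore_ext_simps)
qed

lemma Phi_inj: "inj_on Phi (carrier A.Alg)"
proof (rule inj_onI)
  fix X Y assume XY: "X \<in> carrier A.Alg" "Y \<in> carrier A.Alg" "Phi X = Phi Y"
  then obtain f g where fg: "f \<in> fa (Suc n)" "g \<in> fa (Suc n)" "X = A.cls f" "Y = A.cls g"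
    by (auto simp: A.carrier_Alg)
  then have "phi f = phi g" using XY(3) by (simp add: Phi_cls)
  then have "A.nf f = A.nf g" by (rule phi_inj[OF fg(1,2)])
  then show "X = Y" unfolding fg(3,4) A.cls_eq_iff[OF fg(1,2)] .
qed

lemma Phi_const: "b \<in> fa n \<Longrightarrow> Phi (A.cls b) = ore_const Q (ps b)"
  by (simp add: Phi_cls phi_const Q.ore_const_cmon)

lemma Phi_unit: "s \<in> denoms \<Longrightarrow> Phi s \<in> Units E"
  using ring_hom_inv_Units[OF Q.ring_axioms Q.ring_ore_ext Q.const_hom ps_unit] Phi_const
  by (auto simp: denoms_eq)

text \<open>Induction on the degree bound: the denominator for the lower coefficients and that of
  the top coefficient have a common left multiple in B.\<close>

lemma clear_denominators:
  assumes "f \<in> up Q" "Q.bounded N f"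
  shows "\<exists>s\<in>fa n. \<exists>a\<in>fa (Suc n). B.nf s \<noteq> 0 \<and> phi a = (\<lambda>k. ps s \<otimes> f k)"
  using assms
proof (induction N arbitrary: f)
  case 0
  then have "f = (\<lambda>k. \<zero>)" by (auto simp: Q.bounded_def)
  moreover have "phi 0 = (\<lambda>k. \<zero>)" by (simp add: phi_def)
  ultimately show ?case by (intro bexI[of _ 1] bexI[of _ 0]) simp_all
next
  case (Suc N)
  have fc: "f k \<in> carrier Q" for k using Suc.prems(1) by blast
  define f' where "f' = (\<lambda>k. if k < N then f k else \<zero>)"
  have "f' \<in> Q.coeffs" "Q.bounded N f'" using fc by (auto simp: f'_def Q.coeffs_def Q.bounded_def)
  then obtain s a where s: "s \<in> fa n" "a \<in> fa (Suc n)" "B.nf s \<noteq> 0" "phi a = (\<lambda>k. ps s \<otimes> f' k)"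
    using Suc.IH[of f'] Q.up_iff by blast
  obtain t b where t: "t \<in> fa n" "b \<in> fa n" "B.nf t \<noteq> 0" "ps t \<otimes> f N = ps b"
    using ps_fraction[OF fc[of N]] by blast
  obtain u v where uv: "u \<in> fa n" "v \<in> fa n" "B.nf u \<noteq> 0" "B.nf (u * s) = B.nf (v * t)"
    using ps_left_ore[OF s(1) t(1,3)] by blast
  have eq: "ps (u * s) = ps (v * t)" using uv s(1) t(1) by (simp add: ps_eq_iff)
  \<comment> \<open>With the common denominator \<open>u s = v t\<close>, the lower part is scaled
    by \<open>u\<close> and the new top coefficient by \<open>v\<close>.\<close>
  let ?a = "u * a + v * b * D ^ N"
  have phi_a: "phi ?a = (\<lambda>k. ps u \<otimes> phi a k \<oplus> Q.cmon (ps (v * b)) N k)"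
    using phi_add[of "u * a" "v * b * D ^ N"] phi_smult[OF uv(1) s(2)] phi_mono[of "v * b" N]
      uv(1,2) s(2) t(2) by simp
  have "phi ?a = (\<lambda>k. ps (u * s) \<otimes> f k)"
  proof
    fix k
    have "phi ?a k = ps u \<otimes> (ps s \<otimes> f' k) \<oplus> Q.cmon (ps v \<otimes> (ps t \<otimes> f N)) N k"
      by (simp only: phi_a s(4) ps_mult[OF uv(2) t(2)] t(4))
    also have "\<dots> = ps (u * s) \<otimes> f' k \<oplus> Q.cmon (ps (v * t) \<otimes> f N) N k"
      using uv(1,2) s(1) t(1) fc by (simp add: ps_mult Q.m_assoc f'_def)
    also have "\<dots> = ps (u * s) \<otimes> f k"
      using Suc.prems(2) uv(1) s(1) fc
      by (auto simp: eq[symmetric] f'_def Q.cmon_def Q.bounded_def not_less_eq_eq)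
    finally show "phi ?a k = ps (u * s) \<otimes> f k" .
  qed
  moreover have "B.nf (u * s) \<noteq> 0" using B.nf_mult_nonzero uv s by blast
  ultimately show ?case using uv(1,2) s(1,2) t(1,2)
    by (intro bexI[of _ "u * s"] bexI[of _ ?a]) simp_all
qed

lemma ore_localization_E: "ore_localization A.Alg denoms E Phi"
  unfolding ore_localization_def
proof (intro conjI ballI)
  show "ring E" by (rule Q.ring_ore_ext)
  then interpret E: ring E .
  show "Phi \<in> ring_hom A.Alg E" by (rule Phi_hom)
  show "inj_on Phi (carrier A.Alg)" by (rule Phi_inj)
  show "Phi s \<in> Units E" if "s \<in> denoms" for s using that by (rule Phi_unit)
  fix f assume fE: "f \<in> carrier E"
  then have f: "f \<in> up Q" by (simp add: Q.ore_ext_simps)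
  then obtain N where "Q.bounded N f" using Q.up_iff by blast
  then obtain s a where sa: "s \<in> fa n" "a \<in> fa (Suc n)" "B.nf s \<noteq> 0" "phi a = (\<lambda>k. ps s \<otimes> f k)"
    using clear_denominators[OF f] by blast
  have S: "A.cls s \<in> denoms" using denomsI sa by blast
  have "Phi (A.cls s) \<otimes>\<^bsub>E\<^esub> f = Phi (A.cls a)"
    using sa f by (simp add: Phi_cls phi_const Q.ore_ext_simps Q.mul_cmon Q.up_coeffs)
  then have "f = inv\<^bsub>E\<^esub> Phi (A.cls s) \<otimes>\<^bsub>E\<^esub> Phi (A.cls a)"
    using E.m_assoc[OF E.Units_inv_closed E.Units_closed fE, OF Phi_unit[OF S] Phi_unit[OF S]]
      E.Units_l_inv[OF Phi_unit[OF S]] E.l_one[OF fE] by simp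
  then show "\<exists>s\<in>denoms. \<exists>a\<in>carrier A.Alg. f = inv\<^bsub>E\<^esub> Phi s \<otimes>\<^bsub>E\<^esub> Phi a"
    using S A.cls_closed[OF sa(2)] by blast
qed

text \<open>\<sigma> fixes scalars and \<delta> kills them, so linearity is a case of the twisted
  product rule.\<close>

lemma skew_derivation_delta: "skew_derivation (\<lambda>k. \<psi> (B.cls (scal k))) Q \<sigma> \<delta>"
proof -
  have "\<delta> (ps (scal k) \<otimes> a) = ps (scal k) \<otimes> \<delta> a" if "a \<in> carrier Q" for k a
  proof -
    have "\<sigma> (ps (scal k)) = ps (scal k)" "\<delta> (ps (scal k)) = \<zero>"
      using sigma_psi[of "scal k"] delta_psi[of "scal k"]
      by (simp_all add: sg_scal dl_scal ps_def[symmetric])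
    then show ?thesis using that by (simp add: Q.delta_mult)
  qed
  then show ?thesis
    unfolding skew_derivation_def ps_def[symmetric] using Q.delta_add Q.delta_mult by auto
qed

lemma Phi_D: "Phi (A.cls D) = ore_var Q"
  using phi_mono[of 1 1] by (simp add: Phi_cls Q.ore_var_cmon)

text \<open>Any localization is isomorphic over A to the one inside the Ore extension, so the images
  of B and \<partial> are those under \<open>Phi\<close>.\<close>

lemma iso_E:
  assumes "ore_localization A.Alg denoms L \<phi>"
  shows "\<exists>\<Phi>\<in>ring_iso L E. (\<forall>X\<in>carrier B.Alg. \<Phi> (\<phi> (galg_incl (Suc n) c d X)) = ore_const Q (\<psi> X)) \<and>
    \<Phi> (\<phi> (A.cls D)) = ore_var Q"
proof -
  obtain \<Phi> where P: "\<Phi> \<in> ring_iso L E" "\<And>X. X \<in> carrier A.Alg \<Longrightarrow> \<Phi> (\<phi> X) = Phi X"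
    using ore_localization_unique[OF A.ring_Alg denoms_submonoid assms ore_localization_E] by blast
  have "\<Phi> (\<phi> (galg_incl (Suc n) c d X)) = ore_const Q (\<psi> X)" if X: "X \<in> carrier B.Alg" for X
  proof -
    obtain b where b: "b \<in> fa n" "X = B.cls b" using X by (auto simp: B.carrier_Alg)
    then show ?thesis
      using P(2)[of "A.cls b"] Phi_const[of b] by (simp add: incl_cls A.cls_closed ps_def)
  qed
  moreover have "\<Phi> (\<phi> (A.cls D)) = ore_var Q" using P(2)[of "A.cls D"] by (simp add: Phi_D A.cls_closed)
  ultimately show ?thesis using P(1) by blast
qed

end

theorem theorem2p6:
  fixes n :: nat
    and c :: "nat \<Rightarrow> nat \<Rightarrow> 'k::field"
    and d :: "nat \<Rightarrow> nat \<Rightarrow> 'k cpoly"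
  defines "A \<equiv> galg (Suc n) c d"
    and "B \<equiv> galg n c d"
    and "\<iota> \<equiv> galg_incl (Suc n) c d"
    and "x\<^sub>D \<equiv> galg_class (Suc n) c d (var (Suc n))"
  defines "Bs \<equiv> \<iota> ` (carrier B - {\<zero>\<^bsub>B\<^esub>})"
  assumes "is_galg (Suc n) c d"
    and "is_galg n c d"
    and "\<exists>r. admissible_ordering (Suc n) d r \<and>
             (\<forall>k\<in>{1..n}. (var_exp k, var_exp (Suc n)) \<in> r - Id)"
  shows "ore_set A Bs \<and>
    (\<forall>(Q :: 'q ring) \<psi>. quot_ring B Q \<psi> \<longrightarrow>
      (\<exists>\<sigma> \<delta>. \<sigma> \<in> ring_hom Q Q \<and>
         skew_derivation (\<lambda>k. \<psi> (galg_class n c d (scal k))) Q \<sigma> \<delta> \<and>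
         (\<exists>\<phi>. ore_localization A Bs (ore_ext Q \<sigma> \<delta>) \<phi>) \<and>
         (\<forall>(L :: 'l ring) \<phi>. ore_localization A Bs L \<phi> \<longrightarrow>
            (\<exists>\<Phi>\<in>ring_iso L (ore_ext Q \<sigma> \<delta>).
               (\<forall>b\<in>carrier B. \<Phi> (\<phi> (\<iota> b)) = ore_const Q (\<psi> b)) \<and>
               \<Phi> (\<phi> x\<^sub>D) = ore_var Q))))"
proof -
  obtain r where r: "admissible_ordering (Suc n) d r"
    "\<forall>k\<in>{1..n}. (var_exp k, var_exp (Suc n)) \<in> r - Id" using assms(8) by blast
  \<comment> \<open>B brings an ordering of its own as part of being a G-algebra, so
    \<open>r\<close> need not be restricted to fewer variables.\<close>
  obtain r' where r': "admissible_ordering n d r'" using assms(7) by (auto simp: is_galg_def)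
  interpret A: galg_pbw "Suc n" c d r by unfold_locales (fact assms(6), fact r(1))
  interpret galg_ext n c d r r'
    by unfold_locales (use assms(7) r' r(2) in \<open>auto simp: A.lt_def\<close>)
  have Bs: "Bs = denoms" by (simp add: Bs_def \<iota>_def B_def denoms_def)
  have "\<exists>\<sigma> \<delta>. \<sigma> \<in> ring_hom Q Q \<and> skew_derivation (\<lambda>k. \<psi> (galg_class n c d (scal k))) Q \<sigma> \<delta> \<and>
      (\<exists>\<phi>. ore_localization A Bs (ore_ext Q \<sigma> \<delta>) \<phi>) \<and>
      (\<forall>(L :: 'l ring) \<phi>. ore_localization A Bs L \<phi> \<longrightarrow>
        (\<exists>\<Phi>\<in>ring_iso L (ore_ext Q \<sigma> \<delta>).
          (\<forall>b\<in>carrier B. \<Phi> (\<phi> (\<iota> b)) = ore_const Q (\<psi> b)) \<and> \<Phi> (\<phi> x\<^sub>D) = ore_var Q))"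
    if Q: "quot_ring B Q \<psi>" for Q :: "'q ring" and \<psi>
  proof -
    obtain \<sigma> \<delta> where *: "skew_ring Q \<sigma> \<delta>"
      "\<forall>b\<in>fa n. \<sigma> (\<psi> (B.cls b)) = \<psi> (B.cls (sg b)) \<and> \<delta> (\<psi> (B.cls b)) = \<psi> (B.cls (dl b))"
      using derivation_of_quot_ring[OF Q[unfolded B_def]] by blast
    interpret Q: skew_ring Q \<sigma> \<delta> by (rule *(1))
    interpret galg_ore_ext n c d r r' Q \<sigma> \<delta> \<psi>
      by unfold_locales (use * Q in \<open>auto simp: quot_ring_def B_def\<close>)
    show ?thesis
      unfolding Bs A_def B_def \<iota>_def x\<^sub>D_def
      using Q.sigma skew_derivation_delta ore_localization_E iso_E
      by (intro exI[of _ \<sigma>] exI[of _ \<delta>] conjI allI impI) blast+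
  qed
  then show ?thesis using denoms_ore_set by (simp add: Bs A_def)
qed

end
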